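(* Let $a\in C^2(\mathbf{R})$ satisfy $a''(v)\ge\alpha_0>0$ for all $v\in\mathbf{R}$, and let $u^{in}\in L^\infty(\mathbf{R})$. Let $u\in L^\infty(\mathbf{R}_+\times\mathbf{R})$ be a bounded weak solution of the Cauchy problem $$\partial_t u+\partial_x a(u)=0\quad (t>0,\ x\in\mathbf{R}),\qquad u|_{t=0}=u^{in},$$ such that for each convex entropy $\eta\in C^1(\mathbf{R})$ one has, in the sense of distributions, $$\partial_t\eta(u)+\partial_x q(u)=-\mu,$$ where $q(v)=\int^v\eta'(w)a'(w)\,dw$ is the associated entropy flux and $\mu$ (which may depend on $\eta$) is a signed Radon measure on $\mathbf{R}_+\times\mathbf{R}$. Then $u\in B^{1/3,3}_{\infty,loc}((0,\infty)\times\mathbf{R})$.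
   Context: For an open set $\Omega\subset\mathbf{R}^2$, $0<s<1$ and $1\le p<\infty$, a function $g\in L^p_{loc}(\Omega)$ belongs to the local Besov space $B^{s,p}_{\infty,loc}(\Omega)$ if for every compact $K\subset\Omega$ there exist $C,h_0>0$ such that $\int_K|g(z+h)-g(z)|^p\,dz\le C|h|^{sp}$ for all $h\in\mathbf{R}^2$ with $|h|\le h_0$. The entropy production $\mu$ is not assumed to have a sign. *)

theory Defs
  imports "HOL-Analysis.Analysis"
begin

definition pd_t :: "(real \<times> real \<Rightarrow> real) \<Rightarrow> real \<times> real \<Rightarrow> real" where
  "pd_t f = (\<lambda>(t, x). deriv (\<lambda>s. f (s, x)) t)"

definition pd_x :: "(real \<times> real \<Rightarrow> real) \<Rightarrow> real \<times> real \<Rightarrow> real" where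
  "pd_x f = (\<lambda>(t, x). deriv (\<lambda>y. f (t, y)) x)"

fun iter_pd :: "bool list \<Rightarrow> (real \<times> real \<Rightarrow> real) \<Rightarrow> real \<times> real \<Rightarrow> real" where
  "iter_pd [] f = f"
| "iter_pd (b # bs) f = (if b then pd_t else pd_x) (iter_pd bs f)"

definition smooth2 :: "(real \<times> real \<Rightarrow> real) \<Rightarrow> bool" where
  "smooth2 f \<longleftrightarrow> (\<forall>bs. continuous_on UNIV (iter_pd bs f) \<and>
     (\<forall>t x. (\<lambda>s. iter_pd bs f (s, x)) differentiable (at t) \<and>
            (\<lambda>y. iter_pd bs f (t, y)) differentiable (at x)))"

definition tsupp :: "(real \<times> real \<Rightarrow> real) \<Rightarrow> (real \<times> real) set" where
  "tsupp f = closure {z. f z \<noteq> 0}"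

definition test_fun :: "(real \<times> real) set \<Rightarrow> (real \<times> real \<Rightarrow> real) \<Rightarrow> bool" where
  "test_fun \<Omega> \<phi> \<longleftrightarrow> smooth2 \<phi> \<and> compact (tsupp \<phi>) \<and> tsupp \<phi> \<subseteq> \<Omega>"

text \<open>Positive Radon measure on an open set Omega: Borel measure, finite on compact subsets of Omega.
  A signed Radon measure is represented by its Jordan decomposition (mu_plus, mu_minus).\<close>
definition radon_on :: "(real \<times> real) set \<Rightarrow> (real \<times> real) measure \<Rightarrow> bool" where
  "radon_on \<Omega> M \<longleftrightarrow> sets M = sets borel \<and>
     (\<forall>K. compact K \<and> K \<subseteq> \<Omega> \<longrightarrow> emeasure M K < \<infinity>)"

definition besov_loc :: "real \<Rightarrow> real \<Rightarrow> (real \<times> real) set \<Rightarrow> (real \<times> real \<Rightarrow> real) \<Rightarrow> bool" where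
  "besov_loc s p \<Omega> g \<longleftrightarrow>
     g \<in> borel_measurable lebesgue \<and>
     (\<forall>K. compact K \<and> K \<subseteq> \<Omega> \<longrightarrow> set_integrable lborel K (\<lambda>z. \<bar>g z\<bar> powr p)) \<and>
     (\<forall>K. compact K \<and> K \<subseteq> \<Omega> \<longrightarrow>
        (\<exists>C h0. C > 0 \<and> h0 > 0 \<and>
          (\<forall>h. norm h \<le> h0 \<longrightarrow>
             (LINT z:K|lborel. \<bar>g (z + h) - g z\<bar> powr p) \<le> C * norm h powr (s * p))))"

end

theory Submission
  imports Defs "HOL-Computational_Algebra.Polynomial"
begin

text \<open>Choose entropies \<open>\<eta>\<^sub>i\<close> whose derivatives are ramps rising from 0 to 1 on consecutive cells of a grid of mesh
  \<open>\<delta> \<le> \<bar>h\<bar>\<close>, put \<open>V\<^sub>i = (\<eta>\<^sub>i(u), q\<^sub>i(u))\<close>, and let \<open>\<Delta>\<close> be the increment by \<open>h\<close>. Uniform convexity of the flux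
  gives the pointwise bound \<open>\<Sum>\<^sub>i det (\<Delta> V\<^sub>i, \<Delta> V\<^sub>i\<^sub>+\<^sub>1) \<ge> \<alpha> (\<bar>\<Delta> u\<bar>\<^sup>3 / 6 - \<delta> \<bar>\<Delta> u\<bar>\<^sup>2)\<close>. In the other direction, up to
  cutoff terms \<open>\<integral> det (\<Delta> V, \<Delta> W)\<close> is a pairing of \<open>div V\<close> with \<open>W\<close> plus a pairing of \<open>div W\<close> with \<open>V\<close>, each
  of size \<open>\<bar>h\<bar>\<close>. Applied to \<open>V\<^sub>i\<close> and \<open>V\<^sub>i\<^sub>+\<^sub>1 - V\<^sub>i = O(\<delta>)\<close> and summed by parts over the \<open>O(1/\<delta>)\<close> indices, this is
  \<open>O(\<bar>h\<bar>)\<close>, because the measures \<open>div V\<^sub>i\<close> have uniformly bounded mass on compact sets. The uniformity comes from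
  Baire's theorem on the cone of bounded nondecreasing \<open>\<eta>'\<close>.\<close>

section \<open>Uniform boundedness on a cone and parameter integrals\<close>

text \<open>Since \<mu> has no sign, testing with a cutoff does not bound its mass, and the masses
  for different entropies are a priori unrelated. The link is linearity in \<eta>'; only convex
  \<eta> are admissible, hence a cone instead of a Banach space. The resulting bound is O(1) for
  each ramp and gains nothing for the difference of neighbouring ramps, whose sup norm is of order
  1, although their fields are O(\<delta>) close. Estimating the pairings with div (V_{i+1} - V_i)
  one index at a time would therefore give O(|h| / \<delta>), which is no decay at all when \<delta>
  is of order |h|. The cubic term is \<alpha> times the integral of w - v over r < v < w < s: the
  sum of the 2 x 2 minors of neighbouring ramps at v and w acts as a discrete indicator of v < w,
  reliable once w - v reaches two cells. What is lost below that scale is the \<delta>-term, of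
  order |h| after integration. As u is only bounded and measurable, the identity is applied to
  mollified fields, with bounds independent of the radius, which tends to 0 for fixed h.\<close>

lemma uniform_boundedness_on_cone:
  fixes S :: "'a::{real_normed_vector, complete_space} set" and \<T> :: "('a \<Rightarrow> real) set"
  assumes "closed S" and S0: "0 \<in> S"
    and add: "\<And>x y. x \<in> S \<Longrightarrow> y \<in> S \<Longrightarrow> x + y \<in> S"
    and scale: "\<And>x c. x \<in> S \<Longrightarrow> 0 \<le> c \<Longrightarrow> c *\<^sub>R x \<in> S"
    and lin: "\<And>T. T \<in> \<T> \<Longrightarrow> bounded_linear T"
    and bdd: "\<And>x. x \<in> S \<Longrightarrow> \<exists>B. \<forall>T\<in>\<T>. \<bar>T x\<bar> \<le> B"
  shows "\<exists>C\<ge>0. \<forall>x\<in>S. \<forall>T\<in>\<T>. \<bar>T x\<bar> \<le> C * norm x"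
proof -
  \<comment> \<open>Level sets of the pointwise bound. They are closed and exhaust the complete
    space \<open>S\<close>, so by Baire one of them contains a relative neighbourhood of some point
    \<open>x0\<close>.\<close>
  define F where "F n = {x\<in>S. \<forall>T\<in>\<T>. \<bar>T x\<bar> \<le> real n}" for n :: nat
  have F_closed: "closed (F n)" for n
  proof -
    have "F n = S \<inter> (\<Inter>T\<in>\<T>. {x. \<bar>T x\<bar> \<le> real n})" by (auto simp: F_def)
    moreover have "closed {x. \<bar>T x\<bar> \<le> real n}" if "T \<in> \<T>" for T
      using lin[OF that]
      by (intro closed_Collect_le continuous_intros linear_continuous_on)
    ultimately show ?thesis using \<open>closed S\<close> by (auto intro!: closed_Int closed_INT)
  qed
  have "S \<subseteq> \<Union>(range F)"
  proof
    fix x assume "x \<in> S"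
    then obtain B where B: "\<forall>T\<in>\<T>. \<bar>T x\<bar> \<le> B" using bdd by blast
    obtain n where "B \<le> real n" using real_arch_simple by blast
    then have "\<forall>T\<in>\<T>. \<bar>T x\<bar> \<le> real n" using B by (meson order_trans)
    then have "x \<in> F n" using \<open>x \<in> S\<close> by (simp add: F_def)
    then show "x \<in> \<Union>(range F)" by blast
  qed
  then have cover: "\<Union>(range F) = S" by (auto simp: F_def)
  have "completely_metrizable_space (top_of_set S)"
    using \<open>closed S\<close> completely_metrizable_space_closedin completely_metrizable_space_euclidean closed_closedin
    by blast
  then have *: "(\<And>B. B \<in> range F \<Longrightarrow> closedin (top_of_set S) B \<and> (top_of_set S) interior_of B = {})
      \<Longrightarrow> (top_of_set S) interior_of S = {}"
    using Baire_category_alt[of "top_of_set S" "range F"] cover by simp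
  have "closedin (top_of_set S) (F n)" for n
    using F_closed by (intro closed_subset) (auto simp: F_def)
  moreover have "(top_of_set S) interior_of S \<noteq> {}"
    using S0 interior_of_topspace[of "top_of_set S"] by auto
  ultimately have "\<exists>n. (top_of_set S) interior_of (F n) \<noteq> {}"
    using * by blast
  then obtain n x0 U where U: "openin (top_of_set S) U" "x0 \<in> U" "U \<subseteq> F n"
    unfolding interior_of_def by blast
  then obtain r where r: "r > 0" "\<And>y. y \<in> S \<Longrightarrow> dist y x0 < r \<Longrightarrow> y \<in> F n"
    unfolding openin_euclidean_subtopology_iff by blast
  have x0: "x0 \<in> S" "x0 \<in> F n" using U by (auto simp: F_def)
  have "\<bar>T x\<bar> \<le> (4 * real n / r) * norm x" if "x \<in> S" "T \<in> \<T>" for x T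
  proof (cases "x = 0")
    case True
    then show ?thesis using lin[OF that(2)] by (simp add: linear_0 bounded_linear.linear)
  next
    case False
    interpret T: bounded_linear T using lin that(2) .
    \<comment> \<open>Scaled so that \<open>c *\<^sub>R x\<close> has norm r / 2. The point x0 - c x
      may leave the cone, so \<open>T x\<close> is recovered from the values at
      \<open>x0 + c *\<^sub>R x\<close> and \<open>x0\<close>, which costs a factor 2.\<close>
    define c where "c = r / (2 * norm x)"
    have c: "c > 0" using r False by (simp add: c_def)
    have "norm (c *\<^sub>R x) < r" using r False by (simp add: c_def)
    then have "x0 + c *\<^sub>R x \<in> F n"
      using r(2) add[OF x0(1) scale[OF that(1), of c]] c by (simp add: dist_norm)
    then have "\<bar>T x0 + c * T x\<bar> \<le> real n" "\<bar>T x0\<bar> \<le> real n"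
      using x0(2) that(2) by (auto simp: F_def T.add T.scaleR)
    then have "\<bar>c * T x\<bar> \<le> 2 * real n" by linarith
    then have "\<bar>T x\<bar> \<le> 2 * real n / c"
      using c by (simp add: abs_mult field_simps)
    also have "\<dots> = (4 * real n / r) * norm x" using r False by (simp add: c_def field_simps)
    finally show ?thesis .
  qed
  moreover have "4 * real n / r \<ge> 0" using r by simp
  ultimately show ?thesis by blast
qed

section \<open>Taylor remainders and differentiation of parameter integrals\<close>

lemma first_order_remainder:
  fixes f f' f'' :: "real \<Rightarrow> real"
  assumes "\<And>x. (f has_real_derivative f' x) (at x)" "\<And>x. (f' has_real_derivative f'' x) (at x)"
    and "\<And>x. \<bar>f'' x\<bar> \<le> C"
  shows "\<bar>f s - f t - (s - t) * f' t\<bar> \<le> C * (s - t)\<^sup>2"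
proof -
  have lip: "\<bar>f' x - f' y\<bar> \<le> C * \<bar>x - y\<bar>" for x y
    using field_differentiable_bound[of UNIV f' f'' C x y] assms by simp
  have "C \<ge> 0" using assms(3)[of 0] by linarith
  have "norm ((f s - s * f' t) - (f t - t * f' t)) \<le> C * \<bar>s - t\<bar> * norm (s - t)"
  proof (rule field_differentiable_bound[of "closed_segment s t" "\<lambda>x. f x - x * f' t" "\<lambda>x. f' x - f' t"])
    show "((\<lambda>x. f x - x * f' t) has_real_derivative f' x - f' t) (at x within closed_segment s t)" for x
      by (rule derivative_eq_intros DERIV_subset[OF assms(1)] refl | simp)+
    fix x assume x: "x \<in> closed_segment s t"
    have "\<bar>f' x - f' t\<bar> \<le> C * \<bar>x - t\<bar>" by (rule lip)
    also have "\<dots> \<le> C * \<bar>s - t\<bar>" using x \<open>C \<ge> 0\<close>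
      by (intro mult_left_mono) (auto simp: closed_segment_eq_real_ivl split: if_splits)
    finally show "norm (f' x - f' t) \<le> C * \<bar>s - t\<bar>" by simp
  qed auto
  then show ?thesis
    by (simp add: algebra_simps power2_eq_square abs_mult_self_eq mult.assoc)
qed

text \<open>A remainder quadratic in s - t with an integrable factor bounds the error of the
  difference quotient by |h| times the integral of \<open>G\<close>. This form suits both the
  kernels, through \<open>first_order_remainder\<close>, and the motion along the segment from z to
  z + h.\<close>

lemma has_real_derivative_integral:
  fixes F :: "real \<Rightarrow> 'a \<Rightarrow> real"
  assumes F: "\<And>s. integrable M (F s)" and F': "integrable M F'" and G: "integrable M G"
    and rem: "\<And>s y. \<bar>s - t\<bar> \<le> 1 \<Longrightarrow> \<bar>F s y - F t y - (s - t) * F' y\<bar> \<le> (s - t)\<^sup>2 * G y"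
  shows "((\<lambda>s. integral\<^sup>L M (F s)) has_real_derivative integral\<^sup>L M F') (at t)"
proof -
  let ?I = "\<lambda>s. integral\<^sup>L M (F s)"
  have *: "\<bar>?I s - ?I t - (s - t) * integral\<^sup>L M F'\<bar> \<le> (s - t)\<^sup>2 * integral\<^sup>L M G" if "\<bar>s - t\<bar> \<le> 1" for s
  proof -
    have "?I s - ?I t - (s - t) * integral\<^sup>L M F' = (\<integral>y. F s y - F t y - (s - t) * F' y \<partial>M)"
      using F F' by simp
    also have "\<bar>\<dots>\<bar> \<le> (\<integral>y. (s - t)\<^sup>2 * G y \<partial>M)"
      using F F' G rem[OF that] by (intro order_trans[OF integral_abs_bound integral_mono]) auto
    finally show ?thesis using G by simp
  qed
  have "((\<lambda>h. (?I (t + h) - ?I t) / h - integral\<^sup>L M F') \<longlongrightarrow> 0) (at 0)"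
  proof (rule Lim_null_comparison)
    have "norm ((?I (t + h) - ?I t) / h - integral\<^sup>L M F') \<le> \<bar>h\<bar> * integral\<^sup>L M G"
      if "h \<noteq> 0" "\<bar>h\<bar> < 1" for h
    proof -
      have "(?I (t + h) - ?I t) / h - integral\<^sup>L M F' = (?I (t + h) - ?I t - h * integral\<^sup>L M F') / h"
        using that by (simp add: field_simps)
      also have "norm \<dots> \<le> h\<^sup>2 * integral\<^sup>L M G / \<bar>h\<bar>"
        using *[of "t + h"] that by (simp add: abs_divide divide_right_mono)
      also have "\<dots> = \<bar>h\<bar> * integral\<^sup>L M G" using that by (simp add: field_simps power2_eq_square abs_if)
      finally show ?thesis .
    qed
    then show "\<forall>\<^sub>F h in at 0. norm ((?I (t + h) - ?I t) / h - integral\<^sup>L M F') \<le> \<bar>h\<bar> * integral\<^sup>L M G"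
      unfolding eventually_at by (auto intro!: exI[of _ 1])
    show "((\<lambda>h. \<bar>h\<bar> * integral\<^sup>L M G) \<longlongrightarrow> 0) (at 0)"
      by (auto intro!: tendsto_eq_intros)
  qed
  then show ?thesis
    unfolding DERIV_def by (simp add: LIM_zero_iff)
qed

section \<open>Mollifiers\<close>

text \<open>The profile exp(-1/(1 - x^2)) with a rational factor. The family is closed under
  differentiation, so all derivatives of the mollifier are explicit.\<close>

definition bump :: "real poly \<Rightarrow> nat \<Rightarrow> real \<Rightarrow> real" where
  "bump p k x = (if \<bar>x\<bar> < 1 then poly p x / (1 - x\<^sup>2) ^ k * exp (- 1 / (1 - x\<^sup>2)) else 0)"

text \<open>The numerator of the derivative of \<open>bump p k\<close> over the denominator \<open>(1 - x\<^sup>2) ^ (k + 2)\<close>.\<close>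

definition bump_deriv :: "real poly \<Rightarrow> nat \<Rightarrow> real poly" where
  "bump_deriv p k = pderiv p * [:1, 0, -1:]\<^sup>2 + [:0, 2 * real k:] * p * [:1, 0, -1:] - [:0, 2:] * p"

text \<open>The single term of order k + 2 in the exponential series gives exp(-1/w) \<le> (k+2)!
  w^(k+2) with w = 1 - x^2. It absorbs the pole of order k and leaves w^2, which makes the
  derivative vanish at x = 1 and x = -1.\<close>

lemma bump_quadratic_bound: "\<exists>C\<ge>0. \<forall>x. \<bar>x\<bar> < 1 \<longrightarrow> \<bar>bump p k x\<bar> \<le> C * (1 - x\<^sup>2)\<^sup>2"
proof -
  have "continuous_on {-1..1} (poly p)" by (intro continuous_intros)
  then have "bounded (poly p ` {-1..1})" by (intro compact_imp_bounded compact_continuous_image) auto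
  then obtain B where "\<forall>y\<in>poly p ` {-1..1}. norm y \<le> B" by (meson bounded_iff)
  then have B: "\<bar>poly p x\<bar> \<le> B" if "x \<in> {-1..1}" for x using that by simp
  have "B \<ge> 0" using order_trans[OF abs_ge_zero B[of 0]] by simp
  have "\<bar>bump p k x\<bar> \<le> (B * fact (k + 2)) * (1 - x\<^sup>2)\<^sup>2" if x: "\<bar>x\<bar> < 1" for x
  proof -
    define w where "w = 1 - x\<^sup>2"
    have w: "w > 0" using x by (simp add: w_def abs_square_less_1)
    have "(\<Sum>n\<in>{k + 2}. (1 / w) ^ n /\<^sub>R fact n) \<le> exp (1 / w)"
      unfolding exp_def using w by (intro sum_le_suminf summable_exp_generic) auto
    moreover define F :: real where "F = fact (k + 2)"
    moreover define W where "W = w ^ (k + 2)"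
    moreover have "(\<Sum>n\<in>{k + 2}. (1 / w) ^ n /\<^sub>R fact n) = 1 / (W * F)"
      unfolding F_def W_def by (simp only: sum.insert finite.emptyI empty_iff sum.empty add_0_right not_False_eq_True
        real_scaleR_def power_one_over inverse_eq_divide times_divide_times_eq mult_1_left mult.commute)
    ultimately have "1 / (W * F) \<le> exp (1 / w)" by simp
    moreover have "F > 0" "W > 0" using w by (auto simp: F_def W_def)
    ultimately have "exp (- 1 / w) \<le> F * W"
      by (simp add: exp_minus field_simps)
    then have "exp (- 1 / w) \<le> fact (k + 2) * w ^ (k + 2)" by (simp add: F_def W_def)
    moreover have "\<bar>poly p x\<bar> \<le> B" using x by (intro B) auto
    ultimately have "\<bar>poly p x\<bar> / w ^ k * exp (- 1 / w) \<le> B / w ^ k * (fact (k + 2) * w ^ (k + 2))"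
      using w \<open>B \<ge> 0\<close> by (intro mult_mono divide_right_mono) auto
    also have "\<dots> = (B * fact (k + 2)) * w\<^sup>2"
      using w by (simp add: power_add power2_eq_square)
    finally show ?thesis using x w by (simp add: bump_def w_def[symmetric] abs_mult)
  qed
  then show ?thesis using \<open>B \<ge> 0\<close> by (intro exI[of _ "B * fact (k + 2)"]) auto
qed

lemma bump_has_derivative:
  "(bump p k has_real_derivative bump (bump_deriv p k) (k + 2) x) (at x)"
proof -
  consider "\<bar>x\<bar> < 1" | "\<bar>x\<bar> > 1" | "\<bar>x\<bar> = 1" by linarith
  then show ?thesis
  proof cases
    case 1
    define w where "w = 1 - x\<^sup>2"
    have w: "w > 0" using 1 by (simp add: w_def abs_square_less_1)
    have "((\<lambda>x. poly p x / (1 - x\<^sup>2) ^ k * exp (- 1 / (1 - x\<^sup>2))) has_real_derivative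
        bump (bump_deriv p k) (k + 2) x) (at x)"
    proof -
      have "((\<lambda>x. poly p x / (1 - x\<^sup>2) ^ k * exp (- 1 / (1 - x\<^sup>2))) has_real_derivative
        (poly (pderiv p) x * w ^ k - poly p x * (real k * w ^ (k - 1) * (- (2 * x)))) / (w ^ k * w ^ k) * exp (- 1 / w)
          + exp (- 1 / w) * (- (2 * x) / (w * w)) * (poly p x / w ^ k)) (at x)"
        unfolding w_def
        by (rule derivative_eq_intros refl | use w in \<open>simp add: w_def\<close>)+
      also have "(poly (pderiv p) x * w ^ k - poly p x * (real k * w ^ (k - 1) * (- (2 * x)))) / (w ^ k * w ^ k) * exp (- 1 / w)
          + exp (- 1 / w) * (- (2 * x) / (w * w)) * (poly p x / w ^ k) = bump (bump_deriv p k) (k + 2) x"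
      proof -
        have "poly (bump_deriv p k) x = poly (pderiv p) x * w\<^sup>2 + 2 * real k * x * poly p x * w - 2 * x * poly p x"
          by (simp add: bump_deriv_def w_def power2_eq_square algebra_simps)
        then have *: "bump (bump_deriv p k) (k + 2) x =
            (poly (pderiv p) x * w\<^sup>2 + 2 * real k * x * poly p x * w - 2 * x * poly p x) / w ^ (k + 2) * exp (- 1 / w)"
          using 1 by (simp add: bump_def w_def)
        show ?thesis unfolding * using w
          by (cases k) (simp_all add: divide_simps power2_eq_square, simp_all add: algebra_simps)
      qed
      finally show ?thesis .
    qed
    moreover have "\<forall>\<^sub>F y in nhds x. bump p k y = poly p y / (1 - y\<^sup>2) ^ k * exp (- 1 / (1 - y\<^sup>2))"
      by (rule eventually_mono[OF eventually_nhds_in_open[of "{-1<..<1}" x]]) (use 1 in \<open>auto simp: bump_def\<close>)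
    ultimately show ?thesis
      by (subst DERIV_cong_ev[OF refl _ refl]) auto
  next
    case 2
    have "\<forall>\<^sub>F y in nhds x. bump p k y = 0"
      by (rule eventually_mono[OF eventually_nhds_in_open[of "- {-1..1}" x]]) (use 2 in \<open>auto simp: bump_def open_Compl\<close>)
    then have "(bump p k has_real_derivative 0) (at x)"
      using DERIV_cong_ev[OF refl _ refl, of "bump p k" "\<lambda>_. 0" x 0] by simp
    then show ?thesis using 2 by (simp add: bump_def)
  next
    case 3
    obtain C where C: "C \<ge> 0" "\<And>y. \<bar>y\<bar> < 1 \<Longrightarrow> \<bar>bump p k y\<bar> \<le> C * (1 - y\<^sup>2)\<^sup>2"
      using bump_quadratic_bound by blast
    \<comment> \<open>At a boundary point 1 - (x + h)^2 = - h (2 x + h) with |2 x + h| \<le> 3, so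
      the quadratic bound in 1 - x^2 becomes one in h; the factor 9 is 3^2.\<close>
    have bd: "\<bar>bump p k (x + h)\<bar> \<le> C * (9 * h\<^sup>2)" if "\<bar>h\<bar> < 1" for h
    proof (cases "\<bar>x + h\<bar> < 1")
      case True
      have "1 - (x + h)\<^sup>2 = - h * (2 * x + h)" using 3 
        by (simp add: power2_eq_square algebra_simps abs_if split: if_splits)
      moreover have "(2 * x + h)\<^sup>2 \<le> 3\<^sup>2" using 3 that by (intro abs_le_square_iff[THEN iffD1]) linarith
      ultimately have "(1 - (x + h)\<^sup>2)\<^sup>2 \<le> h\<^sup>2 * 3\<^sup>2"
        by (simp add: power_mult_distrib mult_left_mono)
      then have "C * (1 - (x + h)\<^sup>2)\<^sup>2 \<le> C * (9 * h\<^sup>2)" using C(1) by (intro mult_left_mono) auto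
      with C(2)[OF True] show ?thesis by linarith
    next
      case False
      then show ?thesis using C(1) by (simp add: bump_def)
    qed
    have x0: "bump p k x = 0" "bump (bump_deriv p k) (k + 2) x = 0" using 3 by (auto simp: bump_def)
    have "((\<lambda>h. (bump p k (x + h) - bump p k x) / h) \<longlongrightarrow> 0) (at 0)"
    proof (rule Lim_null_comparison)
      have "norm ((bump p k (x + h) - bump p k x) / h) \<le> 9 * C * \<bar>h\<bar>" if "h \<noteq> 0" "\<bar>h\<bar> < 1" for h
        using bd[OF that(2)] that(1) x0 
        by (simp add: abs_divide divide_le_eq power2_eq_square algebra_simps)
      then show "\<forall>\<^sub>F h in at 0. norm ((bump p k (x + h) - bump p k x) / h) \<le> 9 * C * \<bar>h\<bar>"
        unfolding eventually_at by (auto intro!: exI[of _ 1])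
    qed (auto intro!: tendsto_eq_intros)
    then show ?thesis using x0 unfolding DERIV_def by simp
  qed
qed

text \<open>All derivatives are kept as one sequence, \<open>\<beta> n\<close> being the n-th, so
  that differentiating a convolution is an index shift. Evenness makes mollification symmetric under
  the integral pairing.\<close>

locale mollifier =
  fixes \<beta> :: "nat \<Rightarrow> real \<Rightarrow> real" and \<epsilon> :: real
  assumes eps_pos: "\<epsilon> > 0"
    and deriv: "\<And>n x. (\<beta> n has_real_derivative \<beta> (Suc n) x) (at x)"
    and supp: "\<And>n x. \<epsilon> \<le> \<bar>x\<bar> \<Longrightarrow> \<beta> n x = 0"
    and nonneg: "\<And>x. 0 \<le> \<beta> 0 x"
    and even: "\<And>x. \<beta> 0 (- x) = \<beta> 0 x"
    and integral_1: "(LINT x|lborel. \<beta> 0 x) = 1"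

lemma mollifier_exists:
  assumes "\<epsilon> > 0"
  shows "\<exists>\<beta>. mollifier \<beta> \<epsilon>"
proof -
  \<comment> \<open>Each derivative raises the exponent of the denominator by 2, whence 2 n after n
    steps.\<close>
  define p where "p = rec_nat (1 :: real poly) (\<lambda>n q. bump_deriv q (2 * n))"
  define b where "b n = bump (p n) (2 * n)" for n
  have p: "p 0 = 1" "p (Suc n) = bump_deriv (p n) (2 * n)" for n by (auto simp: p_def)
  have db: "(b n has_real_derivative b (Suc n) x) (at x)" for n x
    using bump_has_derivative[of "p n" "2 * n" x] by (simp add: b_def p)
  have b0: "b 0 x = (if \<bar>x\<bar> < 1 then exp (- 1 / (1 - x\<^sup>2)) else 0)" for x
    by (simp add: b_def p bump_def)
  have cont: "continuous_on A (b n)" for n A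
    using db DERIV_isCont continuous_at_imp_continuous_on by blast
  have int: "integrable lborel (b 0)"
  proof -
    have "integrable lborel (\<lambda>x. indicator {-1..1} x *\<^sub>R b 0 x)"
      using borel_integrable_compact[of "{-1..1}" "b 0"] cont by simp
    moreover have "(\<lambda>x. indicator {-1..1} x *\<^sub>R b 0 x) = b 0"
      by (auto simp: b0 indicator_def fun_eq_iff)
    ultimately show ?thesis by simp
  qed
  define c where "c = integral\<^sup>L lborel (b 0)"
  have "c > 0"
  proof -
    have "c \<noteq> 0"
    proof
      assume "c = 0"
      then have "AE x in lborel. b 0 x = 0"
        using integral_nonneg_eq_0_iff_AE[OF int] by (auto simp: c_def b0)
      then have "AE x in lborel. \<not> x \<in> {-1<..<1::real}"
        by eventually_elim (auto simp: b0 split: if_splits)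
      then have "{-1<..<1::real} \<in> null_sets lborel"
        by (subst (asm) AE_iff_null_sets[symmetric]) auto
      then show False by (simp add: null_sets_def)
    qed
    moreover have "c \<ge> 0" unfolding c_def by (intro Bochner_Integration.integral_nonneg) (simp add: b0)
    ultimately show ?thesis by simp
  qed
  \<comment> \<open>Each derivative brings a factor 1 / \<epsilon> by the chain rule; one more
    compensates the change of variables, and \<open>c\<close> normalises the mass.\<close>
  define \<beta> where "\<beta> n x = b n (x / \<epsilon>) / (\<epsilon> ^ Suc n * c)" for n x
  have "mollifier \<beta> \<epsilon>"
  proof
    show "(\<beta> n has_real_derivative \<beta> (Suc n) x) (at x)" for n x
      unfolding \<beta>_def
      by (rule derivative_eq_intros DERIV_chain2[OF db] refl | use assms \<open>c > 0\<close> in simp)+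
    show "\<beta> n x = 0" if "\<epsilon> \<le> \<bar>x\<bar>" for n x
    proof -
      have "\<not> \<bar>x / \<epsilon>\<bar> < 1" using that assms by (simp add: abs_divide)
      then show ?thesis unfolding \<beta>_def b_def bump_def by simp
    qed
    show "(LINT x|lborel. \<beta> 0 x) = 1"
    proof -
      have "c = \<bar>1 / \<epsilon>\<bar> *\<^sub>R (LINT x|lborel. b 0 (0 + 1 / \<epsilon> * x))"
        unfolding c_def by (rule lborel_integral_real_affine) (use assms in simp)
      then have "(LINT x|lborel. b 0 (x / \<epsilon>)) = \<epsilon> * c" using assms by (simp add: field_simps)
      then show ?thesis using assms \<open>c > 0\<close> by (simp add: \<beta>_def)
    qed
  qed (use assms \<open>c > 0\<close> in \<open>auto simp: \<beta>_def b0\<close>)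
  then show ?thesis by blast
qed

section \<open>Translation of Lebesgue integrals and functions supported in squares\<close>

lemma lborel_integral_translate:
  fixes g :: "'a::euclidean_space \<Rightarrow> real"
  assumes "g \<in> borel_measurable borel"
  shows "(LINT y|lborel. g (y + c)) = (LINT y|lborel. g y)"
proof -
  have "(LINT y|lborel. g y) = (LINT y|distr lborel borel ((+) c). g y)"
    by (simp add: lborel_distr_plus)
  also have "\<dots> = (LINT y|lborel. g (c + y))"
    using assms by (intro integral_distr) auto
  finally show ?thesis by (simp add: add.commute)
qed

lemma integrable_lborel_translate:
  fixes g :: "'a::euclidean_space \<Rightarrow> real"
  assumes "integrable lborel g"
  shows "integrable lborel (\<lambda>y. g (y + c))"
proof -
  have "integrable (distr lborel borel ((+) c)) g" using assms by (simp add: lborel_distr_plus)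
  then have "integrable lborel (\<lambda>y. g (c + y))"
    using assms by (subst (asm) integrable_distr_eq) auto
  then show ?thesis by (simp add: add.commute)
qed

lemma integrable_bounded_cbox:
  fixes f :: "'a::euclidean_space \<Rightarrow> real"
  assumes "f \<in> borel_measurable borel" "\<And>y. \<bar>f y\<bar> \<le> C * indicator (cbox a b) y"
  shows "integrable lborel f"
proof (rule Bochner_Integration.integrable_bound[where f = "\<lambda>y. C * indicator (cbox a b) y"])
  show "integrable lborel (\<lambda>y. C * indicator (cbox a b) y :: real)"
    by (intro integrable_mult_right integrable_real_indicator) (auto simp: emeasure_lborel_cbox_eq)
qed (use assms in \<open>auto intro: order_trans[OF _ abs_ge_self]\<close>)

abbreviation square :: "real \<times> real \<Rightarrow> real \<Rightarrow> (real \<times> real) set" where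
  "square z r \<equiv> cbox (z - (r, r)) (z + (r, r))"

lemma mem_square: "y \<in> square z r \<longleftrightarrow> \<bar>fst z - fst y\<bar> \<le> r \<and> \<bar>snd z - snd y\<bar> \<le> r"
  by (cases y; cases z) (auto simp: cbox_Pair_eq)

section \<open>Mollification in the plane with a product kernel\<close>

context mollifier
begin

lemma cont [continuous_intros]: "continuous_on A (\<beta> n)"
  using deriv DERIV_isCont continuous_at_imp_continuous_on by blast

definition bmax :: "nat \<Rightarrow> real" where
  "bmax n = (SOME B. \<forall>x. \<bar>\<beta> n x\<bar> \<le> B)"

lemma bmax: "\<bar>\<beta> n x\<bar> \<le> bmax n"
proof -
  have "bounded (\<beta> n ` {-\<epsilon>..\<epsilon>})" by (intro compact_imp_bounded compact_continuous_image cont) auto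
  then obtain B where "\<forall>y\<in>\<beta> n ` {-\<epsilon>..\<epsilon>}. norm y \<le> B" by (meson bounded_iff)
  then have B: "\<bar>\<beta> n x\<bar> \<le> B" if "x \<in> {-\<epsilon>..\<epsilon>}" for x using that by simp
  have "\<bar>\<beta> n x\<bar> \<le> max B 0" for x
  proof (cases "\<epsilon> \<le> \<bar>x\<bar>")
    case False
    then have "\<bar>\<beta> n x\<bar> \<le> B" by (intro B) auto
    then show ?thesis by simp
  qed (simp add: supp)
  then have "\<exists>B. \<forall>x. \<bar>\<beta> n x\<bar> \<le> B" by blast
  then show ?thesis unfolding bmax_def by (rule someI2_ex) auto
qed

lemma bmax_nonneg: "0 \<le> bmax n"
  using bmax[of n 0] by linarith

definition kern :: "nat \<Rightarrow> nat \<Rightarrow> real \<times> real \<Rightarrow> real" where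
  "kern m n z = \<beta> m (fst z) * \<beta> n (snd z)"

text \<open>The derivative of order m in t and n in x of the mollification of f. With all
  derivatives on the kernel, f may be merely bounded and measurable.\<close>

definition conv :: "nat \<Rightarrow> nat \<Rightarrow> (real \<times> real \<Rightarrow> real) \<Rightarrow> real \<times> real \<Rightarrow> real" where
  "conv m n f z = (LINT y|lborel. kern m n (z - y) * f y)"

lemma kern_cont: "continuous_on A (kern m n)"
  unfolding kern_def
  by (intro continuous_on_mult continuous_on_compose2[OF cont[of UNIV]] continuous_on_fst continuous_on_snd continuous_on_id) auto

lemma kern_measurable [measurable]: "kern m n \<in> borel_measurable borel"
  by (intro borel_measurable_continuous_onI kern_cont)

lemma kern_bound: "\<bar>kern m n (z - y)\<bar> \<le> bmax m * bmax n * indicator (square z \<epsilon>) y"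
  using supp[of "fst z - fst y" m] supp[of "snd z - snd y" n] bmax[of m] bmax[of n] bmax_nonneg
  by (auto simp: kern_def mem_square indicator_def abs_mult intro: mult_mono)

lemma kern_mult_bound:
  assumes "\<bar>f y\<bar> \<le> B"
  shows "\<bar>kern m n (z - y) * f y\<bar> \<le> bmax m * bmax n * B * indicator (square z \<epsilon>) y"
proof -
  have "\<bar>kern m n (z - y)\<bar> * \<bar>f y\<bar> \<le> (bmax m * bmax n * indicator (square z \<epsilon>) y) * B"
    using kern_bound assms by (intro mult_mono) (auto simp: bmax_nonneg)
  then show ?thesis by (simp add: abs_mult algebra_simps)
qed

lemma kern_integrable:
  assumes "f \<in> borel_measurable borel" "\<And>y. \<bar>f y\<bar> \<le> B"
  shows "integrable lborel (\<lambda>y. kern m n (z - y) * f y)"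
proof (rule integrable_bounded_cbox)
  show "(\<lambda>y. kern m n (z - y) * f y) \<in> borel_measurable borel" using assms(1) by measurable
qed (rule kern_mult_bound, rule assms(2))

text \<open>A bound of the kernel times the area of its support. For m + n \<ge> 1 it blows up as
  \<epsilon> tends to 0, so for the fields built from u it serves integrability and
  differentiability at fixed \<epsilon>; estimates uniform in \<epsilon> rest on
  \<open>conv_bound\<close>.\<close>

definition cmax :: "nat \<Rightarrow> nat \<Rightarrow> real" where
  "cmax m n = bmax m * bmax n * (2 * \<epsilon>)\<^sup>2"

lemma cmax_nonneg: "0 \<le> cmax m n"
  by (simp add: cmax_def bmax_nonneg)

lemma measure_square: "measure lborel (square z \<epsilon>) = (2 * \<epsilon>)\<^sup>2"
proof -
  have "measure lborel (square z \<epsilon>) = (\<Prod>b\<in>Basis. ((z + (\<epsilon>, \<epsilon>)) - (z - (\<epsilon>, \<epsilon>))) \<bullet> b)"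
    using eps_pos by (intro measure_lborel_cbox) (auto simp: Basis_prod_def inner_simps)
  also have "\<dots> = (2 * \<epsilon>)\<^sup>2"
    by (simp add: Basis_prod_def power2_eq_square prod.union_disjoint inner_simps)
  finally show ?thesis .
qed

lemma conv_bound_cmax:
  assumes "f \<in> borel_measurable borel" "\<And>y. \<bar>f y\<bar> \<le> B"
  shows "\<bar>conv m n f z\<bar> \<le> cmax m n * B"
proof -
  have "\<bar>conv m n f z\<bar> \<le> (LINT y|lborel. \<bar>kern m n (z - y) * f y\<bar>)"
    unfolding conv_def by (rule integral_abs_bound)
  also have "\<dots> \<le> (LINT y|lborel. bmax m * bmax n * B * indicator (square z \<epsilon>) y)"
  proof (rule integral_mono)
    show "\<bar>kern m n (z - y) * f y\<bar> \<le> bmax m * bmax n * B * indicator (square z \<epsilon>) y" for y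
      by (rule kern_mult_bound[OF assms(2)])
  qed (use kern_integrable[OF assms] in \<open>auto intro!: integrable_mult_right integrable_real_indicator simp: emeasure_lborel_cbox_eq\<close>)
  also have "\<dots> = cmax m n * B"
    by (simp add: cmax_def measure_square)
  finally show ?thesis .
qed

text \<open>Taylor expansion in the first factor of the kernel, the second being bounded. Since |s -
  t| \<le> 1, the remainder lives in the square of radius \<epsilon> + 1, which supplies the
  integrable majorant.\<close>

lemma conv_deriv_fst:
  assumes "f \<in> borel_measurable borel" "\<And>y. \<bar>f y\<bar> \<le> B"
  shows "((\<lambda>s. conv m n f (s, x)) has_real_derivative conv (Suc m) n f (t, x)) (at t)"
  unfolding conv_def
proof (rule has_real_derivative_integral[where G = "\<lambda>y. bmax (Suc (Suc m)) * bmax n * B * indicator (square (t, x) (\<epsilon> + 1)) y"])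
  have B: "B \<ge> 0" using assms(2)[of undefined] by linarith
  fix s :: real and y :: "real \<times> real" assume s: "\<bar>s - t\<bar> \<le> 1"
  define R where "R = \<beta> m (s - fst y) - \<beta> m (t - fst y) - (s - t) * \<beta> (Suc m) (t - fst y)"
  have R: "\<bar>R\<bar> \<le> bmax (Suc (Suc m)) * (s - t)\<^sup>2"
    using first_order_remainder[OF deriv deriv bmax, of m "s - fst y" "t - fst y"] by (simp add: R_def)
  have eq: "kern m n ((s, x) - y) * f y - kern m n ((t, x) - y) * f y - (s - t) * (kern (Suc m) n ((t, x) - y) * f y)
     = R * \<beta> n (x - snd y) * f y"
    by (simp add: kern_def R_def algebra_simps)
  show "\<bar>kern m n ((s, x) - y) * f y - kern m n ((t, x) - y) * f y - (s - t) * (kern (Suc m) n ((t, x) - y) * f y)\<bar>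
      \<le> (s - t)\<^sup>2 * (bmax (Suc (Suc m)) * bmax n * B * indicator (square (t, x) (\<epsilon> + 1)) y)"
  proof (cases "y \<in> square (t, x) (\<epsilon> + 1)")
    case True
    have "\<bar>R * \<beta> n (x - snd y) * f y\<bar> \<le> (bmax (Suc (Suc m)) * (s - t)\<^sup>2) * bmax n * B"
      unfolding abs_mult using R bmax assms(2) B by (intro mult_mono) (auto simp: bmax_nonneg)
    then show ?thesis using True unfolding eq by (simp add: algebra_simps)
  next
    case False
    then have "\<epsilon> \<le> \<bar>x - snd y\<bar> \<or> \<epsilon> \<le> \<bar>t - fst y\<bar> \<and> \<epsilon> \<le> \<bar>s - fst y\<bar>"
      using s unfolding mem_square by simp linarith
    then have "R * \<beta> n (x - snd y) = 0" by (auto simp: supp R_def)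
    then show ?thesis using False unfolding eq by simp
  qed
next
  show "integrable lborel (\<lambda>y. bmax (Suc (Suc m)) * bmax n * B * indicator (square (t, x) (\<epsilon> + 1)) y :: real)"
    by (intro integrable_mult_right integrable_real_indicator) (auto simp: emeasure_lborel_cbox_eq)
qed (use kern_integrable[OF assms] in auto)

lemma conv_deriv_snd:
  assumes "f \<in> borel_measurable borel" "\<And>y. \<bar>f y\<bar> \<le> B"
  shows "((\<lambda>s. conv m n f (t, s)) has_real_derivative conv m (Suc n) f (t, x)) (at x)"
  unfolding conv_def
proof (rule has_real_derivative_integral[where G = "\<lambda>y. bmax m * bmax (Suc (Suc n)) * B * indicator (square (t, x) (\<epsilon> + 1)) y"])
  have B: "B \<ge> 0" using assms(2)[of undefined] by linarith
  fix s :: real and y :: "real \<times> real" assume s: "\<bar>s - x\<bar> \<le> 1"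
  define R where "R = \<beta> n (s - snd y) - \<beta> n (x - snd y) - (s - x) * \<beta> (Suc n) (x - snd y)"
  have R: "\<bar>R\<bar> \<le> bmax (Suc (Suc n)) * (s - x)\<^sup>2"
    using first_order_remainder[OF deriv deriv bmax, of n "s - snd y" "x - snd y"] by (simp add: R_def)
  have eq: "kern m n ((t, s) - y) * f y - kern m n ((t, x) - y) * f y - (s - x) * (kern m (Suc n) ((t, x) - y) * f y)
     = R * \<beta> m (t - fst y) * f y"
    by (simp add: kern_def R_def algebra_simps)
  show "\<bar>kern m n ((t, s) - y) * f y - kern m n ((t, x) - y) * f y - (s - x) * (kern m (Suc n) ((t, x) - y) * f y)\<bar>
      \<le> (s - x)\<^sup>2 * (bmax m * bmax (Suc (Suc n)) * B * indicator (square (t, x) (\<epsilon> + 1)) y)"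
  proof (cases "y \<in> square (t, x) (\<epsilon> + 1)")
    case True
    have "\<bar>R * \<beta> m (t - fst y) * f y\<bar> \<le> (bmax (Suc (Suc n)) * (s - x)\<^sup>2) * bmax m * B"
      unfolding abs_mult using R bmax assms(2) B by (intro mult_mono) (auto simp: bmax_nonneg)
    then show ?thesis using True unfolding eq by (simp add: algebra_simps)
  next
    case False
    then have "\<epsilon> \<le> \<bar>t - fst y\<bar> \<or> \<epsilon> \<le> \<bar>x - snd y\<bar> \<and> \<epsilon> \<le> \<bar>s - snd y\<bar>"
      using s unfolding mem_square by simp linarith
    then have "R * \<beta> m (t - fst y) = 0" by (auto simp: supp R_def)
    then show ?thesis using False unfolding eq by simp
  qed
next
  show "integrable lborel (\<lambda>y. bmax m * bmax (Suc (Suc n)) * B * indicator (square (t, x) (\<epsilon> + 1)) y :: real)"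
    by (intro integrable_mult_right integrable_real_indicator) (auto simp: emeasure_lborel_cbox_eq)
qed (use kern_integrable[OF assms] in auto)

lemma conv_Lipschitz:
  assumes "f \<in> borel_measurable borel" "\<And>y. \<bar>f y\<bar> \<le> B"
  shows "\<bar>conv m n f z - conv m n f z'\<bar>
    \<le> cmax (Suc m) n * B * \<bar>fst z - fst z'\<bar> + cmax m (Suc n) * B * \<bar>snd z - snd z'\<bar>"
proof -
  have "norm (conv m n f (fst z, snd z) - conv m n f (fst z', snd z)) \<le> cmax (Suc m) n * B * norm (fst z - fst z')"
    by (rule field_differentiable_bound[of UNIV "\<lambda>s. conv m n f (s, snd z)" "\<lambda>s. conv (Suc m) n f (s, snd z)"])
       (use conv_deriv_fst[OF assms] conv_bound_cmax[OF assms] in auto)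
  moreover have "norm (conv m n f (fst z', snd z) - conv m n f (fst z', snd z')) \<le> cmax m (Suc n) * B * norm (snd z - snd z')"
    by (rule field_differentiable_bound[of UNIV "\<lambda>s. conv m n f (fst z', s)" "\<lambda>s. conv m (Suc n) f (fst z', s)"])
       (use conv_deriv_snd[OF assms] conv_bound_cmax[OF assms] in auto)
  ultimately show ?thesis by simp
qed

lemma conv_cont:
  assumes "f \<in> borel_measurable borel" "\<And>y. \<bar>f y\<bar> \<le> B"
  shows "continuous_on A (conv m n f)"
proof -
  have "isCont (conv m n f) z" for z
    unfolding isCont_def
  proof (rule Lim_transform_bound[THEN LIM_zero_cancel, rotated])
    let ?g = "\<lambda>w. cmax (Suc m) n * B * \<bar>fst w - fst z\<bar> + cmax m (Suc n) * B * \<bar>snd w - snd z\<bar>"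
    show "(?g \<longlongrightarrow> 0) (at z)"
      by (auto intro!: tendsto_eq_intros)
    show "\<forall>\<^sub>F w in at z. norm (conv m n f w - conv m n f z) \<le> norm (?g w)"
    proof (intro always_eventually allI)
      fix w
      show "norm (conv m n f w - conv m n f z) \<le> norm (?g w)"
        using conv_Lipschitz[OF assms, of m n w z] by simp
    qed
  qed
  then show ?thesis using continuous_at_imp_continuous_on by blast
qed

lemma pd_t_conv:
  assumes "f \<in> borel_measurable borel" "\<And>y. \<bar>f y\<bar> \<le> B"
  shows "pd_t (conv m n f) = conv (Suc m) n f"
  using DERIV_imp_deriv[OF conv_deriv_fst[OF assms]] by (auto simp: pd_t_def fun_eq_iff)

lemma pd_x_conv:
  assumes "f \<in> borel_measurable borel" "\<And>y. \<bar>f y\<bar> \<le> B"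
  shows "pd_x (conv m n f) = conv m (Suc n) f"
  using DERIV_imp_deriv[OF conv_deriv_snd[OF assms]] by (auto simp: pd_x_def fun_eq_iff)

text \<open>\<open>pd_t\<close> and \<open>pd_x\<close> map each \<open>conv i j f\<close> to
  another one, so by induction on the word \<open>bs\<close> all iterated derivatives stay in a
  family whose continuity and differentiability are known.\<close>

lemma conv_smooth:
  assumes "f \<in> borel_measurable borel" "\<And>y. \<bar>f y\<bar> \<le> B"
  shows "smooth2 (conv m n f)"
proof -
  note t = pd_t_conv[OF assms] and x = pd_x_conv[OF assms]
  have "\<exists>i j. iter_pd bs (conv m n f) = conv i j f" for bs
  proof (induction bs)
    case (Cons b bs)
    then obtain i j where "iter_pd bs (conv m n f) = conv i j f" by blast
    then show ?case using t[of i j] x[of i j] by (cases b) auto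
  qed auto
  then obtain i j where ij: "iter_pd bs (conv m n f) = conv (i bs) (j bs) f" for bs by metis
  show ?thesis
    unfolding smooth2_def ij real_differentiable_def
    using conv_cont[OF assms] conv_deriv_fst[OF assms] conv_deriv_snd[OF assms] by blast
qed

text \<open>The kernel lives on a square of half side \<epsilon>, contained in the Euclidean ball of
  radius 2 \<epsilon>; the factor 2 is a convenient bound for the square root of 2.\<close>

lemma conv_eq_0:
  assumes "\<And>y. dist z y \<le> 2 * \<epsilon> \<Longrightarrow> f y = 0"
  shows "conv m n f z = 0"
proof -
  have "kern m n (z - y) * f y = 0" for y
  proof (cases "\<bar>fst z - fst y\<bar> \<le> \<epsilon> \<and> \<bar>snd z - snd y\<bar> \<le> \<epsilon>")
    case True
    have "dist z y \<le> \<bar>fst z - fst y\<bar> + \<bar>snd z - snd y\<bar>"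
      by (simp add: dist_prod_def dist_real_def sqrt_sum_squares_le_sum_abs)
    then show ?thesis using True assms[of y] by simp
  qed (auto simp: kern_def supp)
  then have "(\<lambda>y. kern m n (z - y) * f y) = (\<lambda>y. 0)" by blast
  then show ?thesis unfolding conv_def by simp
qed

text \<open>Mollification turns a bounded measurable function of compact support into an admissible
  test function, so that the weak formulation can be tested against merely measurable
  functions.\<close>

lemma test_fun_conv:
  assumes "f \<in> borel_measurable borel" "\<And>y. \<bar>f y\<bar> \<le> B" "compact K" "K \<subseteq> \<Omega>"
    and "\<And>z y. f y \<noteq> 0 \<Longrightarrow> dist z y \<le> 2 * \<epsilon> \<Longrightarrow> z \<in> K"
  shows "test_fun \<Omega> (conv 0 0 f)" "tsupp (conv 0 0 f) \<subseteq> K"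
proof -
  have "{z. conv 0 0 f z \<noteq> 0} \<subseteq> K" using conv_eq_0 assms(5) by blast
  then show *: "tsupp (conv 0 0 f) \<subseteq> K"
    unfolding tsupp_def using assms(3) by (simp add: closure_minimal compact_imp_closed)
  have "compact (tsupp (conv 0 0 f))"
    using * assms(3) by (metis bounded_subset closed_closure compact_eq_bounded_closed tsupp_def)
  then show "test_fun \<Omega> (conv 0 0 f)"
    unfolding test_fun_def using * assms(4) conv_smooth[OF assms(1,2)] by auto
qed

end

section \<open>Duality and approximation by convolution\<close>

lemma borel_measurable_comp_diff:
  fixes f :: "'a::euclidean_space \<Rightarrow> real"
  assumes [measurable]: "f \<in> borel_measurable borel"
  shows "(\<lambda>p. f (fst p - snd p)) \<in> borel_measurable borel"
  by (rule measurable_compose[OF _ assms]) (intro borel_measurable_continuous_onI continuous_intros)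

lemma borel_measurable_comp_plus:
  fixes f :: "'a::euclidean_space \<Rightarrow> real"
  assumes [measurable]: "f \<in> borel_measurable borel"
  shows "(\<lambda>p. f (fst p + snd p)) \<in> borel_measurable borel"
  by (rule measurable_compose[OF _ assms]) (intro borel_measurable_continuous_onI continuous_intros)

lemma borel_measurable_comp_fst:
  fixes f :: "'a::euclidean_space \<Rightarrow> real"
  assumes [measurable]: "f \<in> borel_measurable borel"
  shows "(\<lambda>p::'a \<times> 'b::euclidean_space. f (fst p)) \<in> borel_measurable borel"
  by (rule measurable_compose[OF _ assms]) (intro borel_measurable_continuous_onI continuous_intros)

lemma borel_measurable_comp_snd:
  fixes f :: "'b::euclidean_space \<Rightarrow> real"
  assumes [measurable]: "f \<in> borel_measurable borel"
  shows "(\<lambda>p::'a::euclidean_space \<times> 'b. f (snd p)) \<in> borel_measurable borel"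
  by (rule measurable_compose[OF _ assms]) (intro borel_measurable_continuous_onI continuous_intros)

context mollifier
begin

lemma odd: "\<beta> (Suc 0) (- x) = - \<beta> (Suc 0) x"
proof -
  have "((\<lambda>x. \<beta> 0 (- x)) has_real_derivative \<beta> (Suc 0) (- x) * (- 1)) (at x)"
    by (rule DERIV_chain2[OF deriv]) (auto intro!: derivative_eq_intros)
  moreover have "((\<lambda>x. \<beta> 0 (- x)) has_real_derivative \<beta> (Suc 0) x) (at x)"
    using deriv[of 0 x] by (simp add: even)
  ultimately have "\<beta> (Suc 0) (- x) * (- 1) = \<beta> (Suc 0) x" by (rule DERIV_unique)
  then show ?thesis by simp
qed

text \<open>The explicit factors are the values of \<sigma> in \<open>integral_mult_conv\<close>:
  the kernel itself is symmetric, and one derivative produces the sign of an integration by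
  parts.\<close>

lemma kern_reflect:
  "kern 0 0 (- z) = 1 * kern 0 0 z"
  "kern (Suc 0) 0 (- z) = (- 1) * kern (Suc 0) 0 z"
  "kern 0 (Suc 0) (- z) = (- 1) * kern 0 (Suc 0) z"
  by (simp_all add: kern_def even odd)

lemma kern_nonneg: "0 \<le> kern 0 0 z"
  by (simp add: kern_def nonneg)

lemma integrable_kern: "integrable lborel (kern 0 0)"
  using kern_integrable[of "\<lambda>_. 1" 1 0 0 0] by (simp add: kern_reflect)

lemma integral_kern: "(LINT z|lborel. kern 0 0 z) = 1"
proof -
  have "(LINT z|lborel. kern 0 0 z) = integral\<^sup>L (lborel \<Otimes>\<^sub>M lborel) (kern 0 0)" by (simp add: lborel_prod)
  also have "\<dots> = (LINT x|lborel. LINT y|lborel. kern 0 0 (x, y))"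
    using integrable_kern by (intro lborel_pair.integral_fst'[symmetric]) (simp add: lborel_prod)
  also have "\<dots> = 1" by (simp add: kern_def integral_1)
  finally show ?thesis .
qed

lemma kern_diff_eq: "kern 0 0 (z - y) = kern 0 0 (y + - z)"
  using kern_reflect(1)[of "z - y"] by simp

lemma integral_kern_diff: "(LINT y|lborel. kern 0 0 (z - y)) = 1"
  unfolding kern_diff_eq by (subst lborel_integral_translate) (auto simp: integral_kern)

text \<open>The kernel is nonnegative with mass 1, so the sup norm does not grow, whatever
  \<epsilon> is.\<close>

lemma conv_bound:
  assumes "f \<in> borel_measurable borel" "\<And>y. \<bar>f y\<bar> \<le> B"
  shows "\<bar>conv 0 0 f z\<bar> \<le> B"
proof -
  have "\<bar>conv 0 0 f z\<bar> \<le> (LINT y|lborel. \<bar>kern 0 0 (z - y) * f y\<bar>)"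
    unfolding conv_def by (rule integral_abs_bound)
  also have "\<dots> \<le> (LINT y|lborel. kern 0 0 (z - y) * B)"
  proof (rule integral_mono)
    show "\<bar>kern 0 0 (z - y) * f y\<bar> \<le> kern 0 0 (z - y) * B" for y
      using assms(2)[of y] kern_nonneg by (simp add: abs_mult mult_left_mono)
  qed (use kern_integrable[OF assms, of 0 0 z] kern_integrable[of "\<lambda>_. B" "\<bar>B\<bar>" 0 0 z] in auto)
  also have "\<dots> = B" using integral_kern_diff[of z] by simp
  finally show ?thesis .
qed

text \<open>Fubini and the parity of the kernel move a convolution from one factor to the other. The
  bounded support of g confines the joint integrand to a product of two squares, which makes it
  integrable.\<close>

lemma integral_mult_conv:
  assumes [measurable]: "f \<in> borel_measurable borel" "g \<in> borel_measurable borel"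
    and f: "\<And>y. \<bar>f y\<bar> \<le> B" and g: "\<And>y. \<bar>g y\<bar> \<le> B'"
    and g0: "\<And>z. z \<notin> square c R \<Longrightarrow> g z = 0"
    and reflect: "\<And>w. kern m n (- w) = \<sigma> * kern m n w"
  shows "(LINT z|lborel. g z * conv m n f z) = \<sigma> * (LINT y|lborel. conv m n g y * f y)"
proof -
  have int: "integrable (lborel \<Otimes>\<^sub>M lborel) (\<lambda>p. g (fst p) * kern m n (fst p - snd p) * f (snd p))"
    unfolding lborel_prod
  proof (rule integrable_bounded_cbox)
    show "(\<lambda>p. g (fst p) * kern m n (fst p - snd p) * f (snd p)) \<in> borel_measurable borel"
      by (intro borel_measurable_times borel_measurable_comp_diff borel_measurable_comp_fst borel_measurable_comp_snd) auto
    fix p :: "(real \<times> real) \<times> (real \<times> real)"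
    have B: "B \<ge> 0" "B' \<ge> 0" using f[of undefined] g[of undefined] by linarith+
    have "\<bar>kern m n (fst p - snd p)\<bar> \<le> bmax m * bmax n"
      using bmax_nonneg bmax unfolding kern_def abs_mult by (intro mult_mono) auto
    then have *: "\<bar>g (fst p) * kern m n (fst p - snd p) * f (snd p)\<bar> \<le> B' * (bmax m * bmax n) * B"
      unfolding abs_mult using f g B by (intro mult_mono) (auto simp: bmax_nonneg)
    show "\<bar>g (fst p) * kern m n (fst p - snd p) * f (snd p)\<bar> \<le> (B' * (bmax m * bmax n) * B) *
        indicator (cbox (c - (R, R), c - (R + \<epsilon>, R + \<epsilon>)) (c + (R, R), c + (R + \<epsilon>, R + \<epsilon>))) p"
    proof (cases "p \<in> square c R \<times> square c (R + \<epsilon>)")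
      case True
      then show ?thesis using * by (cases p) (auto simp: cbox_Pair_eq)
    next
      case False
      then have "fst p \<notin> square c R \<or> \<epsilon> \<le> \<bar>fst (fst p) - fst (snd p)\<bar> \<or> \<epsilon> \<le> \<bar>snd (fst p) - snd (snd p)\<bar>"
        by (auto simp: mem_square mem_Times_iff)
      then have "g (fst p) * kern m n (fst p - snd p) = 0" using g0[of "fst p"] by (auto simp: kern_def supp)
      moreover have "0 \<le> (B' * (bmax m * bmax n) * B)" using B by (simp add: bmax_nonneg)
      ultimately show ?thesis by (auto simp: indicator_def)
    qed
  qed
  have "(LINT z|lborel. g z * conv m n f z) = (LINT z|lborel. LINT y|lborel. g z * kern m n (z - y) * f y)"
    unfolding conv_def by (simp add: mult.assoc)
  also have "\<dots> = (LINT y|lborel. LINT z|lborel. g z * kern m n (z - y) * f y)"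
    using int by (intro lborel_pair.Fubini_integral[symmetric]) (simp add: case_prod_unfold)
  also have "\<dots> = (LINT y|lborel. \<sigma> * (conv m n g y * f y))"
  proof (rule Bochner_Integration.integral_cong[OF refl])
    fix y
    have "(LINT z|lborel. g z * kern m n (z - y) * f y) = (LINT z|lborel. (\<sigma> * f y) * (kern m n (y - z) * g z))"
      using reflect[of "y - _"] by (intro Bochner_Integration.integral_cong) (auto simp: algebra_simps)
    then show "(LINT z|lborel. g z * kern m n (z - y) * f y) = \<sigma> * (conv m n g y * f y)"
      by (simp add: conv_def algebra_simps)
  qed
  finally show ?thesis by simp
qed

text \<open>Kernel-weighted mean oscillation of f about z. Taken for u, it dominates the
  mollification error of all Lipschitz functions of u simultaneously, so one \<epsilon> serves all
  entropies and fluxes.\<close>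

definition osc :: "(real \<times> real \<Rightarrow> real) \<Rightarrow> real \<times> real \<Rightarrow> real" where
  "osc f z = (LINT y|lborel. kern 0 0 (z - y) * \<bar>f y - f z\<bar>)"

lemma conv_comp_diff_le_osc:
  assumes [measurable]: "u \<in> borel_measurable borel" "W \<in> borel_measurable borel"
    and u: "\<And>y. \<bar>u y\<bar> \<le> M" and W: "\<And>y. \<bar>W (u y)\<bar> \<le> B"
    and lip: "\<And>y z. \<bar>W (u y) - W (u z)\<bar> \<le> L * \<bar>u y - u z\<bar>"
  shows "\<bar>conv 0 0 (\<lambda>y. W (u y)) z - W (u z)\<bar> \<le> L * osc u z"
proof -
  have i1: "integrable lborel (\<lambda>y. kern 0 0 (z - y) * W (u y))" by (rule kern_integrable[of _ B]) (use W in auto)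
  have i2: "integrable lborel (\<lambda>y. kern 0 0 (z - y) * W (u z))" by (rule kern_integrable[of _ B]) (use W in auto)
  have i3: "integrable lborel (\<lambda>y. kern 0 0 (z - y) * \<bar>u y - u z\<bar>)"
  proof (rule kern_integrable[of _ "2 * M"])
    show "\<bar>\<bar>u y - u z\<bar>\<bar> \<le> 2 * M" for y using u[of y] u[of z] by linarith
  qed auto
  have "conv 0 0 (\<lambda>y. W (u y)) z - W (u z) = (LINT y|lborel. kern 0 0 (z - y) * W (u y) - kern 0 0 (z - y) * W (u z))"
    using i1 i2 integral_kern_diff[of z] by (simp add: conv_def)
  also have "\<bar>\<dots>\<bar> \<le> (LINT y|lborel. \<bar>kern 0 0 (z - y) * W (u y) - kern 0 0 (z - y) * W (u z)\<bar>)"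
    by (rule integral_abs_bound)
  also have "\<dots> \<le> (LINT y|lborel. L * (kern 0 0 (z - y) * \<bar>u y - u z\<bar>))"
  proof (rule integral_mono)
    fix y
    have "\<bar>kern 0 0 (z - y) * W (u y) - kern 0 0 (z - y) * W (u z)\<bar> = kern 0 0 (z - y) * \<bar>W (u y) - W (u z)\<bar>"
      using kern_nonneg[of "z - y"] by (simp add: abs_mult right_diff_distrib[symmetric])
    also have "\<dots> \<le> kern 0 0 (z - y) * (L * \<bar>u y - u z\<bar>)" using lip kern_nonneg by (intro mult_left_mono) auto
    finally show "\<bar>kern 0 0 (z - y) * W (u y) - kern 0 0 (z - y) * W (u z)\<bar> \<le> L * (kern 0 0 (z - y) * \<bar>u y - u z\<bar>)"
      by (simp add: algebra_simps)
  qed (use i1 i2 i3 in auto)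
  also have "\<dots> = L * osc u z" by (simp add: osc_def)
  finally show ?thesis .
qed

lemma osc_nonneg: "0 \<le> osc f z"
  unfolding osc_def by (intro Bochner_Integration.integral_nonneg) (simp add: kern_nonneg)

lemma osc_eq:
  assumes [measurable]: "u \<in> borel_measurable borel"
  shows "osc u z = (LINT w|lborel. kern 0 0 w * \<bar>u (z + w) - u z\<bar>)"
proof -
  have "(LINT y|lborel. kern 0 0 (y + - z) * \<bar>u (y + - z + z) - u z\<bar>) = (LINT w|lborel. kern 0 0 w * \<bar>u (w + z) - u z\<bar>)"
    by (rule lborel_integral_translate[of "\<lambda>w. kern 0 0 w * \<bar>u (w + z) - u z\<bar>"]) measurable
  then show ?thesis unfolding osc_def kern_diff_eq by (simp add: add.commute)
qed

text \<open>After the substitution y = z + w and Fubini, the integral of \<open>osc u\<close> over Q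
  is an average over w of L1 translation moduli of u, and the kernel only sees w of norm at most 2
  \<epsilon>.\<close>

lemma osc_integral:
  assumes [measurable]: "u \<in> borel_measurable borel"
    and u: "\<And>y. \<bar>u y\<bar> \<le> M" and Q: "compact Q"
    and small: "\<And>w. norm w \<le> 2 * \<epsilon> \<Longrightarrow> (LINT z|lborel. indicator Q z * \<bar>u (z + w) - u z\<bar>) \<le> \<eta>"
  shows "integrable lborel (\<lambda>z. indicator Q z * osc u z)" "(LINT z|lborel. indicator Q z * osc u z) \<le> \<eta>"
proof -
  define H where "H p = indicator Q (fst p) * (kern 0 0 (snd p) * \<bar>u (fst p + snd p) - u (fst p)\<bar>)" for p
  obtain c d where cd: "Q \<subseteq> cbox c d" using Q bounded_subset_cbox_symmetric compact_imp_bounded by metis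
  have [measurable]: "Q \<in> sets borel" using Q by (simp add: compact_imp_closed)
  have int: "integrable (lborel \<Otimes>\<^sub>M lborel) H"
    unfolding lborel_prod
  proof (rule integrable_bounded_cbox)
    show "H \<in> borel_measurable borel" unfolding H_def
      by (intro borel_measurable_times borel_measurable_abs borel_measurable_diff borel_measurable_comp_plus borel_measurable_comp_fst borel_measurable_comp_snd) auto
    fix p :: "(real \<times> real) \<times> (real \<times> real)"
    have M: "M \<ge> 0" using u[of undefined] by linarith
    have "\<bar>kern 0 0 (snd p)\<bar> \<le> bmax 0 * bmax 0"
      using bmax_nonneg bmax unfolding kern_def abs_mult by (intro mult_mono) auto
    moreover have "\<bar>u (fst p + snd p) - u (fst p)\<bar> \<le> 2 * M" using u[of "fst p + snd p"] u[of "fst p"] by linarith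
    ultimately have *: "\<bar>kern 0 0 (snd p)\<bar> * \<bar>u (fst p + snd p) - u (fst p)\<bar> \<le> (bmax 0 * bmax 0) * (2 * M)"
      by (intro mult_mono) (auto simp: bmax_nonneg)
    show "\<bar>H p\<bar> \<le> (bmax 0 * bmax 0 * (2 * M)) * indicator (cbox (c, (-\<epsilon>, -\<epsilon>)) (d, (\<epsilon>, \<epsilon>))) p"
    proof (cases "fst p \<in> cbox c d \<and> snd p \<in> cbox (-\<epsilon>, -\<epsilon>) (\<epsilon>, \<epsilon>)")
      case True
      then show ?thesis using * by (cases p) (auto simp: H_def abs_mult cbox_Pair_eq indicator_def bmax_nonneg M)
    next
      case False
      then have "fst p \<notin> cbox c d \<or> \<epsilon> \<le> \<bar>fst (snd p)\<bar> \<or> \<epsilon> \<le> \<bar>snd (snd p)\<bar>"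
        by (cases p) (auto simp: cbox_Pair_eq)
      then have "H p = 0" using cd by (auto simp: H_def kern_def supp indicator_def)
      then show ?thesis using M by (auto simp: indicator_def bmax_nonneg)
    qed
  qed
  have eq: "indicator Q z * osc u z = (LINT w|lborel. H (z, w))" for z
    by (simp add: osc_eq H_def)
  show "integrable lborel (\<lambda>z. indicator Q z * osc u z)"
    unfolding eq by (rule lborel_pair.integrable_fst'[OF int])
  have "(LINT z|lborel. indicator Q z * osc u z) = (LINT w|lborel. LINT z|lborel. H (z, w))"
    unfolding eq using int by (intro lborel_pair.Fubini_integral[of "\<lambda>z w. H (z, w)", symmetric]) simp
  also have "\<dots> = (LINT w|lborel. kern 0 0 w * (LINT z|lborel. indicator Q z * \<bar>u (z + w) - u z\<bar>))"
    unfolding H_def by (simp add: algebra_simps flip: Bochner_Integration.integral_mult_right_zero)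
  also have "\<dots> \<le> (LINT w|lborel. kern 0 0 w * \<eta>)"
  proof (rule integral_mono)
    have "integrable lborel (\<lambda>w. LINT z|lborel. H (z, w))"
      using lborel_pair.integrable_snd[of "\<lambda>z w. H (z, w)"] int by simp
    then show "integrable lborel (\<lambda>w. kern 0 0 w * (LINT z|lborel. indicator Q z * \<bar>u (z + w) - u z\<bar>))"
      unfolding H_def by (simp add: algebra_simps flip: Bochner_Integration.integral_mult_right_zero)
    show "integrable lborel (\<lambda>w. kern 0 0 w * \<eta>)" using integrable_kern by simp
    fix w :: "real \<times> real"
    show "kern 0 0 w * (LINT z|lborel. indicator Q z * \<bar>u (z + w) - u z\<bar>) \<le> kern 0 0 w * \<eta>"
    proof (cases "kern 0 0 w = 0")
      case False
      then have "\<bar>fst w\<bar> \<le> \<epsilon>" "\<bar>snd w\<bar> \<le> \<epsilon>" using supp[of "fst w" 0] supp[of "snd w" 0] by (force simp: kern_def)+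
      moreover have "norm w \<le> \<bar>fst w\<bar> + \<bar>snd w\<bar>" by (simp add: norm_prod_def sqrt_sum_squares_le_sum_abs)
      ultimately show ?thesis using small kern_nonneg by (intro mult_left_mono) auto
    qed simp
  qed
  also have "\<dots> = \<eta>" by (simp add: integral_kern)
  finally show "(LINT z|lborel. indicator Q z * osc u z) \<le> \<eta>" .
qed

end

text \<open>On a larger ball f is L1-close to a continuous function, which is uniformly continuous
  there. The three errors of size \<eta> / 3 come from the approximation at z + w, from the
  continuous function, and from the approximation at z.\<close>

lemma L1_translation_continuous:
  fixes f :: "'a::euclidean_space \<Rightarrow> real"
  assumes [measurable]: "f \<in> borel_measurable borel" and f: "\<And>y. \<bar>f y\<bar> \<le> M"
    and Q: "compact Q" and \<eta>: "\<eta> > 0"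
  shows "\<exists>r>0. \<forall>w. norm w < r \<longrightarrow> (LINT z|lborel. indicator Q z * \<bar>f (z + w) - f z\<bar>) \<le> \<eta>"
proof -
  have M: "M \<ge> 0" using f[of undefined] by linarith
  obtain R where "\<forall>x\<in>Q. norm x \<le> R" using Q by (meson bounded_iff compact_imp_bounded)
  then have R: "Q \<subseteq> cball 0 R" by auto
  \<comment> \<open>Radius R + 1 keeps both z and z + w inside for z in \<open>Q\<close> and |w| <
    1.\<close>
  define Q' :: "'a set" where "Q' = cball 0 (R + 1)"
  have [measurable]: "Q \<in> sets borel" "Q' \<in> sets borel" using Q by (auto simp: compact_imp_closed Q'_def)
  have fin: "emeasure lborel Q < \<infinity>" "emeasure lborel Q' < \<infinity>"
    using Q by (auto simp: Q'_def compact_imp_bounded intro!: emeasure_bounded_finite[unfolded infinity_ennreal_def])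
  have "f \<in> borel_measurable lebesgue" using assms(1) by (intro measurable_completion) simp
  then have "f measurable_on UNIV" by (intro lebesgue_measurable_imp_measurable_on) auto
  then obtain N g where N: "negligible N" and g: "\<And>n. continuous_on UNIV (g n)"
    "\<And>x. x \<notin> N \<Longrightarrow> (\<lambda>n. g n x) \<longlonglongrightarrow> f x" unfolding measurable_on_def by auto
  \<comment> \<open>Truncation at M preserves the limit because |f| \<le> M, and it yields the
    majorant 2 M for dominated convergence.\<close>
  define c where "c n x = max (- M) (min M (g n x :: real))" for n :: nat and x
  have c_cont: "continuous_on A (c n)" for n A
    unfolding c_def using continuous_on_subset[OF g(1)] by (intro continuous_intros) auto
  have [measurable]: "c n \<in> borel_measurable borel" for n by (intro borel_measurable_continuous_onI c_cont)
  have c_bd: "\<bar>c n x\<bar> \<le> M" for n x using M by (auto simp: c_def)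
  have lim: "(\<lambda>n. LINT z|lborel. indicator Q' z * \<bar>c n z - f z\<bar>) \<longlonglongrightarrow> (LINT z|(lborel::'a measure). (0::real))"
  proof (rule integral_dominated_convergence[where f = "\<lambda>z. 0" and w = "\<lambda>z. 2 * M * indicator Q' z"])
    show "integrable lborel (\<lambda>z. 2 * M * indicator Q' z :: real)"
      using fin by (intro integrable_mult_right integrable_real_indicator) auto
    have "AE z in lebesgue. z \<notin> N" using N by (simp add: negligible_iff_null_sets AE_not_in)
    then have "AE z in lborel. z \<notin> N" by (simp add: AE_completion_iff)
    then show "AE z in lborel. (\<lambda>n. indicator Q' z * \<bar>c n z - f z\<bar>) \<longlonglongrightarrow> 0"
    proof eventually_elim
      case (elim z)
      have "(\<lambda>n. max (- M) (min M (g n z))) \<longlonglongrightarrow> max (- M) (min M (f z))"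
        by (intro tendsto_intros g(2)[OF elim])
      also have "max (- M) (min M (f z)) = f z" using f[of z] by auto
      finally have "(\<lambda>n. c n z) \<longlonglongrightarrow> f z" by (simp add: c_def)
      then have "(\<lambda>n. indicator Q' z * \<bar>c n z - f z\<bar>) \<longlonglongrightarrow> indicator Q' z * \<bar>f z - f z\<bar>"
        by (intro tendsto_intros)
      then show ?case by simp
    qed
    show "AE z in lborel. norm (indicator Q' z * \<bar>c n z - f z\<bar>) \<le> 2 * M * indicator Q' z" for n
    proof (rule AE_I2)
      fix z
      have "\<bar>c n z - f z\<bar> \<le> 2 * M" using c_bd[of n z] f[of z] by linarith
      then show "norm (indicator Q' z * \<bar>c n z - f z\<bar>) \<le> 2 * M * indicator Q' z" by (auto simp: indicator_def)
    qed
  qed auto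
  then have "\<exists>n. (LINT z|lborel. indicator Q' z * \<bar>c n z - f z\<bar>) < \<eta> / 3"
    using order_tendstoD(2)[OF lim, of "\<eta> / 3"] \<eta> by (auto simp: eventually_sequentially)
  then obtain n where n: "(LINT z|lborel. indicator Q' z * \<bar>c n z - f z\<bar>) < \<eta> / 3" by blast
  \<comment> \<open>The summand 1 covers the case of a null set \<open>Q\<close>.\<close>
  define \<kappa> where "\<kappa> = \<eta> / (3 * (1 + measure lborel Q))"
  have \<kappa>: "\<kappa> > 0" using \<eta> by (simp add: \<kappa>_def add_pos_nonneg)
  have "uniformly_continuous_on Q' (c n)"
    by (intro compact_uniformly_continuous c_cont) (auto simp: Q'_def)
  then obtain r where r: "r > 0" "\<And>x y. x \<in> Q' \<Longrightarrow> y \<in> Q' \<Longrightarrow> dist y x < r \<Longrightarrow> dist (c n y) (c n x) < \<kappa>"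
    using \<kappa> unfolding uniformly_continuous_on_def by metis
  have ic: "integrable lborel (\<lambda>z. indicator Q' z * \<bar>c n z - f z\<bar>)"
  proof (rule Bochner_Integration.integrable_bound[where f = "\<lambda>z. 2 * M * indicator Q' z :: real"])
    show "AE z in lborel. norm (indicator Q' z * \<bar>c n z - f z\<bar>) \<le> norm (2 * M * indicator Q' z)"
    proof (rule AE_I2)
      fix z
      have "\<bar>c n z - f z\<bar> \<le> 2 * M" using c_bd[of n z] f[of z] by linarith
      then show "norm (indicator Q' z * \<bar>c n z - f z\<bar>) \<le> norm (2 * M * indicator Q' z)" using M by (auto simp: indicator_def)
    qed
  qed (use fin in \<open>auto intro!: integrable_mult_right integrable_real_indicator\<close>)
  have "(LINT z|lborel. indicator Q z * \<bar>f (z + w) - f z\<bar>) \<le> \<eta>" if w: "norm w < min r 1" for w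
  proof -
    let ?d = "\<lambda>z. indicator Q' z * \<bar>c n z - f z\<bar>"
    have "(LINT z|lborel. indicator Q z * \<bar>f (z + w) - f z\<bar>)
        \<le> (LINT z|lborel. ?d (z + w) + \<kappa> * indicator Q z + ?d z)"
    proof (rule integral_mono')
      show "integrable lborel (\<lambda>z. ?d (z + w) + \<kappa> * indicator Q z + ?d z)"
        using integrable_lborel_translate[OF ic, of w] ic fin
        by (intro Bochner_Integration.integrable_add integrable_mult_right integrable_real_indicator) auto
      fix z
      show "indicator Q z * \<bar>f (z + w) - f z\<bar> \<le> ?d (z + w) + \<kappa> * indicator Q z + ?d z"
      proof (cases "z \<in> Q")
        case True
        then have z: "norm z \<le> R" using R by auto
        then have "z \<in> Q'" "z + w \<in> Q'" using w norm_triangle_ineq[of z w] by (auto simp: Q'_def)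
        moreover from this have "\<bar>c n (z + w) - c n z\<bar> < \<kappa>" using r(2)[of z "z + w"] w by (simp add: dist_norm)
        ultimately show ?thesis using True by (simp add: indicator_def)
      qed (use \<kappa> in auto)
      show "0 \<le> ?d (z + w) + \<kappa> * indicator Q z + ?d z" using \<kappa> by simp
    qed
    also have "\<dots> = (LINT z|lborel. ?d (z + w)) + \<kappa> * measure lborel Q + (LINT z|lborel. ?d z)"
      using integrable_lborel_translate[OF ic, of w] ic fin by simp
    also have "(LINT z|lborel. ?d (z + w)) = (LINT z|lborel. ?d z)" by (rule lborel_integral_translate) measurable
    also have "\<kappa> * measure lborel Q \<le> \<eta> / 3"
    proof -
      have *: "\<kappa> * measure lborel Q \<le> \<kappa> * (1 + measure lborel Q)" using \<kappa> by (intro mult_left_mono) auto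
      have "\<eta> / (3 * X) * X = \<eta> / 3" if "X \<noteq> 0" for X using that by simp
      from this[of "1 + measure lborel Q"] have "\<kappa> * (1 + measure lborel Q) = \<eta> / 3"
        unfolding \<kappa>_def using measure_nonneg[of lborel Q] by force
      with * show ?thesis by simp
    qed
    finally show ?thesis using n by linarith
  qed
  then show ?thesis using r(1) by (intro exI[of _ "min r 1"]) auto
qed

section \<open>Integration by parts in the plane\<close>

definition C1 :: "(real \<times> real \<Rightarrow> real) \<Rightarrow> (real \<times> real \<Rightarrow> real) \<Rightarrow> (real \<times> real \<Rightarrow> real) \<Rightarrow> bool" where
  "C1 f ft fx \<longleftrightarrow> (\<forall>t x. ((\<lambda>s. f (s, x)) has_real_derivative ft (t, x)) (at t)) \<and>
     (\<forall>t x. ((\<lambda>s. f (t, s)) has_real_derivative fx (t, x)) (at x)) \<and>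
     continuous_on UNIV f \<and> continuous_on UNIV ft \<and> continuous_on UNIV fx"

lemma C1D:
  assumes "C1 f ft fx"
  shows "((\<lambda>s. f (s, x)) has_real_derivative ft (t, x)) (at t)"
    "((\<lambda>s. f (t, s)) has_real_derivative fx (t, x)) (at x)"
    "continuous_on A f" "continuous_on A ft" "continuous_on A fx"
  using assms unfolding C1_def by (auto intro: continuous_on_subset)

lemma C1_mult:
  assumes "C1 f ft fx" "C1 g gt gx"
  shows "C1 (\<lambda>z. f z * g z) (\<lambda>z. ft z * g z + gt z * f z) (\<lambda>z. fx z * g z + gx z * f z)"
  unfolding C1_def
  by (intro conjI allI DERIV_mult C1D[OF assms(1)] C1D[OF assms(2)] continuous_intros)

lemma C1_diff:
  assumes "C1 f ft fx" "C1 g gt gx"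
  shows "C1 (\<lambda>z. f z - g z) (\<lambda>z. ft z - gt z) (\<lambda>z. fx z - gx z)"
  unfolding C1_def
  by (intro conjI allI DERIV_diff C1D[OF assms(1)] C1D[OF assms(2)] continuous_intros)

lemma C1_cmult:
  assumes "C1 f ft fx"
  shows "C1 (\<lambda>z. c * f z) (\<lambda>z. c * ft z) (\<lambda>z. c * fx z)"
  unfolding C1_def
  by (intro conjI allI DERIV_cmult C1D[OF assms(1)] continuous_intros)

lemma C1_translate:
  assumes "C1 f ft fx"
  shows "C1 (\<lambda>z. f (z + k)) (\<lambda>z. ft (z + k)) (\<lambda>z. fx (z + k))"
proof -
  have "((\<lambda>s. f (s + fst k, x + snd k)) has_real_derivative ft (t + fst k, x + snd k)) (at t)"
    "((\<lambda>s. f (t + fst k, s + snd k)) has_real_derivative fx (t + fst k, x + snd k)) (at x)" for t x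
    using C1D(1)[OF assms, of "x + snd k" "t + fst k"] C1D(2)[OF assms, of "t + fst k" "x + snd k"]
    by (simp_all add: DERIV_shift)
  moreover have "continuous_on UNIV (\<lambda>z. g (z + k))" if "continuous_on UNIV g" for g :: "real \<times> real \<Rightarrow> real"
    by (rule continuous_on_compose2[OF that]) (auto intro: continuous_intros)
  ultimately show ?thesis
    using assms by (auto simp: C1_def plus_prod_def)
qed

lemma C1_zero_outside:
  assumes "C1 f ft fx" "closed S" "\<And>z. z \<notin> S \<Longrightarrow> f z = 0" "z \<notin> S"
  shows "ft z = 0" "fx z = 0"
proof -
  obtain t x where tx: "z = (t, x)" by (cases z)
  have op: "open (- S)" using assms(2) by (simp add: open_Compl)
  have "\<forall>\<^sub>F s in nhds t. f (s, x) = 0"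
  proof (rule eventually_mono[OF eventually_nhds_in_open[of "(\<lambda>s. (s, x)) -` (- S)"]])
    show "open ((\<lambda>s. (s, x)) -` (- S))" by (rule open_vimage[OF op]) (intro continuous_intros)
  qed (use assms tx in auto)
  then have "((\<lambda>s. f (s, x)) has_real_derivative 0) (at t)"
    by (subst DERIV_cong_ev[OF refl _ refl, where g = "\<lambda>_. 0"]) auto
  then show "ft z = 0" using DERIV_unique C1D(1)[OF assms(1)] tx by blast
  have "\<forall>\<^sub>F s in nhds x. f (t, s) = 0"
  proof (rule eventually_mono[OF eventually_nhds_in_open[of "(\<lambda>s. (t, s)) -` (- S)"]])
    show "open ((\<lambda>s. (t, s)) -` (- S))" by (rule open_vimage[OF op]) (intro continuous_intros)
  qed (use assms tx in auto)
  then have "((\<lambda>s. f (t, s)) has_real_derivative 0) (at x)"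
    by (subst DERIV_cong_ev[OF refl _ refl, where g = "\<lambda>_. 0"]) auto
  then show "fx z = 0" using DERIV_unique C1D(2)[OF assms(1)] tx by blast
qed

text \<open>Continuity of the partial derivatives gives total differentiability; the chain rule
  along the line does the rest.\<close>

lemma C1_directional:
  assumes "C1 f ft fx"
  shows "((\<lambda>s. f (z + s *\<^sub>R h)) has_real_derivative fst h * ft (z + s *\<^sub>R h) + snd h * fx (z + s *\<^sub>R h)) (at s)"
proof -
  have F: "(f has_derivative (\<lambda>(p, q). ft w * p + fx w * q)) (at w)" for w
  proof -
    obtain t x where w: "w = (t, x)" by (cases w)
    have "((\<lambda>(t, x). f (t, x)) has_derivative (\<lambda>(p, q). (*) (ft (t, x)) p + blinfun_apply (blinfun_mult_right (fx (t, x))) q))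
      (at (t, x) within UNIV \<times> UNIV)"
    proof (rule has_derivative_partialsI[where fy = "\<lambda>t x. blinfun_mult_right (fx (t, x))"])
      have "continuous_on UNIV (\<lambda>z. blinfun_mult_right (fx z))"
        by (intro bounded_linear.continuous_on[OF bounded_linear_blinfun_mult_right] C1D[OF assms])
      then show "continuous (at (t, x) within UNIV \<times> UNIV) (\<lambda>(t, x). blinfun_mult_right (fx (t, x)))"
        by (simp add: continuous_on_eq_continuous_at case_prod_unfold)
    qed (use C1D(1,2)[OF assms] in \<open>auto simp: has_field_derivative_def\<close>)
    then show ?thesis by (simp add: w case_prod_unfold)
  qed
  have g: "((\<lambda>s. z + s *\<^sub>R h) has_derivative (\<lambda>d. d *\<^sub>R h)) (at s)"
    by (auto intro!: derivative_eq_intros)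
  have "((\<lambda>s. f (z + s *\<^sub>R h)) has_derivative (\<lambda>d. (case d *\<^sub>R h of (p, q) \<Rightarrow> ft (z + s *\<^sub>R h) * p + fx (z + s *\<^sub>R h) * q))) (at s)"
    by (rule has_derivative_compose[OF g F])
  then show ?thesis
    unfolding has_field_derivative_def by (rule has_derivative_eq_rhs) (auto simp: fun_eq_iff algebra_simps case_prod_unfold)
qed

lemma integrable_continuous_square:
  assumes "continuous_on UNIV f" "\<And>z. z \<notin> square c R \<Longrightarrow> f z = 0"
  shows "integrable lborel (f :: real \<times> real \<Rightarrow> real)"
proof -
  have "integrable lborel (\<lambda>z. indicator (square c R) z *\<^sub>R f z)"
    using assms by (intro borel_integrable_compact) (auto intro: continuous_on_subset)
  moreover have "(\<lambda>z. indicator (square c R) z *\<^sub>R f z) = f"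
    by (rule ext) (use assms(2) in \<open>auto simp: indicator_def\<close>)
  ultimately show ?thesis by simp
qed

lemma C1_integral_derivative:
  assumes "C1 f ft fx" "\<And>z. z \<notin> square c R \<Longrightarrow> f z = 0"
  shows "(LINT z|lborel. ft z) = 0" "(LINT z|lborel. fx z) = 0"
    "integrable lborel ft" "integrable lborel fx"
proof -
  note z = C1_zero_outside[OF assms(1) closed_cbox assms(2)]
  show it: "integrable lborel ft"
    by (rule integrable_continuous_square[OF C1D(4)[OF assms(1)] z(1)])
  show ix: "integrable lborel fx"
    by (rule integrable_continuous_square[OF C1D(5)[OF assms(1)] z(2)])
  \<comment> \<open>Puts both end points of the integration interval outside the square, also for
    negative R.\<close>
  let ?R = "\<bar>R\<bar> + 1"
  have out: "f w = 0 \<and> ft w = 0 \<and> fx w = 0" if "\<bar>fst c - fst w\<bar> \<ge> ?R \<or> \<bar>snd c - snd w\<bar> \<ge> ?R" for w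
  proof -
    have "w \<notin> square c R" using that unfolding mem_square by linarith
    then show ?thesis using assms(2) z by blast
  qed
  have "(LINT t|lborel. ft (t, x)) = 0" for x
  proof -
    have "(LINT t|lborel. ft (t, x)) = (LINT t|lborel. ft (t, x) * indicator {fst c - ?R .. fst c + ?R} t)"
    proof (rule Bochner_Integration.integral_cong[OF refl])
      fix t show "ft (t, x) = ft (t, x) * indicator {fst c - ?R .. fst c + ?R} t"
      proof (cases "t \<in> {fst c - ?R .. fst c + ?R}")
        case False
        then have "\<bar>fst c - t\<bar> \<ge> ?R" by auto
        then show ?thesis using out[of "(t, x)"] by simp
      qed simp
    qed
    also have "\<dots> = f (fst c + ?R, x) - f (fst c - ?R, x)"
    proof (rule integral_FTC_Icc_real)
      have "continuous_on UNIV (\<lambda>t. ft (t, x))"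
        by (rule continuous_on_compose2[OF C1D(4)[OF assms(1), of UNIV]]) (auto intro: continuous_intros)
      then show "isCont (\<lambda>t. ft (t, x)) y" for y by (simp add: continuous_on_eq_continuous_at)
    qed (use C1D(1)[OF assms(1)] in auto)
    also have "\<dots> = 0" using out[of "(fst c + ?R, x)"] out[of "(fst c - ?R, x)"] by simp
    finally show ?thesis .
  qed
  moreover have "(LINT z|lborel. ft z) = (LINT x|lborel. LINT t|lborel. ft (t, x))"
    using it lborel_pair.integral_snd[of "\<lambda>t x. ft (t, x)"] by (simp add: lborel_prod)
  ultimately show "(LINT z|lborel. ft z) = 0" by simp
  have "(LINT x|lborel. fx (t, x)) = 0" for t
  proof -
    have "(LINT x|lborel. fx (t, x)) = (LINT x|lborel. fx (t, x) * indicator {snd c - ?R .. snd c + ?R} x)"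
    proof (rule Bochner_Integration.integral_cong[OF refl])
      fix x show "fx (t, x) = fx (t, x) * indicator {snd c - ?R .. snd c + ?R} x"
      proof (cases "x \<in> {snd c - ?R .. snd c + ?R}")
        case False
        then have "\<bar>snd c - x\<bar> \<ge> ?R" by auto
        then show ?thesis using out[of "(t, x)"] by simp
      qed simp
    qed
    also have "\<dots> = f (t, snd c + ?R) - f (t, snd c - ?R)"
    proof (rule integral_FTC_Icc_real)
      have "continuous_on UNIV (\<lambda>x. fx (t, x))"
        by (rule continuous_on_compose2[OF C1D(5)[OF assms(1), of UNIV]]) (auto intro: continuous_intros)
      then show "isCont (\<lambda>x. fx (t, x)) y" for y by (simp add: continuous_on_eq_continuous_at)
    qed (use C1D(2)[OF assms(1)] in auto)
    also have "\<dots> = 0" using out[of "(t, snd c + ?R)"] out[of "(t, snd c - ?R)"] by simp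
    finally show ?thesis .
  qed
  moreover have "(LINT z|lborel. fx z) = (LINT t|lborel. LINT x|lborel. fx (t, x))"
    using ix lborel_pair.integral_fst'[of fx] by (simp add: lborel_prod)
  ultimately show "(LINT z|lborel. fx z) = 0" by simp
qed

text \<open>With \<open>p = h1 b - h2 a\<close>, the derivative of the field \<open>(a, b)\<close> along \<open>h\<close> is
  \<open>h div (a, b)\<close> plus the rotated gradient \<open>(- p\<^sub>x, p\<^sub>t)\<close>; the gradient of \<open>p\<close> is integrated by parts.\<close>

lemma determinant_identity:
  assumes a: "C1 a a\<^sub>t ax" and b: "C1 b bt bx" and v: "C1 v vt vx" and w: "C1 w wt wx"
    and \<zeta>: "C1 \<zeta> \<zeta>t \<zeta>x" and \<zeta>0: "\<And>z. z \<notin> square c R \<Longrightarrow> \<zeta> z = 0"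
  shows "(LINT z|lborel. \<zeta> z * ((h1 * a\<^sub>t z + h2 * ax z) * w z - (h1 * bt z + h2 * bx z) * v z))
    = (LINT z|lborel. \<zeta> z * (h1 * w z - h2 * v z) * (a\<^sub>t z + bx z))
    + (LINT z|lborel. \<zeta> z * (h1 * b z - h2 * a z) * (vt z + wx z))
    + (LINT z|lborel. (h1 * b z - h2 * a z) * (\<zeta>t z * v z + \<zeta>x z * w z))"
proof -
  let ?p = "\<lambda>z. h1 * b z - h2 * a z"
  let ?pt = "\<lambda>z. h1 * bt z - h2 * a\<^sub>t z" and ?px = "\<lambda>z. h1 * bx z - h2 * ax z"
  have p: "C1 ?p ?pt ?px" by (intro C1_diff C1_cmult a b)
  note z = C1_zero_outside[OF \<zeta> closed_cbox \<zeta>0]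
  note cs = C1D(3-5)[OF a] C1D(3-5)[OF b] C1D(3-5)[OF v] C1D(3-5)[OF w] C1D(3-5)[OF \<zeta>]
  have 1: "(LINT z|lborel. (\<zeta>t z * ?p z + ?pt z * \<zeta> z) * v z + vt z * (\<zeta> z * ?p z)) = 0"
    by (rule C1_integral_derivative(1)[OF C1_mult[OF C1_mult[OF \<zeta> p] v], of c R]) (simp add: \<zeta>0)
  have 2: "(LINT z|lborel. (\<zeta>x z * ?p z + ?px z * \<zeta> z) * w z + wx z * (\<zeta> z * ?p z)) = 0"
    by (rule C1_integral_derivative(2)[OF C1_mult[OF C1_mult[OF \<zeta> p] w], of c R]) (simp add: \<zeta>0)
  have i1: "integrable lborel (\<lambda>z. (\<zeta>t z * ?p z + ?pt z * \<zeta> z) * v z + vt z * (\<zeta> z * ?p z))"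
    by (rule C1_integral_derivative(3)[OF C1_mult[OF C1_mult[OF \<zeta> p] v], of c R]) (simp add: \<zeta>0)
  have i2: "integrable lborel (\<lambda>z. (\<zeta>x z * ?p z + ?px z * \<zeta> z) * w z + wx z * (\<zeta> z * ?p z))"
    by (rule C1_integral_derivative(4)[OF C1_mult[OF C1_mult[OF \<zeta> p] w], of c R]) (simp add: \<zeta>0)
  have j1: "integrable lborel (\<lambda>z. \<zeta> z * (h1 * w z - h2 * v z) * (a\<^sub>t z + bx z))"
    by (rule integrable_continuous_square[of _ c R], intro continuous_intros cs) (simp add: \<zeta>0)
  have j2: "integrable lborel (\<lambda>z. \<zeta> z * ?p z * (vt z + wx z))"
    by (rule integrable_continuous_square[of _ c R], intro continuous_intros cs) (simp add: \<zeta>0)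
  have j3: "integrable lborel (\<lambda>z. ?p z * (\<zeta>t z * v z + \<zeta>x z * w z))"
    by (rule integrable_continuous_square[of _ c R], intro continuous_intros cs) (simp add: z)
  \<comment> \<open>The bracket on the left is (h1 w - h2 v) (a_t + b_x) - p_t v - p_x w. Its last
    two terms are completed to the full derivatives of \<zeta> p v in t and \<zeta> p w in x, whose
    integrals vanish by \<open>1\<close> and \<open>2\<close>.\<close>
  have "(LINT z|lborel. \<zeta> z * ((h1 * a\<^sub>t z + h2 * ax z) * w z - (h1 * bt z + h2 * bx z) * v z))
    = (LINT z|lborel. \<zeta> z * (h1 * w z - h2 * v z) * (a\<^sub>t z + bx z) + \<zeta> z * ?p z * (vt z + wx z)
      + ?p z * (\<zeta>t z * v z + \<zeta>x z * w z) - ((\<zeta>t z * ?p z + ?pt z * \<zeta> z) * v z + vt z * (\<zeta> z * ?p z))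
      - ((\<zeta>x z * ?p z + ?px z * \<zeta> z) * w z + wx z * (\<zeta> z * ?p z)))"
    by (intro Bochner_Integration.integral_cong refl) (simp add: algebra_simps)
  also have "\<dots> = (LINT z|lborel. \<zeta> z * (h1 * w z - h2 * v z) * (a\<^sub>t z + bx z)) + (LINT z|lborel. \<zeta> z * ?p z * (vt z + wx z))
      + (LINT z|lborel. ?p z * (\<zeta>t z * v z + \<zeta>x z * w z))
      - (LINT z|lborel. (\<zeta>t z * ?p z + ?pt z * \<zeta> z) * v z + vt z * (\<zeta> z * ?p z))
      - (LINT z|lborel. (\<zeta>x z * ?p z + ?px z * \<zeta> z) * w z + wx z * (\<zeta> z * ?p z))"
    by (simp only: Bochner_Integration.integral_diff Bochner_Integration.integral_add i1 i2 j1 j2 j3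
        Bochner_Integration.integrable_add Bochner_Integration.integrable_diff)
  finally show ?thesis unfolding 1 2 by simp
qed

section \<open>Uniform bounds on entropy production\<close>

text \<open>For v < 0 the first interval is empty and for v > 0 the second, so this is the signed
  integral from 0 to v. A fixed base point makes entropy and flux linear in \<eta>', which uniform
  boundedness requires.\<close>

definition primitive :: "(real \<Rightarrow> real) \<Rightarrow> real \<Rightarrow> real" where
  "primitive f v = integral {0..v} f - integral {v..0} f"

lemma primitive_0 [simp]: "primitive f 0 = 0"
  by (simp add: primitive_def)

lemma primitive_deriv:
  assumes "continuous_on UNIV f"
  shows "(primitive f has_real_derivative f v) (at v)"
proof -
  define c where "c = \<bar>v\<bar> + 1"
  have int: "f integrable_on {a..b}" for a b
    by (intro integrable_continuous_real continuous_on_subset[OF assms]) auto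
  have eq: "primitive f x = integral {-c..x} f - integral {-c..0} f" if "x \<in> {-c<..<c}" for x
  proof (cases "0 \<le> x")
    case True
    have "integral {-c..0} f + integral {0..x} f = integral {-c..x} f"
      using True that int by (intro Henstock_Kurzweil_Integration.integral_combine) (auto simp: c_def)
    moreover have "integral {x..0} f = 0" using True by (cases "x = 0") auto
    ultimately show ?thesis by (simp add: primitive_def)
  next
    case False
    have "integral {-c..x} f + integral {x..0} f = integral {-c..0} f"
      using False that int by (intro Henstock_Kurzweil_Integration.integral_combine) (auto simp: c_def)
    then show ?thesis using False by (simp add: primitive_def)
  qed
  have "((\<lambda>x. integral {-c..x} f) has_real_derivative f v) (at v within {-c..c})"
    by (intro integral_has_real_derivative continuous_on_subset[OF assms]) (auto simp: c_def)
  then have "((\<lambda>x. integral {-c..x} f) has_real_derivative f v) (at v)"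
    by (subst (asm) at_within_Icc_at) (auto simp: c_def)
  then have "((\<lambda>x. integral {-c..x} f - integral {-c..0} f) has_real_derivative f v) (at v)"
    by (auto intro!: derivative_eq_intros)
  moreover have "\<forall>\<^sub>F x in nhds v. primitive f x = integral {-c..x} f - integral {-c..0} f"
    by (rule eventually_mono[OF eventually_nhds_in_open[of "{-c<..<c}" v]]) (use eq in \<open>auto simp: c_def\<close>)
  ultimately show ?thesis by (subst DERIV_cong_ev[OF refl _ refl]) auto
qed

lemma primitive_add:
  assumes "continuous_on UNIV f" "continuous_on UNIV g"
  shows "primitive (\<lambda>v. f v + g v) v = primitive f v + primitive g v"
proof -
  have "f integrable_on {a..b}" "g integrable_on {a..b}" for a b
    by (intro integrable_continuous_real continuous_on_subset[OF assms(1)] continuous_on_subset[OF assms(2)] subset_UNIV)+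
  then show ?thesis by (simp add: primitive_def Henstock_Kurzweil_Integration.integral_add)
qed

lemma primitive_mult: "primitive (\<lambda>v. c * f v) v = c * primitive f v"
  by (simp add: primitive_def right_diff_distrib)

lemma primitive_diff:
  assumes "continuous_on UNIV f" "continuous_on UNIV g"
  shows "primitive (\<lambda>v. f v - g v) v = primitive f v - primitive g v"
  using primitive_add[OF assms(1), of "\<lambda>v. - 1 * g v"] primitive_mult[of "- 1" g] assms(2)
  by (simp add: continuous_on_minus)

text \<open>The bound is asked for on [-M, M], the range of u, because fluxes involve a', which is
  unbounded on the whole line.\<close>

lemma primitive_Lipschitz:
  assumes "continuous_on UNIV f" "\<And>x. x \<in> {-M..M} \<Longrightarrow> \<bar>f x\<bar> \<le> B" "\<bar>v\<bar> \<le> M" "\<bar>w\<bar> \<le> M"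
  shows "\<bar>primitive f v - primitive f w\<bar> \<le> B * \<bar>v - w\<bar>"
proof -
  have "norm (primitive f v - primitive f w) \<le> B * norm (v - w)"
    by (rule field_differentiable_bound[of "{-M..M}" "primitive f" f])
       (use assms DERIV_subset[OF primitive_deriv[OF assms(1)]] in auto)
  then show ?thesis by simp
qed

lemma primitive_bound:
  assumes "continuous_on UNIV f" "\<And>x. x \<in> {-M..M} \<Longrightarrow> \<bar>f x\<bar> \<le> B" "\<bar>v\<bar> \<le> M"
  shows "\<bar>primitive f v\<bar> \<le> B * M"
proof -
  have M: "M \<ge> 0" using assms(3) by linarith
  then have "B \<ge> 0" using assms(2)[of 0] by auto
  have "\<bar>primitive f v - primitive f 0\<bar> \<le> B * \<bar>v - 0\<bar>"
    by (rule primitive_Lipschitz[OF assms]) (use M in auto)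
  then have "\<bar>primitive f v\<bar> \<le> B * \<bar>v\<bar>" by simp
  also have "\<dots> \<le> B * M" using \<open>B \<ge> 0\<close> assms(3) by (intro mult_left_mono)
  finally show ?thesis .
qed

lemma primitive_cont: "continuous_on UNIV f \<Longrightarrow> continuous_on A (primitive f)"
  by (intro continuous_at_imp_continuous_on ballI) (rule DERIV_isCont[OF primitive_deriv])

section \<open>Test functions and Radon measures\<close>

lemma test_fun_C1:
  assumes "test_fun \<Omega> \<phi>"
  shows "C1 \<phi> (pd_t \<phi>) (pd_x \<phi>)"
proof -
  have sm: "continuous_on UNIV (iter_pd bs \<phi>)"
    "(\<lambda>s. iter_pd bs \<phi> (s, x)) differentiable (at t)" "(\<lambda>y. iter_pd bs \<phi> (t, y)) differentiable (at x)" for bs t x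
    using assms unfolding test_fun_def smooth2_def by blast+
  show ?thesis
    unfolding C1_def
    using sm(1)[of "[]"] sm(1)[of "[True]"] sm(1)[of "[False]"] sm(2,3)[of "[]"]
    by (simp add: pd_t_def pd_x_def DERIV_deriv_iff_real_differentiable)
qed

lemma test_fun_derivatives:
  assumes "test_fun \<Omega> \<phi>"
  shows "continuous_on UNIV \<phi>" "continuous_on UNIV (pd_t \<phi>)" "continuous_on UNIV (pd_x \<phi>)"
    and "z \<notin> tsupp \<phi> \<Longrightarrow> \<phi> z = 0" "z \<notin> tsupp \<phi> \<Longrightarrow> pd_t \<phi> z = 0" "z \<notin> tsupp \<phi> \<Longrightarrow> pd_x \<phi> z = 0"
proof -
  note C = test_fun_C1[OF assms]
  show "continuous_on UNIV \<phi>" "continuous_on UNIV (pd_t \<phi>)" "continuous_on UNIV (pd_x \<phi>)"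
    by (rule C1D[OF C])+
  have 0: "\<phi> w = 0" if "w \<notin> tsupp \<phi>" for w
    using that closure_subset[of "{z. \<phi> z \<noteq> 0}"] by (auto simp: tsupp_def)
  have cl: "closed (tsupp \<phi>)" by (simp add: tsupp_def)
  show "z \<notin> tsupp \<phi> \<Longrightarrow> \<phi> z = 0" "z \<notin> tsupp \<phi> \<Longrightarrow> pd_t \<phi> z = 0" "z \<notin> tsupp \<phi> \<Longrightarrow> pd_x \<phi> z = 0"
    using 0 C1_zero_outside[OF C cl 0] by auto
qed

lemma integrable_mult_compact_support:
  fixes f g :: "'a::euclidean_space \<Rightarrow> real"
  assumes [measurable]: "f \<in> borel_measurable borel" and f: "\<And>z. \<bar>f z\<bar> \<le> B"
    and g: "continuous_on UNIV g" "compact K" "\<And>z. z \<notin> K \<Longrightarrow> g z = 0"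
  shows "integrable lborel (\<lambda>z. f z * g z)" "\<bar>LINT z|lborel. f z * g z\<bar> \<le> B * (LINT z|lborel. \<bar>g z\<bar>)"
proof -
  have "integrable lborel (\<lambda>z. indicator K z *\<^sub>R g z)"
    using g by (intro borel_integrable_compact) (auto intro: continuous_on_subset)
  moreover have "(\<lambda>z. indicator K z *\<^sub>R g z) = g" by (rule ext) (use g(3) in \<open>auto simp: indicator_def\<close>)
  ultimately have ig: "integrable lborel g" by simp
  have B: "B \<ge> 0" using f[of undefined] by linarith
  have le: "\<bar>f z * g z\<bar> \<le> B * \<bar>g z\<bar>" for z using f by (simp add: abs_mult mult_right_mono)
  show i: "integrable lborel (\<lambda>z. f z * g z)"
    by (rule Bochner_Integration.integrable_bound[of lborel "\<lambda>z. B * \<bar>g z\<bar>"]) (use ig le in \<open>auto intro: order_trans[OF _ abs_ge_self]\<close>)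
  have "\<bar>LINT z|lborel. f z * g z\<bar> \<le> (LINT z|lborel. \<bar>f z * g z\<bar>)" by (rule integral_abs_bound)
  also have "\<dots> \<le> (LINT z|lborel. B * \<bar>g z\<bar>)" using i ig le by (intro integral_mono) auto
  finally show "\<bar>LINT z|lborel. f z * g z\<bar> \<le> B * (LINT z|lborel. \<bar>g z\<bar>)" by simp
qed

lemma radon_on_integral_bound:
  assumes "radon_on \<Omega> \<mu>" "test_fun \<Omega> \<phi>" "tsupp \<phi> \<subseteq> K" "compact K" "K \<subseteq> \<Omega>" "\<And>z. \<bar>\<phi> z\<bar> \<le> 1"
  shows "\<bar>\<integral>z. \<phi> z \<partial>\<mu>\<bar> \<le> measure \<mu> K"
proof -
  have [measurable_cong]: "sets \<mu> = sets borel" and fin: "emeasure \<mu> K < \<infinity>"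
    using assms by (auto simp: radon_on_def)
  have K: "K \<in> sets \<mu>" using assms(4) by (simp add: \<open>sets \<mu> = sets borel\<close> compact_imp_closed)
  have iK: "integrable \<mu> (indicator K :: _ \<Rightarrow> real)" using fin K by (intro integrable_real_indicator) auto
  have \<phi>: "\<phi> \<in> borel_measurable \<mu>"
    using borel_measurable_continuous_onI[OF test_fun_derivatives(1)[OF assms(2)]] by measurable
  have le: "\<bar>\<phi> z\<bar> \<le> indicator K z" for z
    using assms(3,6) test_fun_derivatives(4)[OF assms(2), of z] by (auto simp: indicator_def)
  have i: "integrable \<mu> \<phi>"
    by (rule Bochner_Integration.integrable_bound[OF iK \<phi>]) (use le in auto)
  have "\<bar>\<integral>z. \<phi> z \<partial>\<mu>\<bar> \<le> (\<integral>z. \<bar>\<phi> z\<bar> \<partial>\<mu>)" by (rule integral_abs_bound)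
  also have "\<dots> \<le> (\<integral>z. indicator K z \<partial>\<mu>)" using i iK le by (intro integral_mono) auto
  also have "\<dots> = measure \<mu> K" using K sets.sets_into_space[OF K] by (simp add: Int_absorb2)
  finally show ?thesis .
qed

text \<open>As \<open>\<partial>\<^sub>t \<eta>(u) + \<partial>\<^sub>x q(u) = - \<mu>\<close> for the entropy with \<open>\<eta>' = \<psi>\<close>, this is the integral of \<open>\<phi>\<close> against \<open>\<mu>\<close>.\<close>

definition entropy_pairing :: "(real \<Rightarrow> real) \<Rightarrow> (real \<times> real \<Rightarrow> real) \<Rightarrow> (real \<Rightarrow> real) \<Rightarrow> (real \<times> real \<Rightarrow> real) \<Rightarrow> real" where
  "entropy_pairing a' u \<psi> \<phi> = (LINT z|lborel. primitive \<psi> (u z) * pd_t \<phi> z + primitive (\<lambda>v. \<psi> v * a' v) (u z) * pd_x \<phi> z)"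

text \<open>\<open>uniform_boundedness_on_cone\<close> is applied to the bounded nondecreasing
  \<psi> = \<eta>', with one functional for each test function \<phi>. For fixed \<psi> the masses
  of the two measures on K bound all functionals at once; each functional is continuous because u
  takes values in [-M, M], where a' is bounded. By duality the constant acts as a common mass bound
  for the productions of all these entropies.\<close>

lemma uniform_entropy_production:
  fixes u :: "real \<times> real \<Rightarrow> real" and a' :: "real \<Rightarrow> real"
  assumes [measurable]: "u \<in> borel_measurable borel" and u: "\<And>z. \<bar>u z\<bar> \<le> M"
    and a': "continuous_on UNIV a'" and K: "compact K" "K \<subseteq> \<Omega>"
    and entropy: "\<And>\<eta> \<eta>' q. convex_on UNIV \<eta> \<Longrightarrow>
       (\<forall>v. (\<eta> has_real_derivative \<eta>' v) (at v)) \<Longrightarrow> continuous_on UNIV \<eta>' \<Longrightarrow>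
       (\<forall>v. (q has_real_derivative \<eta>' v * a' v) (at v)) \<Longrightarrow>
       \<exists>\<mu>p \<mu>n. radon_on \<Omega> \<mu>p \<and> radon_on \<Omega> \<mu>n \<and>
         (\<forall>\<phi>. test_fun \<Omega> \<phi> \<longrightarrow>
            (LINT z|lborel. \<eta> (u z) * pd_t \<phi> z + q (u z) * pd_x \<phi> z)
            = (\<integral>z. \<phi> z \<partial>\<mu>p) - (\<integral>z. \<phi> z \<partial>\<mu>n))"
  shows "\<exists>C\<ge>0. \<forall>\<psi> \<phi>. continuous_on UNIV \<psi> \<longrightarrow> mono \<psi> \<longrightarrow> (\<forall>v. \<bar>\<psi> v\<bar> \<le> 1) \<longrightarrow>
    test_fun \<Omega> \<phi> \<longrightarrow> tsupp \<phi> \<subseteq> K \<longrightarrow> (\<forall>z. \<bar>\<phi> z\<bar> \<le> 1) \<longrightarrow> \<bar>entropy_pairing a' u \<psi> \<phi>\<bar> \<le> C"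
proof -
  have M: "M \<ge> 0" using u[of undefined] by linarith
  have "bounded (a' ` {-M..M})"
    by (intro compact_imp_bounded compact_continuous_image continuous_on_subset[OF a']) auto
  then obtain A where "\<forall>y\<in>a' ` {-M..M}. norm y \<le> A" by (meson bounded_iff)
  then have A: "\<bar>a' v\<bar> \<le> A" if "v \<in> {-M..M}" for v using that by simp
  have A0: "A \<ge> 0" using order_trans[OF abs_ge_zero A[of 0]] M by simp
  \<comment> \<open>Bounded continuous functions with the sup norm provide completeness, and
    monotonicity survives uniform limits.\<close>
  define S :: "(real \<Rightarrow>\<^sub>C real) set" where "S = {f. mono (apply_bcontfun f)}"
  define \<Phi> where "\<Phi> = {\<phi>. test_fun \<Omega> \<phi> \<and> tsupp \<phi> \<subseteq> K \<and> (\<forall>z. \<bar>\<phi> z\<bar> \<le> 1)}"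
  define T where "T \<phi> f = entropy_pairing a' u (apply_bcontfun f) \<phi>" for \<phi> and f :: "real \<Rightarrow>\<^sub>C real"
  have fb: "\<bar>f v\<bar> \<le> norm f" for f :: "real \<Rightarrow>\<^sub>C real" and v
    using norm_bounded[of f v] by simp
  have ca: "continuous_on UNIV (\<lambda>v. f v * a' v)" for f :: "real \<Rightarrow>\<^sub>C real"
    using a' by (intro continuous_intros) auto
  have m1: "(\<lambda>z. primitive g (u z)) \<in> borel_measurable borel" if "continuous_on UNIV g" for g
    using borel_measurable_continuous_onI[OF primitive_cont[OF that]] by measurable
  have b1: "\<bar>primitive f (u z)\<bar> \<le> norm f * M" for f :: "real \<Rightarrow>\<^sub>C real" and z
    using fb u by (intro primitive_bound) auto
  have b2: "\<bar>primitive (\<lambda>v. f v * a' v) (u z)\<bar> \<le> (norm f * A) * M" for f :: "real \<Rightarrow>\<^sub>C real" and z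
    using fb A u ca by (intro primitive_bound) (auto simp: abs_mult intro!: mult_mono)
  have tz: "pd_t \<phi> z = 0" "pd_x \<phi> z = 0" "continuous_on UNIV (pd_t \<phi>)" "continuous_on UNIV (pd_x \<phi>)"
    if "\<phi> \<in> \<Phi>" "z \<notin> K" for \<phi> z
    using that test_fun_derivatives(2,3)[of \<Omega> \<phi>] test_fun_derivatives(5,6)[of \<Omega> \<phi> z] by (auto simp: \<Phi>_def)
  have cph: "continuous_on UNIV (pd_t \<phi>)" "continuous_on UNIV (pd_x \<phi>)" if "\<phi> \<in> \<Phi>" for \<phi>
    using that test_fun_derivatives(2,3)[of \<Omega> \<phi>] by (auto simp: \<Phi>_def)
  note I1 = integrable_mult_compact_support[OF m1[OF continuous_on_apply_bcontfun] b1 cph(1) K(1) tz(1)]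
  note I2 = integrable_mult_compact_support[OF m1[OF ca] b2 cph(2) K(1) tz(2)]
  have "\<exists>C\<ge>0. \<forall>f\<in>S. \<forall>L\<in>T ` \<Phi>. \<bar>L f\<bar> \<le> C * norm f"
  proof (rule uniform_boundedness_on_cone)
    show "closed S" unfolding closed_sequential_limits
    proof safe
      fix f l assume f: "\<forall>n. f n \<in> S" and lim: "f \<longlonglongrightarrow> l"
      have p: "(\<lambda>n. f n x) \<longlonglongrightarrow> l x" for x
        using tendsto_bcontfun_uniform_limit[OF lim] by (rule tendsto_uniform_limitI) simp
      show "l \<in> S" unfolding S_def mem_Collect_eq
      proof (rule monoI)
        fix x y :: real assume "x \<le> y"
        then show "l x \<le> l y" using f by (intro LIMSEQ_le[OF p p]) (auto simp: S_def mono_def)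
      qed
    qed
    show "0 \<in> S" by (simp add: S_def mono_def)
    show "x + y \<in> S" if "x \<in> S" "y \<in> S" for x y using that by (simp add: S_def mono_def add_mono)
    show "c *\<^sub>R x \<in> S" if "x \<in> S" "0 \<le> c" for x c using that by (simp add: S_def mono_def mult_left_mono)
    show "bounded_linear L" if "L \<in> T ` \<Phi>" for L
    proof -
      from that obtain \<phi> where \<phi>: "\<phi> \<in> \<Phi>" and L: "L = T \<phi>" by blast
      let ?It = "LINT z|lborel. \<bar>pd_t \<phi> z\<bar>" and ?Ix = "LINT z|lborel. \<bar>pd_x \<phi> z\<bar>"
      have split: "T \<phi> f = (LINT z|lborel. primitive f (u z) * pd_t \<phi> z) + (LINT z|lborel. primitive (\<lambda>v. f v * a' v) (u z) * pd_x \<phi> z)" for f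
        unfolding T_def entropy_pairing_def
        by (intro Bochner_Integration.integral_add I1(1) I2(1) \<phi>)
      show ?thesis unfolding L
      proof (rule bounded_linear_intro)
        fix f g :: "real \<Rightarrow>\<^sub>C real" and r :: real
        have 1: "primitive (\<lambda>v. f v + g v) w = primitive f w + primitive g w" for w
          by (intro primitive_add) auto
        have 2: "primitive (\<lambda>v. (f v + g v) * a' v) w = primitive (\<lambda>v. f v * a' v) w + primitive (\<lambda>v. g v * a' v) w" for w
          using primitive_add[OF ca ca] by (simp add: algebra_simps)
        show "T \<phi> (f + g) = T \<phi> f + T \<phi> g"
          unfolding split plus_bcontfun.rep_eq 1 2
          using I1(1)[OF \<phi>] I2(1)[OF \<phi>] \<phi> by (simp add: algebra_simps)
        have 3: "primitive (\<lambda>v. r * f v * a' v) w = r * primitive (\<lambda>v. f v * a' v) w" for w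
          using primitive_mult[of r "\<lambda>v. f v * a' v"] by (simp add: algebra_simps)
        show "T \<phi> (r *\<^sub>R f) = r *\<^sub>R T \<phi> f"
          unfolding split scaleR_bcontfun.rep_eq real_scaleR_def primitive_mult 3
          by (simp add: algebra_simps flip: Bochner_Integration.integral_mult_right_zero)
        have "\<bar>T \<phi> f\<bar> \<le> norm f * M * ?It + norm f * A * M * ?Ix"
          unfolding split using I1(2)[OF \<phi> \<phi>, of f] I2(2)[OF \<phi> \<phi>, of f] by linarith
        then show "norm (T \<phi> f) \<le> norm f * (M * ?It + A * M * ?Ix)" by (simp add: algebra_simps)
      qed
    qed
    show "\<exists>B. \<forall>L\<in>T ` \<Phi>. \<bar>L f\<bar> \<le> B" if "f \<in> S" for f
    proof -
      \<comment> \<open>Membership in the cone enters here: a nondecreasing f is the derivative of a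
        convex entropy.\<close>
      have "convex_on UNIV (primitive f)"
      proof (rule convex_on_realI)
        show "(primitive f has_real_derivative f v) (at v)" for v by (intro primitive_deriv) auto
      qed (use that in \<open>auto simp: S_def mono_def\<close>)
      moreover have "\<forall>v. (primitive f has_real_derivative f v) (at v)" by (intro allI primitive_deriv) auto
      moreover have "\<forall>v. (primitive (\<lambda>v. f v * a' v) has_real_derivative f v * a' v) (at v)"
        by (intro allI primitive_deriv ca)
      ultimately obtain \<mu>p \<mu>n where \<mu>: "radon_on \<Omega> \<mu>p" "radon_on \<Omega> \<mu>n"
        "\<And>\<phi>. test_fun \<Omega> \<phi> \<Longrightarrow> T \<phi> f = (\<integral>z. \<phi> z \<partial>\<mu>p) - (\<integral>z. \<phi> z \<partial>\<mu>n)"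
        unfolding T_def entropy_pairing_def using entropy[of "primitive f" f "primitive (\<lambda>v. f v * a' v)"] by auto
      have "\<bar>T \<phi> f\<bar> \<le> measure \<mu>p K + measure \<mu>n K" if "\<phi> \<in> \<Phi>" for \<phi>
        using radon_on_integral_bound[OF \<mu>(1), of \<phi> K] radon_on_integral_bound[OF \<mu>(2), of \<phi> K] \<mu>(3)[of \<phi>] that K
        by (auto simp: \<Phi>_def)
      then show ?thesis by blast
    qed
  qed
  then obtain C where C: "C \<ge> 0" "\<And>f \<phi>. f \<in> S \<Longrightarrow> \<phi> \<in> \<Phi> \<Longrightarrow> \<bar>T \<phi> f\<bar> \<le> C * norm f" by auto
  have "\<bar>entropy_pairing a' u \<psi> \<phi>\<bar> \<le> C"
    if "continuous_on UNIV \<psi>" "mono \<psi>" "\<forall>v. \<bar>\<psi> v\<bar> \<le> 1" "\<phi> \<in> \<Phi>" for \<psi> \<phi>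
  proof -
    have "\<psi> \<in> bcontfun" using that by (intro bcontfun_normI[of _ 1]) auto
    then obtain f where f: "\<psi> = apply_bcontfun f" by (rule bcontfunE)
    have "norm f \<le> 1" using that(3) by (intro norm_bound) (simp add: f)
    moreover have "\<bar>T \<phi> f\<bar> \<le> C * norm f" using C(2) that f by (auto simp: S_def)
    ultimately have "\<bar>T \<phi> f\<bar> \<le> C" using C(1) by (smt (verit) mult_left_le)
    then show ?thesis by (simp add: T_def f)
  qed
  then show ?thesis using C(1) by (auto simp: \<Phi>_def)
qed

section \<open>The interaction estimate for mollified fields\<close>

context mollifier
begin

lemma C1_conv:
  assumes "f \<in> borel_measurable borel" "\<And>y. \<bar>f y\<bar> \<le> B"
  shows "C1 (conv m n f) (conv (Suc m) n f) (conv m (Suc n) f)"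
  unfolding C1_def
  by (intro conjI allI conv_deriv_fst[OF assms] conv_deriv_snd[OF assms] conv_cont[OF assms])

lemma conv_diff:
  assumes "f \<in> borel_measurable borel" "\<And>y. \<bar>f y\<bar> \<le> B" "g \<in> borel_measurable borel" "\<And>y. \<bar>g y\<bar> \<le> B"
  shows "conv m n (\<lambda>y. f y - g y) z = conv m n f z - conv m n g z"
  unfolding conv_def right_diff_distrib
  by (intro Bochner_Integration.integral_diff kern_integrable[OF assms(1,2)] kern_integrable[OF assms(3,4)])

text \<open>Taylor expansion along the direction h, uniformly in z. The constant may depend on
  \<epsilon> and h, since it only supplies the majorant for differentiating under the
  integral.\<close>

lemma conv_directional_remainder:
  assumes "f \<in> borel_measurable borel" "\<And>y. \<bar>f y\<bar> \<le> B"
  shows "\<exists>C\<ge>0. \<forall>z s t. \<bar>conv 0 0 f (z + s *\<^sub>R h) - conv 0 0 f (z + t *\<^sub>R h)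
     - (s - t) * (fst h * conv (Suc 0) 0 f (z + t *\<^sub>R h) + snd h * conv 0 (Suc 0) f (z + t *\<^sub>R h))\<bar> \<le> C * (s - t)\<^sup>2"
proof -
  define D where "D z = fst h * conv (Suc 0) 0 f z + snd h * conv 0 (Suc 0) f z" for z
  define D2 where "D2 z = fst h * (fst h * conv (Suc (Suc 0)) 0 f z + snd h * conv (Suc 0) (Suc 0) f z)
      + snd h * (fst h * conv (Suc 0) (Suc 0) f z + snd h * conv 0 (Suc (Suc 0)) f z)" for z
  define C where "C = \<bar>fst h\<bar> * (\<bar>fst h\<bar> * (cmax (Suc (Suc 0)) 0 * B) + \<bar>snd h\<bar> * (cmax (Suc 0) (Suc 0) * B))
      + \<bar>snd h\<bar> * (\<bar>fst h\<bar> * (cmax (Suc 0) (Suc 0) * B) + \<bar>snd h\<bar> * (cmax 0 (Suc (Suc 0)) * B))"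
  have B: "B \<ge> 0" using assms(2)[of undefined] by linarith
  have C: "C \<ge> 0" unfolding C_def using B by (intro add_nonneg_nonneg mult_nonneg_nonneg) (auto simp: cmax_nonneg)
  have D2: "\<bar>D2 z\<bar> \<le> C" for z
    unfolding D2_def C_def
    by (intro order_trans[OF abs_triangle_ineq] add_mono order_trans[OF eq_refl[OF abs_mult]] mult_left_mono
        conv_bound_cmax[OF assms]) auto
  have "\<bar>conv 0 0 f (z + s *\<^sub>R h) - conv 0 0 f (z + t *\<^sub>R h) - (s - t) * D (z + t *\<^sub>R h)\<bar> \<le> C * (s - t)\<^sup>2" for z s t
  proof (rule first_order_remainder[where f'' = "\<lambda>s. D2 (z + s *\<^sub>R h)"])
    show "((\<lambda>s. conv 0 0 f (z + s *\<^sub>R h)) has_real_derivative D (z + s *\<^sub>R h)) (at s)" for s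
      unfolding D_def by (rule C1_directional[OF C1_conv[OF assms]])
    show "((\<lambda>s. D (z + s *\<^sub>R h)) has_real_derivative D2 (z + s *\<^sub>R h)) (at s)" for s
      unfolding D_def D2_def
      by (intro DERIV_add DERIV_cmult C1_directional[OF C1_conv[OF assms]])
  qed (rule D2)
  then show ?thesis using C unfolding D_def by blast
qed

text \<open>Let v, w be the increments by h of the differences of consecutive fields. Antisymmetry
  turns det (\<Delta> V_i, \<Delta> V_{i+1}) into det (\<Delta> V_i, (v, w)); its first entry is a
  difference along the segment from z to z + h, so the mean value theorem and
  \<open>determinant_identity\<close> apply. This leaves a divergence at an intermediate point
  against an O(\<kappa>) field, a cutoff term, and increments of divergences against a weight of
  size |h|; only the last needs summation by parts. All information on divergences sits in
  \<open>dual\<close>, whose test functions may reach |h| beyond the support of \<zeta> because they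
  get translated. The bound does not involve \<epsilon>.\<close>

lemma smoothed_interaction_bound:
  fixes A B :: "nat \<Rightarrow> real \<times> real \<Rightarrow> real" and h :: "real \<times> real"
  assumes mA: "\<And>i. A i \<in> borel_measurable borel" and mB: "\<And>i. B i \<in> borel_measurable borel"
    and bA: "\<And>i y. \<bar>A i y\<bar> \<le> \<Gamma>" and bB: "\<And>i y. \<bar>B i y\<bar> \<le> \<Gamma>"
    and dA: "\<And>i y. \<bar>A (Suc i) y - A i y\<bar> \<le> \<kappa>" and dB: "\<And>i y. \<bar>B (Suc i) y - B i y\<bar> \<le> \<kappa>"
    and \<zeta>: "C1 \<zeta> \<zeta>t \<zeta>x" and \<zeta>0: "\<And>z. z \<notin> square c R \<Longrightarrow> \<zeta> z = 0"
    and \<zeta>1: "\<And>z. \<bar>\<zeta> z\<bar> \<le> 1" "\<And>z. \<bar>\<zeta>t z\<bar> \<le> \<Lambda>" "\<And>z. \<bar>\<zeta>x z\<bar> \<le> \<Lambda>"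
    and dual: "\<And>i g. i \<le> Suc n \<Longrightarrow> g \<in> borel_measurable borel \<Longrightarrow> (\<And>z. \<bar>g z\<bar> \<le> 1) \<Longrightarrow>
       (\<And>z. g z \<noteq> 0 \<Longrightarrow> \<exists>y. \<zeta> y \<noteq> 0 \<and> dist z y \<le> norm h) \<Longrightarrow>
       \<bar>LINT z|lborel. g z * (conv (Suc 0) 0 (A i) z + conv 0 (Suc 0) (B i) z)\<bar> \<le> C0"
  shows "\<bar>\<Sum>i\<le>n. LINT z|lborel. \<zeta> z *
      ((conv 0 0 (A i) (z + h) - conv 0 0 (A i) z) * (conv 0 0 (B (Suc i)) (z + h) - conv 0 0 (B (Suc i)) z)
     - (conv 0 0 (B i) (z + h) - conv 0 0 (B i) z) * (conv 0 0 (A (Suc i)) (z + h) - conv 0 0 (A (Suc i)) z))\<bar>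
   \<le> norm h * ((real n + 1) * \<kappa> * (8 * C0 + 8 * \<Gamma> * \<Lambda> * measure lborel (square c R)) + 8 * C0 * \<Gamma>)"
proof -
  define a where "a i = conv 0 0 (A i)" for i
  define b where "b i = conv 0 0 (B i)" for i
  define a\<^sub>t where "a\<^sub>t i = conv (Suc 0) 0 (A i)" for i
  define ax where "ax i = conv 0 (Suc 0) (A i)" for i
  define bt where "bt i = conv (Suc 0) 0 (B i)" for i
  define bx where "bx i = conv 0 (Suc 0) (B i)" for i
  define m where "m i z = a\<^sub>t i z + bx i z" for i z
  define v where "v i z = (a (Suc i) (z + h) - a i (z + h)) - (a (Suc i) z - a i z)" for i z
  define w where "w i z = (b (Suc i) (z + h) - b i (z + h)) - (b (Suc i) z - b i z)" for i z
  define vt where "vt i z = (a\<^sub>t (Suc i) (z + h) - a\<^sub>t i (z + h)) - (a\<^sub>t (Suc i) z - a\<^sub>t i z)" for i z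
  define wx where "wx i z = (bx (Suc i) (z + h) - bx i (z + h)) - (bx (Suc i) z - bx i z)" for i z
  define h1 where "h1 = fst h"
  define h2 where "h2 = snd h"
  define N where "N = norm h"
  have \<Gamma>: "\<Gamma> \<ge> 0" using bA[of 0 undefined] by linarith
  have \<kappa>: "\<kappa> \<ge> 0" using dA[of 0 undefined] by linarith
  have \<Lambda>: "\<Lambda> \<ge> 0" using \<zeta>1(2)[of undefined] by linarith
  have C0: "C0 \<ge> 0" using dual[of 0 "\<lambda>_. 0"] by simp
  have N: "N \<ge> 0" "\<bar>h1\<bar> \<le> N" "\<bar>h2\<bar> \<le> N"
    using norm_fst_le[of "fst h" "snd h"] norm_snd_le[of "snd h" "fst h"] by (auto simp: N_def h1_def h2_def)
  have Ca: "C1 (a i) (a\<^sub>t i) (ax i)" and Cb: "C1 (b i) (bt i) (bx i)" for i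
    unfolding a_def a\<^sub>t_def ax_def b_def bt_def bx_def using C1_conv mA bA mB bB by blast+
  have Cv: "C1 (v i) (vt i) (\<lambda>z. (ax (Suc i) (z + h) - ax i (z + h)) - (ax (Suc i) z - ax i z))" for i
    unfolding v_def vt_def by (intro C1_diff C1_translate Ca)
  have Cw: "C1 (w i) (\<lambda>z. (bt (Suc i) (z + h) - bt i (z + h)) - (bt (Suc i) z - bt i z)) (wx i)" for i
    unfolding w_def wx_def by (intro C1_diff C1_translate Cb)
  have a_bd: "\<bar>a i z\<bar> \<le> \<Gamma>" and b_bd: "\<bar>b i z\<bar> \<le> \<Gamma>" for i z
    unfolding a_def b_def using conv_bound mA bA mB bB by blast+
  have da: "\<bar>a (Suc i) z - a i z\<bar> \<le> \<kappa>" for i z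
  proof -
    have "a (Suc i) z - a i z = conv 0 0 (\<lambda>y. A (Suc i) y - A i y) z"
      unfolding a_def by (rule conv_diff[symmetric, of _ \<Gamma>]) (use mA bA in auto)
    then show ?thesis using conv_bound[of "\<lambda>y. A (Suc i) y - A i y" \<kappa> z] mA dA by simp
  qed
  have db: "\<bar>b (Suc i) z - b i z\<bar> \<le> \<kappa>" for i z
  proof -
    have "b (Suc i) z - b i z = conv 0 0 (\<lambda>y. B (Suc i) y - B i y) z"
      unfolding b_def by (rule conv_diff[symmetric, of _ \<Gamma>]) (use mB bB in auto)
    then show ?thesis using conv_bound[of "\<lambda>y. B (Suc i) y - B i y" \<kappa> z] mB dB by simp
  qed
  have v_bd: "\<bar>v i z\<bar> \<le> 2 * \<kappa>" and w_bd: "\<bar>w i z\<bar> \<le> 2 * \<kappa>" for i z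
    using da[of i "z + h"] da[of i z] db[of i "z + h"] db[of i z] unfolding v_def w_def by linarith+
  have meas: "g \<in> borel_measurable borel" if "continuous_on UNIV g" for g :: "real \<times> real \<Rightarrow> real"
    using that by (rule borel_measurable_continuous_onI)
  have tr: "continuous_on S (\<lambda>z. g (z + k))" if "continuous_on UNIV g" for g :: "real \<times> real \<Rightarrow> real" and k S
    by (rule continuous_on_compose2[OF that]) (auto intro: continuous_intros)
  have m_cont: "continuous_on UNIV (m i)" for i
    unfolding m_def using C1D(4)[OF Ca] C1D(5)[OF Cb] by (intro continuous_intros)
  \<comment> \<open>\<open>dual\<close> after translation by y and division by s, so that the bound
    scales with the size of g.\<close>
  have dual': "\<bar>LINT z|lborel. g z * m i (z + y)\<bar> \<le> C0 * s"
    if "i \<le> Suc n" "continuous_on UNIV g" "\<And>z. \<bar>g z\<bar> \<le> s" "\<And>z. g z \<noteq> 0 \<Longrightarrow> \<zeta> z \<noteq> 0" "norm y \<le> N" for i g s y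
  proof (cases "s = 0")
    case True
    then show ?thesis using that(3) by simp
  next
    case False
    have s: "s > 0" using False that(3)[of undefined] by linarith
    have eq: "(LINT z|lborel. g z * m i (z + y)) = (LINT z|lborel. g (z - y) * m i z)"
      using lborel_integral_translate[of "\<lambda>z. g (z - y) * m i z" y] m_cont[of i] tr[OF that(2), of UNIV "- y"]
      by (simp add: meas continuous_on_mult)
    have "\<bar>LINT z|lborel. (g (z - y) / s) * m i z\<bar> \<le> C0"
      unfolding m_def a\<^sub>t_def bx_def
    proof (rule dual[OF that(1)])
      show "(\<lambda>z. g (z - y) / s) \<in> borel_measurable borel"
        using meas[OF tr[OF that(2), of UNIV "- y"]] by simp
      show "\<bar>g (z - y) / s\<bar> \<le> 1" for z using that(3)[of "z - y"] s by simp
      show "\<exists>ya. \<zeta> ya \<noteq> 0 \<and> dist z ya \<le> norm h" if "g (z - y) / s \<noteq> 0" for z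
        using that \<open>norm y \<le> N\<close> \<open>\<And>z. g z \<noteq> 0 \<Longrightarrow> \<zeta> z \<noteq> 0\<close>
        by (intro exI[of _ "z - y"]) (auto simp: dist_norm N_def)
    qed
    moreover have "(LINT z|lborel. (g (z - y) / s) * m i z) = (LINT z|lborel. g (z - y) * m i z) / s"
      by simp
    ultimately show ?thesis unfolding eq using s by (simp add: field_simps)
  qed
  let ?S = "measure lborel (square c R)"
  \<comment> \<open>Only the first field moves with \<theta>; the increments \<open>v\<close> and
    \<open>w\<close> stay fixed.\<close>
  define G where "G \<theta> = (\<Sum>i\<le>n. LINT z|lborel. \<zeta> z * (a i (z + \<theta> *\<^sub>R h) * w i z - b i (z + \<theta> *\<^sub>R h) * v i z))" for \<theta>
  define G' where "G' \<theta> = (\<Sum>i\<le>n. LINT z|lborel. \<zeta> z * ((h1 * a\<^sub>t i (z + \<theta> *\<^sub>R h) + h2 * ax i (z + \<theta> *\<^sub>R h)) * w i z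
      - (h1 * bt i (z + \<theta> *\<^sub>R h) + h2 * bx i (z + \<theta> *\<^sub>R h)) * v i z))" for \<theta>
  have dG: "(G has_real_derivative G' \<theta>) (at \<theta>)" for \<theta>
    unfolding G_def G'_def
  proof (rule DERIV_sum)
    fix i
    obtain K1 where K1: "K1 \<ge> 0" "\<And>z s t. \<bar>a i (z + s *\<^sub>R h) - a i (z + t *\<^sub>R h)
       - (s - t) * (h1 * a\<^sub>t i (z + t *\<^sub>R h) + h2 * ax i (z + t *\<^sub>R h))\<bar> \<le> K1 * (s - t)\<^sup>2"
      using conv_directional_remainder[OF mA[of i] bA, where h = h] unfolding a_def a\<^sub>t_def ax_def h1_def h2_def by blast
    obtain K2 where K2: "K2 \<ge> 0" "\<And>z s t. \<bar>b i (z + s *\<^sub>R h) - b i (z + t *\<^sub>R h)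
       - (s - t) * (h1 * bt i (z + t *\<^sub>R h) + h2 * bx i (z + t *\<^sub>R h))\<bar> \<le> K2 * (s - t)\<^sup>2"
      using conv_directional_remainder[OF mB[of i] bB, where h = h] unfolding b_def bt_def bx_def h1_def h2_def by blast
    note cs = tr[OF C1D(3)[OF Ca]] tr[OF C1D(4)[OF Ca]] tr[OF C1D(5)[OF Ca]] tr[OF C1D(3)[OF Cb]] tr[OF C1D(4)[OF Cb]]
        tr[OF C1D(5)[OF Cb]] C1D(3)[OF Cv] C1D(3)[OF Cw] C1D(3)[OF \<zeta>]
    show "((\<lambda>\<theta>. LINT z|lborel. \<zeta> z * (a i (z + \<theta> *\<^sub>R h) * w i z - b i (z + \<theta> *\<^sub>R h) * v i z)) has_real_derivative
        (LINT z|lborel. \<zeta> z * ((h1 * a\<^sub>t i (z + \<theta> *\<^sub>R h) + h2 * ax i (z + \<theta> *\<^sub>R h)) * w i z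
      - (h1 * bt i (z + \<theta> *\<^sub>R h) + h2 * bx i (z + \<theta> *\<^sub>R h)) * v i z))) (at \<theta>)"
    proof (rule has_real_derivative_integral[where G = "\<lambda>z. (K1 + K2) * (2 * \<kappa>) * indicator (square c R) z"])
      show "integrable lborel (\<lambda>z. \<zeta> z * (a i (z + s *\<^sub>R h) * w i z - b i (z + s *\<^sub>R h) * v i z))" for s
        by (rule integrable_continuous_square[of _ c R], intro continuous_intros cs) (simp add: \<zeta>0)
      show "integrable lborel (\<lambda>z. \<zeta> z * ((h1 * a\<^sub>t i (z + \<theta> *\<^sub>R h) + h2 * ax i (z + \<theta> *\<^sub>R h)) * w i z
          - (h1 * bt i (z + \<theta> *\<^sub>R h) + h2 * bx i (z + \<theta> *\<^sub>R h)) * v i z))"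
        by (rule integrable_continuous_square[of _ c R], intro continuous_intros cs) (simp add: \<zeta>0)
      show "integrable lborel (\<lambda>z. (K1 + K2) * (2 * \<kappa>) * indicator (square c R) z :: real)"
        by (intro integrable_mult_right integrable_real_indicator) (auto simp: emeasure_lborel_cbox_eq)
      fix s z
      define r1 where "r1 = a i (z + s *\<^sub>R h) - a i (z + \<theta> *\<^sub>R h) - (s - \<theta>) * (h1 * a\<^sub>t i (z + \<theta> *\<^sub>R h) + h2 * ax i (z + \<theta> *\<^sub>R h))"
      define r2 where "r2 = b i (z + s *\<^sub>R h) - b i (z + \<theta> *\<^sub>R h) - (s - \<theta>) * (h1 * bt i (z + \<theta> *\<^sub>R h) + h2 * bx i (z + \<theta> *\<^sub>R h))"
      have eq: "\<zeta> z * (a i (z + s *\<^sub>R h) * w i z - b i (z + s *\<^sub>R h) * v i z) - \<zeta> z * (a i (z + \<theta> *\<^sub>R h) * w i z - b i (z + \<theta> *\<^sub>R h) * v i z)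
         - (s - \<theta>) * (\<zeta> z * ((h1 * a\<^sub>t i (z + \<theta> *\<^sub>R h) + h2 * ax i (z + \<theta> *\<^sub>R h)) * w i z
          - (h1 * bt i (z + \<theta> *\<^sub>R h) + h2 * bx i (z + \<theta> *\<^sub>R h)) * v i z)) = \<zeta> z * (r1 * w i z - r2 * v i z)"
        by (simp add: r1_def r2_def algebra_simps)
      have "\<bar>r1 * w i z\<bar> \<le> (K1 * (s - \<theta>)\<^sup>2) * (2 * \<kappa>)" "\<bar>r2 * v i z\<bar> \<le> (K2 * (s - \<theta>)\<^sup>2) * (2 * \<kappa>)"
        unfolding abs_mult r1_def r2_def using K1 K2 \<kappa> by (intro mult_mono K1(2) K2(2) v_bd w_bd; simp)+
      then have "\<bar>r1 * w i z - r2 * v i z\<bar> \<le> (s - \<theta>)\<^sup>2 * ((K1 + K2) * (2 * \<kappa>))" by (simp add: algebra_simps)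
      then have "\<bar>\<zeta> z\<bar> * \<bar>r1 * w i z - r2 * v i z\<bar> \<le> 1 * ((s - \<theta>)\<^sup>2 * ((K1 + K2) * (2 * \<kappa>)))"
        using \<zeta>1(1) by (intro mult_mono) auto
      then show "\<bar>\<zeta> z * (a i (z + s *\<^sub>R h) * w i z - b i (z + s *\<^sub>R h) * v i z) - \<zeta> z * (a i (z + \<theta> *\<^sub>R h) * w i z - b i (z + \<theta> *\<^sub>R h) * v i z)
         - (s - \<theta>) * (\<zeta> z * ((h1 * a\<^sub>t i (z + \<theta> *\<^sub>R h) + h2 * ax i (z + \<theta> *\<^sub>R h)) * w i z
          - (h1 * bt i (z + \<theta> *\<^sub>R h) + h2 * bx i (z + \<theta> *\<^sub>R h)) * v i z))\<bar>
         \<le> (s - \<theta>)\<^sup>2 * ((K1 + K2) * (2 * \<kappa>) * indicator (square c R) z)"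
        unfolding eq using \<zeta>0[of z] by (cases "z \<in> square c R") (auto simp: abs_mult)
    qed
  qed
  obtain \<theta> where \<theta>: "0 < \<theta>" "\<theta> < 1" "G 1 - G 0 = (1 - 0) * G' \<theta>"
    using MVT2[of 0 1 G G'] dG by auto
  define y where "y = \<theta> *\<^sub>R h"
  have y: "norm y \<le> N" using \<theta> by (simp add: y_def N_def mult_left_le_one_le)
  \<comment> \<open>The determinant of h with the field at the intermediate point: of size |h|, and
    changing by O(|h| \<kappa>) from one index to the next.\<close>
  define p where "p i z = h1 * b i (z + y) - h2 * a i (z + y)" for i z
  have p_cont: "continuous_on UNIV (p i)" for i
    unfolding p_def by (intro continuous_intros tr[OF C1D(3)[OF Ca]] tr[OF C1D(3)[OF Cb]])
  have two: "\<bar>h1 * q - h2 * r\<bar> \<le> 2 * N * s" if "\<bar>q\<bar> \<le> s" "\<bar>r\<bar> \<le> s" for q r s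
  proof -
    have "\<bar>h1 * q\<bar> \<le> N * s" "\<bar>h2 * r\<bar> \<le> N * s" unfolding abs_mult using that N by (intro mult_mono; simp)+
    then show ?thesis by linarith
  qed
  have p_bd: "\<bar>p i z\<bar> \<le> 2 * N * \<Gamma>" for i z unfolding p_def by (intro two a_bd b_bd)
  have dp: "\<bar>p (Suc i) z - p i z\<bar> \<le> 2 * N * \<kappa>" for i z
    using two[OF db da, of i "z + y" i "z + y"] by (simp add: p_def algebra_simps)
  \<comment> \<open>\<open>X i j\<close> pairs the weight of index i with the increment of the
    divergence of index j. A change of the first index gains a factor \<kappa>; a change of the
    second does not.\<close>
  define X where "X i j = (LINT z|lborel. \<zeta> z * p i z * (m j (z + h) - m j z))" for i j
  define T1 where "T1 i = (LINT z|lborel. \<zeta> z * (h1 * w i z - h2 * v i z) * m i (z + y))" for i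
  define T3 where "T3 i = (LINT z|lborel. p i z * (\<zeta>t z * v i z + \<zeta>x z * w i z))" for i
  have iX: "integrable lborel (\<lambda>z. g z * m j (z + k))" if "continuous_on UNIV g" "\<And>z. \<zeta> z = 0 \<Longrightarrow> g z = 0" for g j k
    by (rule integrable_continuous_square[of _ c R], intro continuous_intros tr[OF m_cont] that(1)) (simp add: \<zeta>0 that(2))
  have cg: "continuous_on UNIV (\<lambda>z. \<zeta> z * p i z)" for i by (intro continuous_intros p_cont C1D(3)[OF \<zeta>])
  have X_split: "(LINT z|lborel. g z * (m j (z + h) - m j z)) = (LINT z|lborel. g z * m j (z + h)) - (LINT z|lborel. g z * m j z)"
    if "continuous_on UNIV g" "\<And>z. \<zeta> z = 0 \<Longrightarrow> g z = 0" for g j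
    using iX[OF that, of j h] iX[OF that, of j 0] by (simp add: right_diff_distrib)
  have X_bound: "\<bar>LINT z|lborel. g z * (m j (z + h) - m j z)\<bar> \<le> 2 * C0 * s"
    if "j \<le> Suc n" "continuous_on UNIV g" "\<And>z. \<zeta> z = 0 \<Longrightarrow> g z = 0" "\<And>z. \<bar>g z\<bar> \<le> s" for g j s
  proof -
    have "\<bar>LINT z|lborel. g z * m j (z + k)\<bar> \<le> C0 * s" if "norm k \<le> N" for k
      by (rule dual'[OF \<open>j \<le> Suc n\<close> \<open>continuous_on UNIV g\<close> \<open>\<And>z. \<bar>g z\<bar> \<le> s\<close> _ that])
         (use \<open>\<And>z. \<zeta> z = 0 \<Longrightarrow> g z = 0\<close> in blast)
    from this[of h] this[of 0] have "\<bar>LINT z|lborel. g z * m j (z + h)\<bar> \<le> C0 * s" "\<bar>LINT z|lborel. g z * m j z\<bar> \<le> C0 * s"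
      using N(1) by (simp_all add: N_def)
    then show ?thesis using X_split[OF that(2,3), of j] by linarith
  qed
  have G'_eq: "G' \<theta> = (\<Sum>i\<le>n. T1 i + (X i (Suc i) - X i i) + T3 i)"
    unfolding G'_def
  proof (rule sum.cong[OF refl])
    fix i
    have "(LINT z|lborel. \<zeta> z * p i z * (vt i z + wx i z)) = X i (Suc i) - X i i"
    proof -
      have "integrable lborel (\<lambda>z. \<zeta> z * p i z * (m j (z + h) - m j z))" for j
        using iX[OF cg[of i], of j h] iX[OF cg[of i], of j 0] by (simp add: right_diff_distrib)
      then have "X i (Suc i) - X i i = (LINT z|lborel. \<zeta> z * p i z * (m (Suc i) (z + h) - m (Suc i) z) - \<zeta> z * p i z * (m i (z + h) - m i z))"
        unfolding X_def by simp
      also have "\<dots> = (LINT z|lborel. \<zeta> z * p i z * (vt i z + wx i z))"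
        by (intro Bochner_Integration.integral_cong refl) (simp add: m_def vt_def wx_def algebra_simps)
      finally show ?thesis by simp
    qed
    then show "(LINT z|lborel. \<zeta> z * ((h1 * a\<^sub>t i (z + \<theta> *\<^sub>R h) + h2 * ax i (z + \<theta> *\<^sub>R h)) * w i z
      - (h1 * bt i (z + \<theta> *\<^sub>R h) + h2 * bx i (z + \<theta> *\<^sub>R h)) * v i z)) = T1 i + (X i (Suc i) - X i i) + T3 i"
      using determinant_identity[OF C1_translate[OF Ca[of i], of y] C1_translate[OF Cb[of i], of y] Cv[of i] Cw[of i] \<zeta> \<zeta>0,
          where ?h1.0 = h1 and ?h2.0 = h2]
      by (simp add: T1_def T3_def p_def m_def y_def)
  qed
  have T1: "\<bar>T1 i\<bar> \<le> C0 * (4 * N * \<kappa>)" if "i \<le> n" for i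
    unfolding T1_def
  proof (rule dual')
    fix z
    have "\<bar>\<zeta> z\<bar> * \<bar>h1 * w i z - h2 * v i z\<bar> \<le> 1 * (2 * N * (2 * \<kappa>))"
      using \<zeta>1(1) by (intro mult_mono two v_bd w_bd) auto
    then show "\<bar>\<zeta> z * (h1 * w i z - h2 * v i z)\<bar> \<le> 4 * N * \<kappa>" by (simp add: abs_mult)
  qed (use that y in \<open>auto intro!: continuous_intros C1D(3)[OF \<zeta>] C1D(3)[OF Cv] C1D(3)[OF Cw]\<close>)
  have T3: "\<bar>T3 i\<bar> \<le> 8 * N * \<Gamma> * \<Lambda> * \<kappa> * ?S" for i
  proof -
    have \<zeta>d: "\<zeta>t z = 0" "\<zeta>x z = 0" if "z \<notin> square c R" for z
      using C1_zero_outside[OF \<zeta> closed_cbox \<zeta>0 that] by auto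
    have i: "integrable lborel (\<lambda>z. p i z * (\<zeta>t z * v i z + \<zeta>x z * w i z))"
      by (rule integrable_continuous_square[of _ c R],
          intro continuous_intros p_cont C1D(4,5)[OF \<zeta>] C1D(3)[OF Cv] C1D(3)[OF Cw]) (simp add: \<zeta>d)
    have "\<bar>T3 i\<bar> \<le> (LINT z|lborel. \<bar>p i z * (\<zeta>t z * v i z + \<zeta>x z * w i z)\<bar>)"
      unfolding T3_def by (rule integral_abs_bound)
    also have "\<dots> \<le> (LINT z|lborel. (8 * N * \<Gamma> * \<Lambda> * \<kappa>) * indicator (square c R) z)"
    proof (rule integral_mono)
      fix z
      have "\<bar>\<zeta>t z * v i z\<bar> \<le> \<Lambda> * (2 * \<kappa>)" "\<bar>\<zeta>x z * w i z\<bar> \<le> \<Lambda> * (2 * \<kappa>)"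
        unfolding abs_mult using \<Lambda> by (intro mult_mono \<zeta>1 v_bd w_bd; simp)+
      then have "\<bar>\<zeta>t z * v i z + \<zeta>x z * w i z\<bar> \<le> 4 * \<Lambda> * \<kappa>" by linarith
      then have "\<bar>p i z\<bar> * \<bar>\<zeta>t z * v i z + \<zeta>x z * w i z\<bar> \<le> (2 * N * \<Gamma>) * (4 * \<Lambda> * \<kappa>)"
        using N \<Gamma> by (intro mult_mono p_bd) auto
      then show "\<bar>p i z * (\<zeta>t z * v i z + \<zeta>x z * w i z)\<bar> \<le> (8 * N * \<Gamma> * \<Lambda> * \<kappa>) * indicator (square c R) z"
      proof (cases "z \<in> square c R")
        case True
        have "2 * N * \<Gamma> * (4 * \<Lambda> * \<kappa>) = 8 * N * \<Gamma> * \<Lambda> * \<kappa>" by simp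
        with \<open>\<bar>p i z\<bar> * _ \<le> _\<close> True show ?thesis by (simp add: abs_mult)
      qed (simp add: \<zeta>d)
    qed (use i in \<open>auto intro!: integrable_mult_right integrable_real_indicator simp: emeasure_lborel_cbox_eq\<close>)
    also have "\<dots> = 8 * N * \<Gamma> * \<Lambda> * \<kappa> * ?S" by simp
    finally show ?thesis .
  qed
  have cp_bd: "\<bar>\<zeta> z * p i z\<bar> \<le> 2 * N * \<Gamma>" for i z
    unfolding abs_mult using mult_mono[OF \<zeta>1(1)[of z] p_bd[of i z]] by simp
  have Xd: "\<bar>X (Suc i) (Suc i) - X i (Suc i)\<bar> \<le> 2 * C0 * (2 * N * \<kappa>)" if "i \<le> n" for i
  proof -
    have "integrable lborel (\<lambda>z. \<zeta> z * p k z * (m j (z + h) - m j z))" for j k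
      using iX[OF cg[of k], of j h] iX[OF cg[of k], of j 0] by (simp add: right_diff_distrib)
    then have "X (Suc i) (Suc i) - X i (Suc i) = (LINT z|lborel. \<zeta> z * p (Suc i) z * (m (Suc i) (z + h) - m (Suc i) z)
        - \<zeta> z * p i z * (m (Suc i) (z + h) - m (Suc i) z))"
      unfolding X_def by simp
    also have "\<dots> = (LINT z|lborel. (\<zeta> z * (p (Suc i) z - p i z)) * (m (Suc i) (z + h) - m (Suc i) z))"
      by (intro Bochner_Integration.integral_cong refl) (simp add: algebra_simps)
    also have "\<bar>\<dots>\<bar> \<le> 2 * C0 * (2 * N * \<kappa>)"
    proof (rule X_bound)
      show "continuous_on UNIV (\<lambda>z. \<zeta> z * (p (Suc i) z - p i z))"
        by (intro continuous_intros p_cont C1D(3)[OF \<zeta>])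
      show "\<bar>\<zeta> z * (p (Suc i) z - p i z)\<bar> \<le> 2 * N * \<kappa>" for z
        unfolding abs_mult using mult_mono[OF \<zeta>1(1)[of z] dp[of i z]] by simp
    qed (use that in auto)
    finally show ?thesis .
  qed
  have XX: "\<bar>X j j\<bar> \<le> 2 * C0 * (2 * N * \<Gamma>)" if "j \<le> Suc n" for j
    unfolding X_def by (rule X_bound[OF that cg]) (auto simp: cp_bd)
  \<comment> \<open>Summation by parts: the factor \<open>\<kappa>\<close> is moved from the divergences, where it is not available, to the fields.\<close>
  have tel: "(\<Sum>i\<le>n. X (Suc i) (Suc i) - X i i) = X (Suc n) (Suc n) - X 0 0"
    by (induction n) auto
  have sum_bd: "\<bar>sum f {..n}\<bar> \<le> (real n + 1) * K" if "\<And>i. i \<le> n \<Longrightarrow> \<bar>f i\<bar> \<le> K" for f :: "nat \<Rightarrow> real" and K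
    using order_trans[OF sum_abs sum_bounded_above[of "{..n}" "\<lambda>i. \<bar>f i\<bar>" K]] that by (simp add: add.commute)
  have "G' \<theta> = (\<Sum>i\<le>n. T1 i) + ((\<Sum>i\<le>n. X (Suc i) (Suc i) - X i i) - (\<Sum>i\<le>n. X (Suc i) (Suc i) - X i (Suc i))) + (\<Sum>i\<le>n. T3 i)"
    unfolding G'_eq by (simp add: sum.distrib sum_subtractf)
  moreover have "\<bar>\<Sum>i\<le>n. T1 i\<bar> \<le> (real n + 1) * (C0 * (4 * N * \<kappa>))"
    by (rule sum_bd[OF T1])
  moreover have "\<bar>\<Sum>i\<le>n. X (Suc i) (Suc i) - X i (Suc i)\<bar> \<le> (real n + 1) * (2 * C0 * (2 * N * \<kappa>))"
    by (rule sum_bd[OF Xd])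
  moreover have "\<bar>\<Sum>i\<le>n. T3 i\<bar> \<le> (real n + 1) * (8 * N * \<Gamma> * \<Lambda> * \<kappa> * ?S)"
    by (rule sum_bd[OF T3])
  moreover have "\<bar>\<Sum>i\<le>n. X (Suc i) (Suc i) - X i i\<bar> \<le> 2 * (2 * C0 * (2 * N * \<Gamma>))"
    unfolding tel using XX[of "Suc n"] XX[of 0] by simp
  ultimately have "\<bar>G' \<theta>\<bar> \<le> (real n + 1) * (C0 * (4 * N * \<kappa>)) + 2 * (2 * C0 * (2 * N * \<Gamma>))
     + (real n + 1) * (2 * C0 * (2 * N * \<kappa>)) + (real n + 1) * (8 * N * \<Gamma> * \<Lambda> * \<kappa> * ?S)" by linarith
  \<comment> \<open>8 C0 collects 4 C0 from \<open>T1\<close> and 4 C0 from the differences of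
    weights; 8 C0 \<Gamma> comes from the two boundary terms of the summation by parts.\<close>
  also have "\<dots> = N * ((real n + 1) * \<kappa> * (8 * C0 + 8 * \<Gamma> * \<Lambda> * ?S) + 8 * C0 * \<Gamma>)" by (simp add: algebra_simps)
  finally have bound: "\<bar>G' \<theta>\<bar> \<le> N * ((real n + 1) * \<kappa> * (8 * C0 + 8 * \<Gamma> * \<Lambda> * ?S) + 8 * C0 * \<Gamma>)" .
  \<comment> \<open>The parts of \<open>v\<close> and \<open>w\<close> with index i cancel by
    antisymmetry, leaving the mixed determinant of the fields i and i + 1.\<close>
  have "G 1 - G 0 = (\<Sum>i\<le>n. LINT z|lborel. \<zeta> z * ((a i (z + h) - a i z) * (b (Suc i) (z + h) - b (Suc i) z)
     - (b i (z + h) - b i z) * (a (Suc i) (z + h) - a (Suc i) z)))"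
    unfolding G_def sum_subtractf[symmetric]
  proof (rule sum.cong[OF refl])
    fix i
    have "integrable lborel (\<lambda>z. \<zeta> z * (a i (z + k) * w i z - b i (z + k) * v i z))" for k
      by (rule integrable_continuous_square[of _ c R],
          intro continuous_intros tr[OF C1D(3)[OF Ca]] tr[OF C1D(3)[OF Cb]] C1D(3)[OF Cv] C1D(3)[OF Cw] C1D(3)[OF \<zeta>]) (simp add: \<zeta>0)
    from this[of h] this[of 0] show "(LINT z|lborel. \<zeta> z * (a i (z + 1 *\<^sub>R h) * w i z - b i (z + 1 *\<^sub>R h) * v i z))
       - (LINT z|lborel. \<zeta> z * (a i (z + 0 *\<^sub>R h) * w i z - b i (z + 0 *\<^sub>R h) * v i z))
       = (LINT z|lborel. \<zeta> z * ((a i (z + h) - a i z) * (b (Suc i) (z + h) - b (Suc i) z)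
     - (b i (z + h) - b i z) * (a (Suc i) (z + h) - a (Suc i) z)))"
      by (simp flip: Bochner_Integration.integral_diff) (simp add: v_def w_def algebra_simps)
  qed
  then show ?thesis using bound \<theta>(3) by (simp add: a_def b_def N_def)
qed

end

section \<open>The pointwise lower bound\<close>

definition ramp :: "real \<Rightarrow> real" where
  "ramp x = max 0 (min 1 x)"

lemma ramp_nonneg: "0 \<le> ramp x" and ramp_le_1: "ramp x \<le> 1"
  and ramp_eq_0: "x \<le> 0 \<Longrightarrow> ramp x = 0" and ramp_eq_1: "1 \<le> x \<Longrightarrow> ramp x = 1"
  and ramp_id: "0 \<le> x \<Longrightarrow> x \<le> 1 \<Longrightarrow> ramp x = x" and ramp_mono: "x \<le> y \<Longrightarrow> ramp x \<le> ramp y"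
  by (auto simp: ramp_def)

text \<open>Total positivity of order two. For x \<le> 1 the negative product vanishes; for x > 1
  both unshifted ramps equal 1 and monotonicity remains.\<close>

lemma ramp_minor_nonneg:
  assumes "x \<le> y"
  shows "0 \<le> ramp x * ramp (y - 1) - ramp (x - 1) * ramp y"
proof (cases "x \<le> 1")
  case True
  then show ?thesis by (simp add: ramp_eq_0 ramp_nonneg)
next
  case False
  then show ?thesis using assms ramp_mono[of "x - 1" "y - 1"] by (simp add: ramp_eq_1)
qed

text \<open>As y exceeds x by two cells, the ramps in y have saturated wherever those in x do not
  vanish, and the sum telescopes. Two terms suffice: with j + 1 \<le> x \<le> j + 2 the terms j and
  j + 1 are j + 2 - x and x - j - 1.\<close>

lemma sum_ramp_minor_ge_1:
  assumes "1 \<le> x" "x + 2 \<le> y" "y \<le> real n + 1"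
  shows "1 \<le> (\<Sum>i\<le>n. ramp (x - real i) * ramp (y - real (Suc i)) - ramp (x - real (Suc i)) * ramp (y - real i))"
proof -
  let ?f = "\<lambda>i. ramp (x - real i) * ramp (y - real (Suc i)) - ramp (x - real (Suc i)) * ramp (y - real i)"
  define j where "j = nat \<lfloor>x\<rfloor> - 1"
  have x: "real (Suc j) \<le> x" "x \<le> real (Suc j) + 1"
    using assms(1) unfolding j_def by linarith+
  have j: "Suc j \<le> n" using x assms by linarith
  have "1 = ?f j + ?f (Suc j)"
    using x assms(2) by (simp add: ramp_eq_1 ramp_eq_0 ramp_id algebra_simps)
  also have "\<dots> = sum ?f {j, Suc j}" by simp
  also have "\<dots> \<le> (\<Sum>i\<le>n. ?f i)"
  proof (rule sum_mono2)
    fix i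
    show "0 \<le> ?f i" using ramp_minor_nonneg[of "x - real i" "y - real i"] assms(2) by (simp add: algebra_simps)
  qed (use j in auto)
  finally show ?thesis .
qed

text \<open>By antisymmetry of the sum S of minors, the right side is the integral of S v w (a' w -
  a' v) over r \<le> v \<le> w \<le> s. Since S \<ge> 0, and S \<ge> 1 for w - v \<ge> 2 \<delta>,
  the integrand is at least \<alpha> (w - v - 2 \<delta>), whose integral is the left side. The
  double integral is replaced by two monotonicity arguments: \<open>J\<close> is the derivative of
  \<open>H\<close> in the upper end point, and its own derivative in the lower end point is minus
  the integrand.\<close>

lemma interaction_lower_bound:
  fixes E Q \<psi> :: "nat \<Rightarrow> real \<Rightarrow> real" and a' :: "real \<Rightarrow> real"
  assumes E: "\<And>i v. (E i has_real_derivative \<psi> i v) (at v)"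
    and Q: "\<And>i v. (Q i has_real_derivative \<psi> i v * a' v) (at v)"
    and a': "\<And>v w. v \<le> w \<Longrightarrow> \<alpha> * (w - v) \<le> a' w - a' v" and \<alpha>: "\<alpha> > 0"
    and minor: "\<And>v w. v \<le> w \<Longrightarrow> 0 \<le> (\<Sum>i\<le>n. \<psi> i v * \<psi> (Suc i) w - \<psi> (Suc i) v * \<psi> i w)"
    and minor1: "\<And>v w. l \<le> v \<Longrightarrow> v + 2 * \<delta> \<le> w \<Longrightarrow> w \<le> m \<Longrightarrow>
       1 \<le> (\<Sum>i\<le>n. \<psi> i v * \<psi> (Suc i) w - \<psi> (Suc i) v * \<psi> i w)"
    and rs: "l \<le> r" "r \<le> s" "s \<le> m"
  shows "\<alpha> * ((s - r) ^ 3 / 6 - \<delta> * (s - r)\<^sup>2)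
    \<le> (\<Sum>i\<le>n. (E i s - E i r) * (Q (Suc i) s - Q (Suc i) r) - (E (Suc i) s - E (Suc i) r) * (Q i s - Q i r))"
proof -
  define H where "H s = (\<Sum>i\<le>n. (E i s - E i r) * (Q (Suc i) s - Q (Suc i) r) - (E (Suc i) s - E (Suc i) r) * (Q i s - Q i r))" for s
  define J where "J r s = (\<Sum>i\<le>n. \<psi> i s * (Q (Suc i) s - Q (Suc i) r) + (E i s - E i r) * (\<psi> (Suc i) s * a' s)
      - (\<psi> (Suc i) s * (Q i s - Q i r) + (E (Suc i) s - E (Suc i) r) * (\<psi> i s * a' s)))" for r s
  define S where "S v w = (\<Sum>i\<le>n. \<psi> i v * \<psi> (Suc i) w - \<psi> (Suc i) v * \<psi> i w)" for v w
  have dH: "(H has_real_derivative J r s) (at s)" for s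
    unfolding H_def J_def
    by (rule derivative_eq_intros E Q refl | simp add: algebra_simps)+
  have dJ: "((\<lambda>r. J r s) has_real_derivative - (S v s * (a' s - a' v))) (at v)" for s v
  proof -
    have "((\<lambda>r. J r s) has_real_derivative (\<Sum>i\<le>n. \<psi> i s * (0 - \<psi> (Suc i) v * a' v) + (0 - \<psi> i v) * (\<psi> (Suc i) s * a' s)
      - (\<psi> (Suc i) s * (0 - \<psi> i v * a' v) + (0 - \<psi> (Suc i) v) * (\<psi> i s * a' s)))) (at v)"
      unfolding J_def by (rule derivative_eq_intros E Q refl | simp add: algebra_simps)+
    also have "(\<Sum>i\<le>n. \<psi> i s * (0 - \<psi> (Suc i) v * a' v) + (0 - \<psi> i v) * (\<psi> (Suc i) s * a' s)
      - (\<psi> (Suc i) s * (0 - \<psi> i v * a' v) + (0 - \<psi> (Suc i) v) * (\<psi> i s * a' s))) = - (S v s * (a' s - a' v))"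
      unfolding S_def sum_distrib_right sum_negf[symmetric] by (intro sum.cong) (auto simp: algebra_simps)
    finally show ?thesis .
  qed
  have J: "\<alpha> * ((t - r)\<^sup>2 / 2 - 2 * \<delta> * (t - r)) \<le> J r t" if "r \<le> t" "t \<le> s" for t
  proof -
    let ?K = "\<lambda>v. J v t - \<alpha> * ((t - v)\<^sup>2 / 2 - 2 * \<delta> * (t - v))"
    have "?K t \<le> ?K r"
    proof (rule DERIV_nonpos_imp_nonincreasing[OF that(1)])
      fix v assume v: "r \<le> v" "v \<le> t"
      have "\<alpha> * (t - v - 2 * \<delta>) \<le> S v t * (a' t - a' v)"
      proof (cases "v + 2 * \<delta> \<le> t")
        case True
        then have "1 \<le> S v t" using minor1[of v t] v rs that by (auto simp: S_def)
        have d: "0 \<le> a' t - a' v" using a'[OF v(2)] \<alpha> v(2) by (smt (verit) mult_nonneg_nonneg)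
        have "\<alpha> * (t - v) \<le> 1 * (a' t - a' v)" using a'[OF v(2)] by simp
        also have "\<dots> \<le> S v t * (a' t - a' v)" using \<open>1 \<le> S v t\<close> d by (rule mult_right_mono)
        finally have *: "\<alpha> * (t - v) \<le> S v t * (a' t - a' v)" .
        show ?thesis
        proof (cases "0 \<le> \<delta>")
          case True
          then have "\<alpha> * (t - v - 2 * \<delta>) \<le> \<alpha> * (t - v)" using \<alpha> by (intro mult_left_mono) auto
          then show ?thesis using * by linarith
        next
          case False
          \<comment> \<open>A negative \<delta> would let \<open>minor1\<close> apply to equal
            arguments, where the antisymmetric sum is 0: a contradiction.\<close>
          have "1 \<le> S t t" using minor1[of t t] False v rs that by (auto simp: S_def)
          then show ?thesis by (simp add: S_def)
        qed
      next
        case False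
        then have "\<alpha> * (t - v - 2 * \<delta>) \<le> 0" using \<alpha> by (simp add: mult_nonneg_nonpos)
        moreover have "0 \<le> S v t" using minor[OF v(2)] by (simp add: S_def)
        moreover have "0 \<le> a' t - a' v" using a'[OF v(2)] \<alpha> v(2) by (smt (verit) mult_nonneg_nonneg)
        ultimately show ?thesis by (smt (verit) mult_nonneg_nonneg)
      qed
      moreover have "(?K has_real_derivative - (S v t * (a' t - a' v)) - \<alpha> * (2 * (t - v) * (0 - 1) / 2 - 2 * \<delta> * (0 - 1))) (at v)"
        by (rule derivative_eq_intros dJ refl | simp)+
      ultimately show "\<exists>y. (?K has_real_derivative y) (at v) \<and> y \<le> 0"
        by (intro exI conjI) (assumption, simp add: field_simps)
    qed
    moreover have "J t t = 0" by (simp add: J_def)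
    ultimately show ?thesis by simp
  qed
  let ?K = "\<lambda>t. H t - \<alpha> * ((t - r) ^ 3 / 6 - \<delta> * (t - r)\<^sup>2)"
  have "?K r \<le> ?K s"
  proof (rule DERIV_nonneg_imp_nondecreasing[OF rs(2)])
    fix t assume t: "r \<le> t" "t \<le> s"
    have "(?K has_real_derivative J r t - \<alpha> * (3 * (t - r)\<^sup>2 / 6 - \<delta> * (2 * (t - r)))) (at t)"
      by (rule derivative_eq_intros dH refl | simp)+
    then show "\<exists>y. (?K has_real_derivative y) (at t) \<and> 0 \<le> y"
      using J[OF t] by (intro exI conjI) (assumption, simp add: algebra_simps)
  qed
  moreover have "H r = 0" by (simp add: H_def)
  ultimately show ?thesis by (simp add: H_def)
qed

section \<open>Besov regularity\<close>

lemma integrable_bounded_square: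
  fixes f :: "real \<times> real \<Rightarrow> real"
  assumes "f \<in> borel_measurable borel" "\<And>z. \<bar>f z\<bar> \<le> B" "\<And>z. z \<notin> square c R \<Longrightarrow> f z = 0"
  shows "integrable lborel f"
proof (rule integrable_bounded_cbox[OF assms(1), of B])
  show "\<bar>f z\<bar> \<le> B * indicator (square c R) z" for z
    using assms(2,3)[of z] by (cases "z \<in> square c R") auto
qed

context mollifier
begin

text \<open>The divergence of the mollified field against g is the weak divergence of the field
  against the mollified g; the sign comes from the odd first derivative of the kernel. This carries
  the entropy bound, stated for smooth \<phi>, to the hypothesis \<open>dual\<close> of the
  interaction estimate.\<close>

lemma entropy_pairing_conv:
  assumes u: "u \<in> borel_measurable borel" and \<psi>: "continuous_on UNIV \<psi>" and a': "continuous_on UNIV a'"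
    and A: "\<And>z. \<bar>primitive \<psi> (u z)\<bar> \<le> \<Gamma>" and B: "\<And>z. \<bar>primitive (\<lambda>v. \<psi> v * a' v) (u z)\<bar> \<le> \<Gamma>"
    and g: "g \<in> borel_measurable borel" "\<And>z. \<bar>g z\<bar> \<le> 1" "\<And>z. z \<notin> square c R \<Longrightarrow> g z = 0"
  shows "(LINT z|lborel. g z * (conv (Suc 0) 0 (\<lambda>y. primitive \<psi> (u y)) z
      + conv 0 (Suc 0) (\<lambda>y. primitive (\<lambda>v. \<psi> v * a' v) (u y)) z)) = - entropy_pairing a' u \<psi> (conv 0 0 g)"
proof -
  let ?A = "\<lambda>y. primitive \<psi> (u y)" and ?B = "\<lambda>y. primitive (\<lambda>v. \<psi> v * a' v) (u y)"
  have mA: "?A \<in> borel_measurable borel"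
    using borel_measurable_continuous_onI[OF primitive_cont[OF \<psi>]] u by measurable
  have "continuous_on UNIV (\<lambda>v. \<psi> v * a' v)" using \<psi> a' by (intro continuous_intros)
  then have mB: "?B \<in> borel_measurable borel"
    using borel_measurable_continuous_onI[OF primitive_cont] u by measurable
  have \<Gamma>: "\<Gamma> \<ge> 0" using A[of undefined] by linarith
  have mc: "conv m n f \<in> borel_measurable borel" if "f \<in> borel_measurable borel" "\<And>y. \<bar>f y\<bar> \<le> C" for m n f C
    using conv_cont[OF that] by (rule borel_measurable_continuous_onI)
  have i1: "integrable lborel (\<lambda>z. g z * conv m n f z)" if "f \<in> borel_measurable borel" "\<And>y. \<bar>f y\<bar> \<le> \<Gamma>" for m n f
  proof (rule integrable_bounded_square[of _ "1 * (cmax m n * \<Gamma>)" c R])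
    show "(\<lambda>z. g z * conv m n f z) \<in> borel_measurable borel" using g(1) mc[OF that] by measurable
    show "\<bar>g z * conv m n f z\<bar> \<le> 1 * (cmax m n * \<Gamma>)" for z
      unfolding abs_mult using g(2) conv_bound_cmax[OF that] by (intro mult_mono) auto
  qed (simp add: g(3))
  have out: "conv m n g z = 0" if "z \<notin> square c (R + 2 * \<epsilon>)" for m n z
  proof (rule conv_eq_0)
    fix y assume d: "dist z y \<le> 2 * \<epsilon>"
    have "\<bar>fst z - fst y\<bar> \<le> dist z y" "\<bar>snd z - snd y\<bar> \<le> dist z y"
      using dist_fst_le[of z y] dist_snd_le[of z y] by (auto simp: dist_real_def)
    then have "y \<notin> square c R" using that d unfolding mem_square by linarith
    then show "g y = 0" by (rule g(3))
  qed
  have i2: "integrable lborel (\<lambda>z. f z * conv m n g z)" if "f \<in> borel_measurable borel" "\<And>y. \<bar>f y\<bar> \<le> \<Gamma>" for m n f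
  proof (rule integrable_bounded_square[of _ "\<Gamma> * (cmax m n * 1)" c "R + 2 * \<epsilon>"])
    show "(\<lambda>z. f z * conv m n g z) \<in> borel_measurable borel" using that(1) mc[OF g(1,2)] by measurable
    show "\<bar>f z * conv m n g z\<bar> \<le> \<Gamma> * (cmax m n * 1)" for z
      unfolding abs_mult using that(2) conv_bound_cmax[OF g(1,2)] \<Gamma> by (intro mult_mono) auto
  qed (simp add: out)
  have 1: "(LINT z|lborel. g z * conv (Suc 0) 0 ?A z) = - 1 * (LINT y|lborel. conv (Suc 0) 0 g y * ?A y)"
    by (rule integral_mult_conv[OF mA g(1) A g(2,3) kern_reflect(2)])
  have 2: "(LINT z|lborel. g z * conv 0 (Suc 0) ?B z) = - 1 * (LINT y|lborel. conv 0 (Suc 0) g y * ?B y)"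
    by (rule integral_mult_conv[OF mB g(1) B g(2,3) kern_reflect(3)])
  have "entropy_pairing a' u \<psi> (conv 0 0 g) = (LINT z|lborel. ?A z * conv (Suc 0) 0 g z) + (LINT z|lborel. ?B z * conv 0 (Suc 0) g z)"
    unfolding entropy_pairing_def pd_t_conv[OF g(1,2)] pd_x_conv[OF g(1,2)]
    by (intro Bochner_Integration.integral_add i2 mA mB A B)
  moreover have "(LINT z|lborel. g z * (conv (Suc 0) 0 ?A z + conv 0 (Suc 0) ?B z))
      = (LINT z|lborel. g z * conv (Suc 0) 0 ?A z) + (LINT z|lborel. g z * conv 0 (Suc 0) ?B z)"
    unfolding distrib_left by (intro Bochner_Integration.integral_add i1 mA mB A B)
  ultimately show ?thesis unfolding 1 2 by (simp add: mult.commute)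
qed

lemma conv_const: "conv 0 0 (\<lambda>_. c) z = c"
  by (simp add: conv_def integral_kern_diff)

text \<open>In x' y' - x y = x' (y' - y) + (x' - x) y the undifferenced factors are at most 2
  \<Gamma>, and each difference is at most L times the sum of the two oscillations.\<close>

lemma conv_product_error:
  assumes "u \<in> borel_measurable borel" "\<And>y. \<bar>u y\<bar> \<le> M"
    and V: "V \<in> borel_measurable borel" "\<And>y. \<bar>V (u y)\<bar> \<le> \<Gamma>" "\<And>y z. \<bar>V (u y) - V (u z)\<bar> \<le> L * \<bar>u y - u z\<bar>"
    and W: "W \<in> borel_measurable borel" "\<And>y. \<bar>W (u y)\<bar> \<le> \<Gamma>" "\<And>y z. \<bar>W (u y) - W (u z)\<bar> \<le> L * \<bar>u y - u z\<bar>"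
  shows "\<bar>(conv 0 0 (\<lambda>y. V (u y)) (z + h) - conv 0 0 (\<lambda>y. V (u y)) z) * (conv 0 0 (\<lambda>y. W (u y)) (z + h) - conv 0 0 (\<lambda>y. W (u y)) z)
     - (V (u (z + h)) - V (u z)) * (W (u (z + h)) - W (u z))\<bar> \<le> 4 * \<Gamma> * L * (osc u z + osc u (z + h))"
proof -
  have mV: "(\<lambda>y. V (u y)) \<in> borel_measurable borel" "(\<lambda>y. W (u y)) \<in> borel_measurable borel"
    using assms(1) V(1) W(1) by measurable
  define x' y' x y where "x' = conv 0 0 (\<lambda>y. V (u y)) (z + h) - conv 0 0 (\<lambda>y. V (u y)) z"
    and "y' = conv 0 0 (\<lambda>y. W (u y)) (z + h) - conv 0 0 (\<lambda>y. W (u y)) z"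
    and "x = V (u (z + h)) - V (u z)" and "y = W (u (z + h)) - W (u z)"
  let ?o = "L * (osc u z + osc u (z + h))"
  have \<Gamma>: "\<Gamma> \<ge> 0" using V(2)[of undefined] by linarith
  have "\<bar>x'\<bar> \<le> 2 * \<Gamma>" unfolding x'_def
    using conv_bound[of "\<lambda>y. V (u y)" \<Gamma> z] conv_bound[of "\<lambda>y. V (u y)" \<Gamma> "z + h"] mV V(2) by fastforce
  moreover have "\<bar>y\<bar> \<le> 2 * \<Gamma>" unfolding y_def using W(2)[of z] W(2)[of "z + h"] by linarith
  moreover have "\<bar>x' - x\<bar> \<le> ?o" unfolding x'_def x_def
    using conv_comp_diff_le_osc[OF assms(1) V(1) assms(2) V(2,3), of z] conv_comp_diff_le_osc[OF assms(1) V(1) assms(2) V(2,3), of "z + h"]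
    by (simp add: distrib_left)
  moreover have "\<bar>y' - y\<bar> \<le> ?o" unfolding y'_def y_def
    using conv_comp_diff_le_osc[OF assms(1) W(1) assms(2) W(2,3), of z] conv_comp_diff_le_osc[OF assms(1) W(1) assms(2) W(2,3), of "z + h"]
    by (simp add: distrib_left)
  ultimately have "\<bar>x' * (y' - y)\<bar> \<le> 2 * \<Gamma> * ?o" "\<bar>(x' - x) * y\<bar> \<le> ?o * (2 * \<Gamma>)"
    unfolding abs_mult using \<Gamma> by (intro mult_mono; simp)+
  moreover have "x' * y' - x * y = x' * (y' - y) + (x' - x) * y" by (simp add: algebra_simps)
  ultimately have "\<bar>x' * y' - x * y\<bar> \<le> 4 * \<Gamma> * L * (osc u z + osc u (z + h))" by (simp add: algebra_simps)
  then show ?thesis by (simp add: x'_def y'_def x_def y_def)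
qed

end

text \<open>Mollify, with radius d / 2, the indicator of the closed d-neighbourhood of K: points of
  K see only the value 1, and the support reaches at most d + d away from K.\<close>

lemma cutoff_exists:
  fixes K :: "(real \<times> real) set"
  assumes K: "compact K" and d: "d > 0"
  shows "\<exists>\<zeta> \<zeta>t \<zeta>x \<Lambda>. C1 \<zeta> \<zeta>t \<zeta>x \<and> (\<forall>z. 0 \<le> \<zeta> z \<and> \<zeta> z \<le> 1 \<and> \<bar>\<zeta>t z\<bar> \<le> \<Lambda> \<and> \<bar>\<zeta>x z\<bar> \<le> \<Lambda>)
    \<and> (\<forall>z\<in>K. \<zeta> z = 1) \<and> (\<forall>z. \<zeta> z \<noteq> 0 \<longrightarrow> (\<exists>x\<in>K. dist x z \<le> 2 * d))"
proof -
  obtain \<beta> where "mollifier \<beta> (d / 2)" using mollifier_exists[of "d / 2"] d by auto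
  then interpret mollifier \<beta> "d / 2" .
  define K1 where "K1 = {x + y |x y. x \<in> K \<and> y \<in> cball 0 d}"
  have "compact K1" unfolding K1_def using K by (intro compact_sums) auto
  then have "K1 \<in> sets borel" by (simp add: compact_imp_closed)
  then have m: "indicator K1 \<in> borel_measurable borel" by simp
  define \<zeta> where "\<zeta> = conv 0 0 (indicator K1)"
  have b: "\<bar>indicator K1 y :: real\<bar> \<le> 1" for y by (simp add: indicator_def)
  have C: "C1 \<zeta> (conv (Suc 0) 0 (indicator K1)) (conv 0 (Suc 0) (indicator K1))"
    unfolding \<zeta>_def by (rule C1_conv[OF m b])
  have "0 \<le> \<zeta> z" for z
    unfolding \<zeta>_def conv_def by (intro Bochner_Integration.integral_nonneg) (simp add: kern_nonneg)
  moreover have "\<zeta> z \<le> 1" for z using conv_bound[OF m b, of z] by (simp add: \<zeta>_def)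
  moreover have "\<zeta> z = 1" if "z \<in> K" for z
  proof -
    have "conv 0 0 (\<lambda>y. indicator K1 y - 1) z = 0"
    proof (rule conv_eq_0)
      fix y assume "dist z y \<le> 2 * (d / 2)"
      then have "y \<in> K1" unfolding K1_def using that
        by (intro CollectI exI[of _ z] exI[of _ "y - z"]) (auto simp: dist_norm norm_minus_commute)
      then show "indicator K1 y - 1 = (0::real)" by simp
    qed
    moreover have "conv 0 0 (\<lambda>y. indicator K1 y - 1) z = \<zeta> z - 1"
      unfolding \<zeta>_def using conv_diff[OF m b, of "\<lambda>_. 1" 0 0 z] by (simp add: conv_const)
    ultimately show ?thesis by simp
  qed
  moreover have "\<exists>x\<in>K. dist x z \<le> 2 * d" if "\<zeta> z \<noteq> 0" for z
  proof -
    have "\<exists>y. dist z y \<le> 2 * (d / 2) \<and> indicator K1 y \<noteq> (0::real)"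
      using that conv_eq_0[of z "indicator K1" 0 0] unfolding \<zeta>_def by blast
    then obtain y where y: "dist z y \<le> d" "y \<in> K1" by (auto simp: indicator_def split: if_splits)
    then obtain x e where "x \<in> K" "y = x + e" "norm e \<le> d" by (auto simp: K1_def)
    then have x: "x \<in> K" "dist x y \<le> d" by (auto simp: dist_norm)
    then show ?thesis using y dist_triangle[of x z y] by (intro bexI[of _ x]) (auto simp: dist_commute)
  qed
  moreover have "\<bar>conv (Suc 0) 0 (indicator K1) z\<bar> \<le> max (cmax (Suc 0) 0) (cmax 0 (Suc 0))"
    "\<bar>conv 0 (Suc 0) (indicator K1) z\<bar> \<le> max (cmax (Suc 0) 0) (cmax 0 (Suc 0))" for z
    using conv_bound_cmax[OF m b, of "Suc 0" 0 z] conv_bound_cmax[OF m b, of 0 "Suc 0" z] by auto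
  ultimately show ?thesis using C by blast
qed

text \<open>The mass of f sits in an interval of length w, so M does not enter the bound. Applied to
  differences of neighbouring ramps, it puts their fields O(\<delta>) apart.\<close>

lemma primitive_narrow_support:
  assumes "continuous_on UNIV f" "\<And>x. x \<in> {-M..M} \<Longrightarrow> \<bar>f x\<bar> \<le> B" "\<And>x. x \<notin> {l..l + w} \<Longrightarrow> f x = 0"
    and "\<bar>v\<bar> \<le> M" "0 \<le> w" "0 \<le> B"
  shows "\<bar>primitive f v\<bar> \<le> B * w"
proof -
  have *: "\<bar>integral {p..q} f\<bar> \<le> B * w" if "{p..q} \<subseteq> {-M..M}" for p q
  proof -
    let ?g = "\<lambda>x. if x \<in> {l..l + w} then B else 0"
    have int: "f integrable_on {p..q}"
      by (intro integrable_continuous_real continuous_on_subset[OF assms(1)]) auto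
    have ig: "?g integrable_on {p..q}"
      unfolding integrable_restrict_Int by (simp add: Int_atLeastAtMost integrable_const_ivl)
    have "norm (integral {p..q} f) \<le> integral {p..q} ?g"
    proof (rule integral_norm_bound_integral[OF int ig])
      show "norm (f x) \<le> ?g x" if "x \<in> {p..q}" for x
        using assms(2)[of x] assms(3)[of x] that \<open>{p..q} \<subseteq> {-M..M}\<close> by auto
    qed
    also have "integral {p..q} ?g = integral ({l..l + w} \<inter> {p..q}) (\<lambda>_. B)"
      by (rule integral_restrict_Int)
    also have "\<dots> = B * measure lborel {max l p..min (l + w) q}"
      by (simp add: Int_atLeastAtMost)
    also have "\<dots> \<le> B * w"
      using assms(5,6) by (intro mult_left_mono) (auto simp: content_real_if)
    finally show ?thesis by simp
  qed
  show ?thesis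
  proof (cases "0 \<le> v")
    case True
    have "integral {v..0} f = 0" using True by (cases "v = 0") auto
    then show ?thesis using *[of 0 v] assms(4) True by (simp add: primitive_def)
  next
    case False
    then show ?thesis using *[of v 0] assms(4) by (simp add: primitive_def)
  qed
qed

text \<open>The grid is chosen anew for each h, whereas everything that enters the constant, namely
  the entropy bound, the cutoff and the sup bounds, is fixed before h.\<close>

lemma besov_estimate:
  fixes u :: "real \<times> real \<Rightarrow> real" and a' :: "real \<Rightarrow> real"
  assumes mu: "u \<in> borel_measurable borel" and u: "\<And>z. \<bar>u z\<bar> \<le> M" and M: "M > 0"
    and a': "continuous_on UNIV a'" and \<alpha>: "\<alpha> > 0"
    and incr: "\<And>v w. v \<le> w \<Longrightarrow> \<alpha> * (w - v) \<le> a' w - a' v"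
    and \<Omega>: "open \<Omega>" and K: "compact K" "K \<subseteq> \<Omega>"
    and entropy: "\<And>\<eta> \<eta>' q. convex_on UNIV \<eta> \<Longrightarrow>
       (\<forall>v. (\<eta> has_real_derivative \<eta>' v) (at v)) \<Longrightarrow> continuous_on UNIV \<eta>' \<Longrightarrow>
       (\<forall>v. (q has_real_derivative \<eta>' v * a' v) (at v)) \<Longrightarrow>
       \<exists>\<mu>p \<mu>n. radon_on \<Omega> \<mu>p \<and> radon_on \<Omega> \<mu>n \<and>
         (\<forall>\<phi>. test_fun \<Omega> \<phi> \<longrightarrow>
            (LINT z|lborel. \<eta> (u z) * pd_t \<phi> z + q (u z) * pd_x \<phi> z)
            = (\<integral>z. \<phi> z \<partial>\<mu>p) - (\<integral>z. \<phi> z \<partial>\<mu>n))"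
  shows "\<exists>C>0. \<exists>d>0. \<forall>h. 0 < norm h \<longrightarrow> norm h \<le> d \<longrightarrow>
    (LINT z|lborel. indicator K z * \<bar>u (z + h) - u z\<bar> ^ 3) \<le> C * norm h"
proof -
  obtain e where e: "e > 0" "(\<Union>x\<in>K. cball x e) \<subseteq> \<Omega>"
    using compact_subset_open_imp_cball_epsilon_subset[OF K(1) \<Omega> K(2)] by blast
  \<comment> \<open>Four layers of width d around K stay in \<Omega>: two for the cutoff, one for
    the translation by h, one for the support of the mollifier.\<close>
  define d where "d = e / 4"
  have d: "d > 0" using e by (simp add: d_def)
  define K' where "K' = {x + y |x y. x \<in> K \<and> y \<in> cball 0 (4 * d)}"
  have "compact K'" unfolding K'_def using K by (intro compact_sums) auto
  have K'I: "z \<in> K'" if "x \<in> K" "dist x z \<le> 4 * d" for x z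
    unfolding K'_def using that
    by (intro CollectI exI[of _ x] exI[of _ "z - x"]) (auto simp: dist_norm norm_minus_commute)
  have "K' \<subseteq> \<Omega>"
  proof
    fix z assume "z \<in> K'"
    then obtain x y where "x \<in> K" "norm y \<le> 4 * d" "z = x + y" by (auto simp: K'_def)
    then have "z \<in> cball x e" by (simp add: d_def dist_norm)
    then show "z \<in> \<Omega>" using e(2) \<open>x \<in> K\<close> by blast
  qed
  have "\<exists>C\<ge>0. \<forall>\<psi> \<phi>. continuous_on UNIV \<psi> \<longrightarrow> mono \<psi> \<longrightarrow> (\<forall>v. \<bar>\<psi> v\<bar> \<le> 1) \<longrightarrow>
    test_fun \<Omega> \<phi> \<longrightarrow> tsupp \<phi> \<subseteq> K' \<longrightarrow> (\<forall>z. \<bar>\<phi> z\<bar> \<le> 1) \<longrightarrow> \<bar>entropy_pairing a' u \<psi> \<phi>\<bar> \<le> C"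
    by (rule uniform_entropy_production[OF mu u a' \<open>compact K'\<close> \<open>K' \<subseteq> \<Omega>\<close>]) (rule entropy)
  then obtain C0 where C0': "C0 \<ge> 0" "\<forall>\<psi> \<phi>. continuous_on UNIV \<psi> \<longrightarrow> mono \<psi> \<longrightarrow> (\<forall>v. \<bar>\<psi> v\<bar> \<le> 1) \<longrightarrow>
    test_fun \<Omega> \<phi> \<longrightarrow> tsupp \<phi> \<subseteq> K' \<longrightarrow> (\<forall>z. \<bar>\<phi> z\<bar> \<le> 1) \<longrightarrow> \<bar>entropy_pairing a' u \<psi> \<phi>\<bar> \<le> C0"
    by blast
  have "\<bar>entropy_pairing a' u \<psi> \<phi>\<bar> \<le> C0"
    if "continuous_on UNIV \<psi>" "mono \<psi>" "\<And>v. \<bar>\<psi> v\<bar> \<le> 1" "test_fun \<Omega> \<phi>" "tsupp \<phi> \<subseteq> K'" "\<And>z. \<bar>\<phi> z\<bar> \<le> 1" for \<psi> \<phi>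
    using C0'(2) that by blast
  note C0 = C0'(1) this
  obtain \<zeta> \<zeta>t \<zeta>x \<Lambda> where \<zeta>: "C1 \<zeta> \<zeta>t \<zeta>x" "\<And>z. 0 \<le> \<zeta> z" "\<And>z. \<zeta> z \<le> 1" "\<And>z. \<bar>\<zeta>t z\<bar> \<le> \<Lambda>" "\<And>z. \<bar>\<zeta>x z\<bar> \<le> \<Lambda>"
    "\<And>z. z \<in> K \<Longrightarrow> \<zeta> z = 1" "\<And>z. \<zeta> z \<noteq> 0 \<Longrightarrow> \<exists>x\<in>K. dist x z \<le> 2 * d"
    using cutoff_exists[OF K(1) d] by blast
  obtain R where "\<forall>x\<in>K'. norm x \<le> R" using \<open>compact K'\<close> by (meson bounded_iff compact_imp_bounded)
  then have out: "z \<notin> K'" if "z \<notin> square 0 R" for z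
    using that norm_fst_le[of "fst z" "snd z"] norm_snd_le[of "snd z" "fst z"] unfolding mem_square by force
  have \<zeta>0: "\<zeta> z = 0" if "z \<notin> square 0 R" for z
  proof (rule ccontr)
    assume "\<zeta> z \<noteq> 0"
    then obtain x where "x \<in> K" "dist x z \<le> 2 * d" using \<zeta>(7) by blast
    then have "z \<in> K'" using d by (intro K'I[of x]) auto
    then show False using out that by blast
  qed
  let ?S = "measure lborel (square 0 R)"
  have "bounded (a' ` {-M..M})"
    by (intro compact_imp_bounded compact_continuous_image continuous_on_subset[OF a']) auto
  then obtain L' where "\<forall>y\<in>a' ` {-M..M}. norm y \<le> L'" by (meson bounded_iff)
  then have L': "\<bar>a' v\<bar> \<le> L'" if "v \<in> {-M..M}" for v using that by simp
  \<comment> \<open>At least 1, so that it bounds \<psi> as well as \<psi> a', hence the Lipschitz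
    constants of entropies and fluxes.\<close>
  define L where "L = max 1 L'"
  have L1: "L \<ge> 1" by (simp add: L_def)
  have "\<bar>a' v\<bar> \<le> L" if "v \<in> {-M..M}" for v
    using order_trans[OF L'[OF that] max.cobounded2] by (auto simp: L_def)
  note L = L1 this
  define \<Gamma> where "\<Gamma> = L * M"
  have \<Gamma>: "\<Gamma> \<ge> 0" using L M by (simp add: \<Gamma>_def)
  have \<Lambda>: "\<Lambda> \<ge> 0" using \<zeta>(4)[of undefined] by linarith
  \<comment> \<open>8 M L bounds (n + 1) \<kappa>, since \<kappa> = 2 L \<delta> and (n + 1)
    \<delta> \<le> 4 M.\<close>
  define c1 where "c1 = 8 * M * L * (8 * C0 + 8 * \<Gamma> * \<Lambda> * ?S) + 8 * C0 * \<Gamma>"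
  have c1: "c1 \<ge> 0" unfolding c1_def using M L C0 \<Gamma> \<Lambda> by (intro add_nonneg_nonneg mult_nonneg_nonneg) auto
  have "(LINT z|lborel. indicator K z * \<bar>u (z + h) - u z\<bar> ^ 3) \<le> (6 * (c1 / \<alpha> + 4 * M\<^sup>2 * ?S) + 1) * norm h"
    if h: "0 < norm h" "norm h \<le> d" for h
  proof -
    \<comment> \<open>The smallest number of equal cells of [-M, M] for which the mesh \<delta> is
      at most |h|.\<close>
    define n where "n = nat \<lceil>2 * M / norm h\<rceil>"
    define \<delta> where "\<delta> = 2 * M / real n"
    have n: "2 * M / norm h \<le> real n" unfolding n_def by (rule real_nat_ceiling_ge)
    have "2 * M / norm h > 0" using M h by simp
    then have n1: "n \<ge> 1" using n by (cases n) auto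
    have \<delta>: "\<delta> > 0" "\<delta> \<le> norm h" "real n * \<delta> = 2 * M"
      using n1 M n h by (auto simp: \<delta>_def field_simps)
    have n\<delta>: "(real n + 1) * \<delta> \<le> 4 * M"
    proof -
      have "(real n + 1) * \<delta> \<le> (real n + real n) * \<delta>" using n1 \<delta> by (intro mult_right_mono) auto
      then show ?thesis using \<delta>(3) by (simp add: algebra_simps)
    qed
    \<comment> \<open>Ramp number i rises on [-M + (i - 1) \<delta>, -M + i \<delta>]. The shift by
      1 starts the grid one cell to the left of -M, so \<open>\<psi> 0\<close> equals 1 on the range
      of u and values in the first cell are resolved too.\<close>
    define \<psi> where "\<psi> i v = ramp ((v + M) / \<delta> + 1 - real i)" for i v
    define E where "E i = primitive (\<psi> i)" for i
    define Q where "Q i = primitive (\<lambda>v. \<psi> i v * a' v)" for i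
    have \<psi>_cont: "continuous_on UNIV (\<psi> i)" for i
      unfolding \<psi>_def ramp_def using \<delta> by (intro continuous_intros) auto
    have \<psi>a_cont: "continuous_on UNIV (\<lambda>v. \<psi> i v * a' v)" for i
      using \<psi>_cont a' by (intro continuous_intros)
    have \<psi>_mono: "mono (\<psi> i)" for i
      unfolding \<psi>_def using \<delta> by (intro monoI ramp_mono) (simp add: divide_right_mono)
    have \<psi>_bd: "\<bar>\<psi> i v\<bar> \<le> 1" for i v using ramp_nonneg ramp_le_1 by (simp add: \<psi>_def)
    have \<psi>_L: "\<bar>\<psi> i v\<bar> \<le> L" for i v using \<psi>_bd[of i v] L by linarith
    have \<psi>a_L: "\<bar>\<psi> i v * a' v\<bar> \<le> L" if "v \<in> {-M..M}" for i v
      unfolding abs_mult using mult_mono[OF \<psi>_bd[of i v] L(2)[OF that]] by simp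
    have E_bd: "\<bar>E i (u z)\<bar> \<le> \<Gamma>" for i z
      unfolding E_def \<Gamma>_def by (rule primitive_bound[OF \<psi>_cont]) (use \<psi>_L u in auto)
    have Q_bd: "\<bar>Q i (u z)\<bar> \<le> \<Gamma>" for i z
      unfolding Q_def \<Gamma>_def by (rule primitive_bound[OF \<psi>a_cont]) (use \<psi>a_L u in auto)
    have E_lip: "\<bar>E i (u y) - E i (u z)\<bar> \<le> L * \<bar>u y - u z\<bar>" for i y z
      unfolding E_def by (rule primitive_Lipschitz[OF \<psi>_cont, of M]) (use \<psi>_L u in auto)
    have Q_lip: "\<bar>Q i (u y) - Q i (u z)\<bar> \<le> L * \<bar>u y - u z\<bar>" for i y z
      unfolding Q_def by (rule primitive_Lipschitz[OF \<psi>a_cont, of M]) (use \<psi>a_L u in auto)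
    have E_m: "E i \<in> borel_measurable borel" and Q_m: "Q i \<in> borel_measurable borel" for i
      unfolding E_def Q_def by (intro borel_measurable_continuous_onI primitive_cont \<psi>_cont \<psi>a_cont)+
    have mE: "(\<lambda>z. E i (u z)) \<in> borel_measurable borel" and mQ: "(\<lambda>z. Q i (u z)) \<in> borel_measurable borel" for i
      using E_m[of i] Q_m[of i] mu by measurable
    \<comment> \<open>Neighbouring ramps differ on two adjacent cells at most, whence the width 2
      \<delta>.\<close>
    have \<psi>_narrow: "\<psi> (Suc i) v - \<psi> i v = 0" if "v \<notin> {- M + (real i - 1) * \<delta> .. - M + (real i - 1) * \<delta> + 2 * \<delta>}" for i v
    proof (cases "v < - M + (real i - 1) * \<delta>")
      case True
      then have "(v + M) / \<delta> < real i - 1" using \<delta> by (simp add: divide_less_eq)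
      then show ?thesis by (simp add: \<psi>_def ramp_eq_0)
    next
      case False
      then have "(v + M) / \<delta> > real i + 1" using that \<delta> by (simp add: less_divide_eq algebra_simps)
      then show ?thesis by (simp add: \<psi>_def ramp_eq_1)
    qed
    have \<psi>_diff: "\<bar>\<psi> (Suc i) v - \<psi> i v\<bar> \<le> 1" for i v
      using ramp_nonneg ramp_le_1 unfolding \<psi>_def by (smt (verit))
    have dE: "\<bar>E (Suc i) (u z) - E i (u z)\<bar> \<le> L * (2 * \<delta>)" for i z
    proof -
      have "\<bar>primitive (\<lambda>v. \<psi> (Suc i) v - \<psi> i v) (u z)\<bar> \<le> L * (2 * \<delta>)"
      proof (rule primitive_narrow_support)
        show "continuous_on UNIV (\<lambda>v. \<psi> (Suc i) v - \<psi> i v)" by (intro continuous_intros \<psi>_cont)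
        show "\<bar>\<psi> (Suc i) v - \<psi> i v\<bar> \<le> L" for v using \<psi>_diff[of i v] L by linarith
      qed (use \<psi>_narrow u \<delta> L in auto)
      then show ?thesis unfolding E_def by (subst (asm) primitive_diff[OF \<psi>_cont \<psi>_cont])
    qed
    have dQ: "\<bar>Q (Suc i) (u z) - Q i (u z)\<bar> \<le> L * (2 * \<delta>)" for i z
    proof -
      have "\<bar>primitive (\<lambda>v. \<psi> (Suc i) v * a' v - \<psi> i v * a' v) (u z)\<bar> \<le> L * (2 * \<delta>)"
      proof (rule primitive_narrow_support)
        show "continuous_on UNIV (\<lambda>v. \<psi> (Suc i) v * a' v - \<psi> i v * a' v)" by (intro continuous_intros \<psi>_cont a')
        show "\<bar>\<psi> (Suc i) v * a' v - \<psi> i v * a' v\<bar> \<le> L" if "v \<in> {-M..M}" for v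
          using mult_mono[OF \<psi>_diff[of i v] L(2)[OF that]] by (simp add: abs_mult[symmetric] left_diff_distrib)
        show "\<psi> (Suc i) v * a' v - \<psi> i v * a' v = 0"
          if "v \<notin> {- M + (real i - 1) * \<delta> .. - M + (real i - 1) * \<delta> + 2 * \<delta>}" for v
          using \<psi>_narrow[OF that] by simp
      qed (use u \<delta> L in auto)
      then show ?thesis unfolding Q_def by (subst (asm) primitive_diff[OF \<psi>a_cont \<psi>a_cont])
    qed
    define P where "P i z = (E i (u (z + h)) - E i (u z)) * (Q (Suc i) (u (z + h)) - Q (Suc i) (u z))
      - (Q i (u (z + h)) - Q i (u z)) * (E (Suc i) (u (z + h)) - E (Suc i) (u z))" for i z
    have tm: "(\<lambda>z. f (z + h)) \<in> borel_measurable borel" if "f \<in> borel_measurable borel" for f :: "real \<times> real \<Rightarrow> real"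
      using that by measurable
    have \<zeta>m: "\<zeta> \<in> borel_measurable borel" by (rule borel_measurable_continuous_onI[OF C1D(3)[OF \<zeta>(1)]])
    have P_m: "P i \<in> borel_measurable borel" for i
      unfolding P_def by (intro borel_measurable_diff borel_measurable_times mE mQ tm[OF mE] tm[OF mQ])
    have diff_bd: "\<bar>f (z + h) - f z\<bar> \<le> 2 * B" if "\<And>y. \<bar>f y\<bar> \<le> B" for f :: "real \<times> real \<Rightarrow> real" and B z
      using that[of z] that[of "z + h"] by linarith
    have P_bd: "\<bar>P i z\<bar> \<le> 8 * \<Gamma>\<^sup>2" for i z
    proof -
      have "\<bar>(E i (u (z + h)) - E i (u z)) * (Q (Suc i) (u (z + h)) - Q (Suc i) (u z))\<bar> \<le> (2 * \<Gamma>) * (2 * \<Gamma>)"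
        "\<bar>(Q i (u (z + h)) - Q i (u z)) * (E (Suc i) (u (z + h)) - E (Suc i) (u z))\<bar> \<le> (2 * \<Gamma>) * (2 * \<Gamma>)"
        unfolding abs_mult using \<Gamma>
        by (intro mult_mono diff_bd[of "\<lambda>y. E _ (u y)"] diff_bd[of "\<lambda>y. Q _ (u y)"] E_bd Q_bd; simp)+
      then show ?thesis unfolding P_def power2_eq_square by linarith
    qed
    have iP: "integrable lborel (\<lambda>z. \<zeta> z * P i z)" for i
    proof (rule integrable_bounded_square[of _ "1 * (8 * \<Gamma>\<^sup>2)" 0 R])
      show "(\<lambda>z. \<zeta> z * P i z) \<in> borel_measurable borel" using \<zeta>m P_m by measurable
      show "\<bar>\<zeta> z * P i z\<bar> \<le> 1 * (8 * \<Gamma>\<^sup>2)" for z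
        unfolding abs_mult using \<zeta>(2,3) P_bd by (intro mult_mono) auto
    qed (simp add: \<zeta>0)

    \<comment> \<open>For fixed h and n the mollification radius is made small: the bound
      \<open>smooth\<close> does not depend on it, and the error is below any given \<eta>.\<close>
    have upper: "\<bar>\<Sum>i\<le>n. LINT z|lborel. \<zeta> z * P i z\<bar> \<le> norm h * c1"
    proof (rule field_le_epsilon)
      fix \<eta> :: real assume \<eta>: "\<eta> > 0"
      \<comment> \<open>Each of the n + 1 terms has error at most 16 \<Gamma> L \<eta>'; the summand
        1 gives a positive denominator from \<Gamma> \<ge> 0 alone.\<close>
      define \<eta>' where "\<eta>' = \<eta> / ((real n + 1) * (16 * \<Gamma> * L) + 1)"
      have pos: "(real n + 1) * (16 * \<Gamma> * L) + 1 > 0" using \<Gamma> L by (intro add_nonneg_pos mult_nonneg_nonneg) auto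
      then have \<eta>': "\<eta>' > 0" using \<eta> by (simp add: \<eta>'_def)
      obtain r where r: "r > 0" "\<And>w. norm w < r \<Longrightarrow> (LINT z|lborel. indicator (square 0 (R + d)) z * \<bar>u (z + w) - u z\<bar>) \<le> \<eta>'"
        using L1_translation_continuous[OF mu u _ \<eta>', of "square 0 (R + d)"] by auto
      \<comment> \<open>d / 2 keeps the mollified test functions in the fourth layer around K; r / 3
        brings all shifts seen by the kernel below r.\<close>
      define \<epsilon> where "\<epsilon> = min (d / 2) (r / 3)"
      have \<epsilon>: "\<epsilon> > 0" "2 * \<epsilon> \<le> d" "2 * \<epsilon> < r" using d r by (auto simp: \<epsilon>_def min_def)
      obtain \<beta> where "mollifier \<beta> \<epsilon>" using mollifier_exists \<epsilon> by blast
      then interpret mollifier \<beta> \<epsilon> .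
      have small: "(LINT z|lborel. indicator (square 0 (R + d)) z * \<bar>u (z + w) - u z\<bar>) \<le> \<eta>'" if "norm w \<le> 2 * \<epsilon>" for w
        using r(2)[of w] that \<epsilon> by simp
      have osc_int: "integrable lborel (\<lambda>z. indicator (square 0 (R + d)) z * osc u z)"
        and osc_le: "(LINT z|lborel. indicator (square 0 (R + d)) z * osc u z) \<le> \<eta>'"
        by (rule osc_integral[OF mu u compact_cbox small], assumption)+
      define Pe where "Pe i z = (conv 0 0 (\<lambda>y. E i (u y)) (z + h) - conv 0 0 (\<lambda>y. E i (u y)) z) *
          (conv 0 0 (\<lambda>y. Q (Suc i) (u y)) (z + h) - conv 0 0 (\<lambda>y. Q (Suc i) (u y)) z)
        - (conv 0 0 (\<lambda>y. Q i (u y)) (z + h) - conv 0 0 (\<lambda>y. Q i (u y)) z) *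
          (conv 0 0 (\<lambda>y. E (Suc i) (u y)) (z + h) - conv 0 0 (\<lambda>y. E (Suc i) (u y)) z)" for i z
      have smooth: "\<bar>\<Sum>i\<le>n. LINT z|lborel. \<zeta> z * Pe i z\<bar>
        \<le> norm h * ((real n + 1) * (L * (2 * \<delta>)) * (8 * C0 + 8 * \<Gamma> * \<Lambda> * ?S) + 8 * C0 * \<Gamma>)"
        unfolding Pe_def
      proof (rule smoothed_interaction_bound[where A = "\<lambda>i y. E i (u y)" and B = "\<lambda>i y. Q i (u y)", OF mE mQ E_bd Q_bd dE dQ \<zeta>(1) \<zeta>0])
        show "\<bar>\<zeta> z\<bar> \<le> 1" for z using \<zeta>(2,3)[of z] by simp
        fix i and g :: "real \<times> real \<Rightarrow> real"
        assume g: "g \<in> borel_measurable borel" "\<And>z. \<bar>g z\<bar> \<le> 1" "\<And>z. g z \<noteq> 0 \<Longrightarrow> \<exists>y. \<zeta> y \<noteq> 0 \<and> dist z y \<le> norm h"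
        have near: "\<exists>x\<in>K. dist x z \<le> 3 * d" if gz: "g z \<noteq> 0" for z
        proof -
          obtain y where y: "\<zeta> y \<noteq> 0" "dist z y \<le> norm h" using g(3)[OF gz] by (elim exE conjE)
          obtain x where x: "x \<in> K" "dist x y \<le> 2 * d" using \<zeta>(7)[OF y(1)] by (elim bexE)
          have "dist x z \<le> 3 * d" using h y x dist_triangle[of x z y] by (simp add: dist_commute)
          then show ?thesis using x(1) by (rule bexI)
        qed
        have g0: "g z = 0" if "z \<notin> square 0 R" for z
        proof (rule ccontr)
          assume "g z \<noteq> 0"
          from near[OF this] obtain x where "x \<in> K" "dist x z \<le> 3 * d" by (elim bexE)
          then have "z \<in> K'" using d by (intro K'I[of x]) auto
          then show False using out[OF that] by simp
        qed
        have K'g: "z \<in> K'" if gy: "g y \<noteq> 0" "dist z y \<le> 2 * \<epsilon>" for z y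
        proof -
          obtain x where x: "x \<in> K" "dist x y \<le> 3 * d" using near[OF gy(1)] by (elim bexE)
          have "dist x z \<le> 4 * d" using x gy(2) \<epsilon> dist_triangle[of x z y] by (simp add: dist_commute)
          then show ?thesis by (rule K'I[OF x(1)])
        qed
        have "\<bar>entropy_pairing a' u (\<psi> i) (conv 0 0 g)\<bar> \<le> C0"
          by (intro C0(2) \<psi>_cont \<psi>_mono \<psi>_bd conv_bound[OF g(1,2)]
              test_fun_conv[OF g(1,2) \<open>compact K'\<close> \<open>K' \<subseteq> \<Omega>\<close> K'g])
        then show "\<bar>LINT z|lborel. g z * (conv (Suc 0) 0 (\<lambda>y. E i (u y)) z + conv 0 (Suc 0) (\<lambda>y. Q i (u y)) z)\<bar> \<le> C0"
          unfolding E_def Q_def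
          using entropy_pairing_conv[where c = 0 and R = R, OF mu \<psi>_cont[of i] a' E_bd[unfolded E_def] Q_bd[unfolded Q_def] g(1,2) g0] by simp
      qed (use \<zeta> in auto)
      have osc_h: "integrable lborel (\<lambda>z. indicator (square 0 (R + d)) (z + h) * osc u (z + h))"
        by (rule integrable_lborel_translate[OF osc_int])
      have osc_h_le: "(LINT z|lborel. indicator (square 0 (R + d)) (z + h) * osc u (z + h)) \<le> \<eta>'"
        using osc_le lborel_integral_translate[of "\<lambda>z. indicator (square 0 (R + d)) z * osc u z" h]
          borel_measurable_integrable[OF osc_int] by simp
      have err: "\<bar>(LINT z|lborel. \<zeta> z * Pe i z) - (LINT z|lborel. \<zeta> z * P i z)\<bar> \<le> 16 * \<Gamma> * L * \<eta>'" for i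
      proof -
        have cm: "conv 0 0 (\<lambda>y. E j (u y)) \<in> borel_measurable borel" "conv 0 0 (\<lambda>y. Q j (u y)) \<in> borel_measurable borel" for j
          by (intro borel_measurable_continuous_onI conv_cont[OF mE E_bd] conv_cont[OF mQ Q_bd])+
        have cb: "\<bar>conv 0 0 (\<lambda>y. E j (u y)) z\<bar> \<le> \<Gamma>" "\<bar>conv 0 0 (\<lambda>y. Q j (u y)) z\<bar> \<le> \<Gamma>" for j z
          by (rule conv_bound[OF mE E_bd] conv_bound[OF mQ Q_bd])+
        \<comment> \<open>Both products of the determinant contribute 4 \<Gamma> L. Enlarging R by d
          keeps z + h in the square when z lies in the square of radius R.\<close>
        have le: "\<bar>\<zeta> z * Pe i z - \<zeta> z * P i z\<bar> \<le> 8 * \<Gamma> * L * (indicator (square 0 (R + d)) z * osc u z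
            + indicator (square 0 (R + d)) (z + h) * osc u (z + h))" for z
        proof (cases "z \<in> square 0 R")
          case True
          have "\<bar>Pe i z - P i z\<bar> \<le> 4 * \<Gamma> * L * (osc u z + osc u (z + h)) + 4 * \<Gamma> * L * (osc u z + osc u (z + h))"
            using conv_product_error[OF mu u E_m[of i] E_bd E_lip Q_m[of "Suc i"] Q_bd Q_lip, of z h]
              conv_product_error[OF mu u Q_m[of i] Q_bd Q_lip E_m[of "Suc i"] E_bd E_lip, of z h]
            unfolding Pe_def P_def by linarith
          then have "\<bar>Pe i z - P i z\<bar> \<le> 8 * \<Gamma> * L * (osc u z + osc u (z + h))" by (simp add: mult.assoc mult.left_commute)
          moreover have "\<bar>fst h\<bar> \<le> d" "\<bar>snd h\<bar> \<le> d"
            using h norm_fst_le[of "fst h" "snd h"] norm_snd_le[of "snd h" "fst h"] by auto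
          then have "z \<in> square 0 (R + d)" "z + h \<in> square 0 (R + d)"
            using True d unfolding mem_square by auto
          moreover have "\<bar>\<zeta> z\<bar> * \<bar>Pe i z - P i z\<bar> \<le> \<bar>Pe i z - P i z\<bar>"
            using \<zeta>(2,3)[of z] by (intro mult_left_le_one_le) auto
          ultimately show ?thesis by (simp add: abs_mult flip: right_diff_distrib)
        next
          case False
          then show ?thesis using \<Gamma> L by (simp add: \<zeta>0 osc_nonneg)
        qed
        have iPe: "integrable lborel (\<lambda>z. \<zeta> z * Pe i z)"
        proof (rule integrable_continuous_square[of _ 0 R])
          show "continuous_on UNIV (\<lambda>z. \<zeta> z * Pe i z)"
            unfolding Pe_def
            by (intro continuous_intros C1D(3)[OF \<zeta>(1)] conv_cont[OF mE E_bd] conv_cont[OF mQ Q_bd]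
                C1D(3)[OF C1_translate[OF C1_conv[OF mE E_bd]]] C1D(3)[OF C1_translate[OF C1_conv[OF mQ Q_bd]]])
        qed (simp add: \<zeta>0)
        have "\<bar>(LINT z|lborel. \<zeta> z * Pe i z) - (LINT z|lborel. \<zeta> z * P i z)\<bar> = \<bar>LINT z|lborel. \<zeta> z * Pe i z - \<zeta> z * P i z\<bar>"
          using iPe iP by simp
        also have "\<dots> \<le> (LINT z|lborel. \<bar>\<zeta> z * Pe i z - \<zeta> z * P i z\<bar>)" by (rule integral_abs_bound)
        also have "\<dots> \<le> (LINT z|lborel. 8 * \<Gamma> * L * (indicator (square 0 (R + d)) z * osc u z
            + indicator (square 0 (R + d)) (z + h) * osc u (z + h)))"
          using iPe iP osc_int osc_h le
          by (intro integral_mono integrable_abs Bochner_Integration.integrable_diff integrable_mult_right Bochner_Integration.integrable_add) auto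
        also have "\<dots> = 8 * \<Gamma> * L * ((LINT z|lborel. indicator (square 0 (R + d)) z * osc u z)
            + (LINT z|lborel. indicator (square 0 (R + d)) (z + h) * osc u (z + h)))"
          using osc_int osc_h by simp
        also have "\<dots> \<le> 8 * \<Gamma> * L * (\<eta>' + \<eta>')"
          using \<Gamma> L osc_le osc_h_le by (intro mult_left_mono add_mono) auto
        finally show ?thesis by simp
      qed
      have "\<bar>(\<Sum>i\<le>n. LINT z|lborel. \<zeta> z * Pe i z) - (\<Sum>i\<le>n. LINT z|lborel. \<zeta> z * P i z)\<bar> \<le> (real n + 1) * (16 * \<Gamma> * L * \<eta>')"
        using order_trans[OF sum_abs sum_bounded_above[of "{..n}" "\<lambda>i. \<bar>(LINT z|lborel. \<zeta> z * Pe i z) - (LINT z|lborel. \<zeta> z * P i z)\<bar>" "16 * \<Gamma> * L * \<eta>'"]] err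
        by (simp add: sum_subtractf add.commute)
      also have "\<dots> \<le> \<eta>"
      proof -
        have "(real n + 1) * (16 * \<Gamma> * L * \<eta>') = ((real n + 1) * (16 * \<Gamma> * L)) * \<eta>'" by simp
        also have "\<dots> \<le> ((real n + 1) * (16 * \<Gamma> * L) + 1) * \<eta>'" using \<eta>' by (intro mult_right_mono) auto
        also have "\<dots> = \<eta>" using pos by (simp add: \<eta>'_def)
        finally show ?thesis .
      qed
      finally have 1: "\<bar>(\<Sum>i\<le>n. LINT z|lborel. \<zeta> z * Pe i z) - (\<Sum>i\<le>n. LINT z|lborel. \<zeta> z * P i z)\<bar> \<le> \<eta>" .
      have "(real n + 1) * (L * (2 * \<delta>)) = ((real n + 1) * \<delta>) * (2 * L)" by simp
      also have "\<dots> \<le> (4 * M) * (2 * L)" using n\<delta> L by (intro mult_right_mono) auto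
      finally have "(real n + 1) * (L * (2 * \<delta>)) * (8 * C0 + 8 * \<Gamma> * \<Lambda> * ?S) \<le> (8 * M * L) * (8 * C0 + 8 * \<Gamma> * \<Lambda> * ?S)"
        using C0 \<Gamma> \<Lambda> by (intro mult_right_mono) auto
      then have "norm h * ((real n + 1) * (L * (2 * \<delta>)) * (8 * C0 + 8 * \<Gamma> * \<Lambda> * ?S) + 8 * C0 * \<Gamma>) \<le> norm h * c1"
        unfolding c1_def by (intro mult_left_mono) auto
      then show "\<bar>\<Sum>i\<le>n. LINT z|lborel. \<zeta> z * P i z\<bar> \<le> norm h * c1 + \<eta>" using 1 smooth by linarith
    qed

    have minor: "0 \<le> \<psi> i v * \<psi> (Suc i) w - \<psi> (Suc i) v * \<psi> i w" if "v \<le> w" for i v w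
      using ramp_minor_nonneg[of "(v + M) / \<delta> + 1 - real i" "(w + M) / \<delta> + 1 - real i"] that \<delta>
      by (simp add: \<psi>_def divide_right_mono algebra_simps)
    \<comment> \<open>With x = (v + M) / \<delta> + 1 and y = (w + M) / \<delta> + 1 the range
      [-M, M] becomes [1, n + 1], as \<open>sum_ramp_minor_ge_1\<close> asks.\<close>
    have minor1: "1 \<le> (\<Sum>i\<le>n. \<psi> i v * \<psi> (Suc i) w - \<psi> (Suc i) v * \<psi> i w)"
      if "-M \<le> v" "v + 2 * \<delta> \<le> w" "w \<le> M" for v w
    proof -
      have "(v + M) / \<delta> + 2 = (v + 2 * \<delta> + M) / \<delta>" using \<delta> by (simp add: field_simps)
      also have "\<dots> \<le> (w + M) / \<delta>" using that \<delta> by (intro divide_right_mono) auto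
      finally have "(v + M) / \<delta> + 2 \<le> (w + M) / \<delta>" .
      moreover have "(w + M) / \<delta> \<le> real n" using that \<delta> by (simp add: divide_le_eq)
      moreover have "0 \<le> (v + M) / \<delta>" using that \<delta> by simp
      ultimately show ?thesis
        unfolding \<psi>_def by (intro sum_ramp_minor_ge_1) auto
    qed
    have lower0: "\<alpha> * ((s - r) ^ 3 / 6 - \<delta> * (s - r)\<^sup>2)
      \<le> (\<Sum>i\<le>n. (E i s - E i r) * (Q (Suc i) s - Q (Suc i) r) - (E (Suc i) s - E (Suc i) r) * (Q i s - Q i r))"
      if "-M \<le> r" "r \<le> s" "s \<le> M" for r s
    proof (rule interaction_lower_bound[OF _ _ incr \<alpha> _ minor1 that])
      show "(E i has_real_derivative \<psi> i v) (at v)" for i v unfolding E_def by (rule primitive_deriv[OF \<psi>_cont])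
      show "(Q i has_real_derivative \<psi> i v * a' v) (at v)" for i v unfolding Q_def by (rule primitive_deriv[OF \<psi>a_cont])
      show "0 \<le> (\<Sum>i\<le>n. \<psi> i v * \<psi> (Suc i) w - \<psi> (Suc i) v * \<psi> i w)" if "v \<le> w" for v w
        using minor[OF that] by (intro sum_nonneg) auto
    qed
    have lower: "\<alpha> * (\<bar>u (z + h) - u z\<bar> ^ 3 / 6 - \<delta> * \<bar>u (z + h) - u z\<bar>\<^sup>2) \<le> (\<Sum>i\<le>n. P i z)" for z
    proof (cases "u z \<le> u (z + h)")
      case True
      then show ?thesis using lower0[of "u z" "u (z + h)"] u[of z] u[of "z + h"]
        by (simp add: P_def abs_le_iff mult.commute)
    next
      case False
      \<comment> \<open>Exchanging the two values flips the sign of every increment, which leaves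
        the determinants unchanged.\<close>
      have "\<alpha> * ((u z - u (z + h)) ^ 3 / 6 - \<delta> * (u z - u (z + h))\<^sup>2)
        \<le> (\<Sum>i\<le>n. (E i (u z) - E i (u (z + h))) * (Q (Suc i) (u z) - Q (Suc i) (u (z + h)))
           - (E (Suc i) (u z) - E (Suc i) (u (z + h))) * (Q i (u z) - Q i (u (z + h))))"
        using False u[of z] u[of "z + h"] by (intro lower0) (auto simp: abs_le_iff)
      also have "\<dots> = (\<Sum>i\<le>n. P i z)"
        unfolding P_def by (intro sum.cong) (auto simp: algebra_simps)
      finally show ?thesis using False by (simp add: abs_if power2_commute)
    qed
    define U where "U z = \<bar>u (z + h) - u z\<bar>" for z
    have Um: "U \<in> borel_measurable borel" unfolding U_def using tm[OF mu] mu by measurable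
    have Ub: "0 \<le> U z" "U z \<le> 2 * M" for z using diff_bd[of u M, OF u] by (auto simp: U_def)
    have Uk: "U z ^ k \<le> (2 * M) ^ k" for z k using Ub[of z] by (intro power_mono) auto
    have iU: "integrable lborel (\<lambda>z. \<zeta> z * U z ^ k)" for k
    proof (rule integrable_bounded_square[of _ "1 * (2 * M) ^ k" 0 R])
      show "(\<lambda>z. \<zeta> z * U z ^ k) \<in> borel_measurable borel" using \<zeta>m Um by measurable
      show "\<bar>\<zeta> z * U z ^ k\<bar> \<le> 1 * (2 * M) ^ k" for z
        unfolding abs_mult using \<zeta>(2,3)[of z] Ub(1)[of z] Uk[of z k] by (intro mult_mono) (simp_all del: power_mult_distrib)
    qed (simp add: \<zeta>0)
    have "(LINT z|lborel. \<alpha> * (\<zeta> z * U z ^ 3 / 6 - \<delta> * (\<zeta> z * U z ^ 2))) \<le> (LINT z|lborel. (\<Sum>i\<le>n. \<zeta> z * P i z))"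
    proof (rule integral_mono)
      show "integrable lborel (\<lambda>z. \<alpha> * (\<zeta> z * U z ^ 3 / 6 - \<delta> * (\<zeta> z * U z ^ 2)))"
        using iU by simp
      show "integrable lborel (\<lambda>z. \<Sum>i\<le>n. \<zeta> z * P i z)" using iP by simp
      fix z
      have "\<zeta> z * (\<alpha> * (U z ^ 3 / 6 - \<delta> * U z ^ 2)) \<le> \<zeta> z * (\<Sum>i\<le>n. P i z)"
        unfolding U_def by (rule mult_left_mono[OF lower \<zeta>(2)])
      then show "\<alpha> * (\<zeta> z * U z ^ 3 / 6 - \<delta> * (\<zeta> z * U z ^ 2)) \<le> (\<Sum>i\<le>n. \<zeta> z * P i z)"
        by (simp add: sum_distrib_left algebra_simps)
    qed
    also have "\<dots> = (\<Sum>i\<le>n. LINT z|lborel. \<zeta> z * P i z)" using iP by simp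
    also have "\<dots> \<le> norm h * c1" using upper by linarith
    also have "(LINT z|lborel. \<alpha> * (\<zeta> z * U z ^ 3 / 6 - \<delta> * (\<zeta> z * U z ^ 2)))
        = \<alpha> * ((LINT z|lborel. \<zeta> z * U z ^ 3) / 6 - \<delta> * (LINT z|lborel. \<zeta> z * U z ^ 2))"
      using iU by simp
    finally have main: "(LINT z|lborel. \<zeta> z * U z ^ 3) / 6 - \<delta> * (LINT z|lborel. \<zeta> z * U z ^ 2) \<le> norm h * c1 / \<alpha>"
      using \<alpha> by (simp add: field_simps)
    have "(LINT z|lborel. \<zeta> z * U z ^ 2) \<le> (LINT z|lborel. (4 * M\<^sup>2) * indicator (square 0 R) z)"
    proof (rule integral_mono[OF iU])
      show "integrable lborel (\<lambda>z. (4 * M\<^sup>2) * indicator (square 0 R) z :: real)"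
        by (intro integrable_mult_right integrable_real_indicator) (auto simp: emeasure_lborel_cbox_eq)
      fix z
      have "\<zeta> z * U z ^ 2 \<le> 1 * (2 * M) ^ 2" using \<zeta>(2,3)[of z] Ub(1)[of z] Uk[of z 2] by (intro mult_mono) (simp_all del: power_mult_distrib)
      then show "\<zeta> z * U z ^ 2 \<le> (4 * M\<^sup>2) * indicator (square 0 R) z"
        using \<zeta>0[of z] by (cases "z \<in> square 0 R") (auto simp: power_mult_distrib)
    qed
    then have U2: "(LINT z|lborel. \<zeta> z * U z ^ 2) \<le> 4 * M\<^sup>2 * ?S" by simp
    \<comment> \<open>For bounded u the quadratic loss is O(\<delta>), and \<delta> \<le> |h| brings
      it to the order of the main bound.\<close>
    have "\<delta> * (LINT z|lborel. \<zeta> z * U z ^ 2) \<le> norm h * (4 * M\<^sup>2 * ?S)"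
      using \<delta> U2 \<zeta>(2) by (intro mult_mono Bochner_Integration.integral_nonneg) auto
    moreover have "x \<le> 6 * (p + q)" if "x / 6 - y \<le> p" "y \<le> q" for x y p q :: real using that by (simp add: field_simps)
    ultimately have *: "(LINT z|lborel. \<zeta> z * U z ^ 3) \<le> 6 * (norm h * c1 / \<alpha> + norm h * (4 * M\<^sup>2 * ?S))"
      using main by blast
    have "(LINT z|lborel. indicator K z * U z ^ 3) \<le> (LINT z|lborel. \<zeta> z * U z ^ 3)"
    proof (rule integral_mono'[OF iU])
      show "indicator K z * U z ^ 3 \<le> \<zeta> z * U z ^ 3" for z
        using \<zeta>(2)[of z] \<zeta>(6)[of z] Ub[of z] by (cases "z \<in> K") auto
      show "0 \<le> \<zeta> z * U z ^ 3" for z using \<zeta>(2) Ub by simp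
    qed
    also note *
    also have "6 * (norm h * c1 / \<alpha> + norm h * (4 * M\<^sup>2 * ?S)) \<le> (6 * (c1 / \<alpha> + 4 * M\<^sup>2 * ?S) + 1) * norm h"
      using h by (simp add: algebra_simps)
    finally show ?thesis by (simp add: U_def)
  qed
  moreover have "6 * (c1 / \<alpha> + 4 * M\<^sup>2 * ?S) + 1 > 0"
    using c1 \<alpha> by (intro add_nonneg_pos mult_nonneg_nonneg add_nonneg_nonneg) auto
  ultimately show ?thesis using d by blast
qed

theorem theorem1:
  fixes a a' a'' :: "real \<Rightarrow> real" and \<alpha>0 :: real
    and u_in :: "real \<Rightarrow> real" and u :: "real \<times> real \<Rightarrow> real"
  assumes a_deriv: "\<And>v. (a has_real_derivative a' v) (at v)"
    and a'_deriv: "\<And>v. (a' has_real_derivative a'' v) (at v)"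
    and a''_cont: "continuous_on UNIV a''"
    and alpha_pos: "\<alpha>0 > 0"
    and convex: "\<And>v. a'' v \<ge> \<alpha>0"
    and uin_meas: "u_in \<in> borel_measurable lborel"
    and uin_bdd: "\<exists>M. \<forall>x. \<bar>u_in x\<bar> \<le> M"
    and u_meas: "u \<in> borel_measurable lborel"
    and u_bdd: "\<exists>M. \<forall>z. \<bar>u z\<bar> \<le> M"
    and weak: "\<And>\<phi>. test_fun UNIV \<phi> \<Longrightarrow>
       (LINT z:({0<..} \<times> UNIV)|lborel. u z * pd_t \<phi> z + a (u z) * pd_x \<phi> z)
       + (LINT x|lborel. u_in x * \<phi> (0, x)) = 0"
    and entropy: "\<And>\<eta> \<eta>' q. convex_on UNIV \<eta> \<Longrightarrow>
       (\<forall>v. (\<eta> has_real_derivative \<eta>' v) (at v)) \<Longrightarrow> continuous_on UNIV \<eta>' \<Longrightarrow>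
       (\<forall>v. (q has_real_derivative \<eta>' v * a' v) (at v)) \<Longrightarrow>
       \<exists>\<mu>p \<mu>n. radon_on ({0<..} \<times> UNIV) \<mu>p \<and> radon_on ({0<..} \<times> UNIV) \<mu>n \<and>
         (\<forall>\<phi>. test_fun ({0<..} \<times> UNIV) \<phi> \<longrightarrow>
            (LINT z|lborel. \<eta> (u z) * pd_t \<phi> z + q (u z) * pd_x \<phi> z)
            = (\<integral>z. \<phi> z \<partial>\<mu>p) - (\<integral>z. \<phi> z \<partial>\<mu>n))"
  shows "besov_loc (1/3) 3 ({0<..} \<times> UNIV) u"
proof -
  let ?\<Omega> = "{0<..} \<times> UNIV :: (real \<times> real) set"
  have mu [measurable]: "u \<in> borel_measurable borel" using u_meas by simp
  obtain M0 where M0: "\<And>z. \<bar>u z\<bar> \<le> M0" using u_bdd by blast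
  \<comment> \<open>At least 1, so that the grid on [-M, M] has positive length.\<close>
  define M where "M = max 1 M0"
  have M: "M > 0" "\<And>z. \<bar>u z\<bar> \<le> M" using M0 by (auto simp: M_def intro: max.coboundedI2)
  have a'_cont: "continuous_on UNIV a'"
    using a'_deriv by (intro continuous_at_imp_continuous_on ballI) (rule DERIV_isCont)
  have incr: "\<alpha>0 * (w - v) \<le> a' w - a' v" if "v \<le> w" for v w
  proof -
    have "a' v - \<alpha>0 * v \<le> a' w - \<alpha>0 * w"
    proof (rule DERIV_nonneg_imp_nondecreasing[OF that])
      fix x
      have "((\<lambda>x. a' x - \<alpha>0 * x) has_real_derivative a'' x - \<alpha>0) (at x)"
        by (rule derivative_eq_intros a'_deriv refl | simp)+
      then show "\<exists>y. ((\<lambda>x. a' x - \<alpha>0 * x) has_real_derivative y) (at x) \<and> 0 \<le> y" using convex[of x] by auto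
    qed
    then show ?thesis by (simp add: algebra_simps)
  qed
  have op: "open ?\<Omega>" by (intro open_Times) auto
  have p3: "\<bar>r\<bar> powr 3 = \<bar>r\<bar> ^ 3" for r :: real
    by simp
  show ?thesis
    unfolding besov_loc_def
  proof (intro conjI allI impI)
    show "u \<in> borel_measurable lebesgue" using u_meas by (rule measurable_completion)
    fix K assume K: "compact K \<and> K \<subseteq> ?\<Omega>"
    have Kb: "K \<in> sets borel" using K by (simp add: compact_imp_closed)
    show "set_integrable lborel K (\<lambda>z. \<bar>u z\<bar> powr 3)"
      unfolding set_integrable_def p3
    proof (rule integrableI_bounded_set_indicator[where B = "M ^ 3"])
      show "emeasure lborel K < \<infinity>" using K emeasure_bounded_finite[OF compact_imp_bounded, of K] by simp
      have "\<bar>u z\<bar> ^ 3 \<le> M ^ 3" for z using M(2) by (intro power_mono) auto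
      then show "AE z in lborel. z \<in> K \<longrightarrow> norm (\<bar>u z\<bar> ^ 3) \<le> M ^ 3" by simp
    qed (use Kb in auto)
  next
    fix K assume K: "compact K \<and> K \<subseteq> ?\<Omega>"
    have "\<exists>C>0. \<exists>d>0. \<forall>h. 0 < norm h \<longrightarrow> norm h \<le> d \<longrightarrow>
        (LINT z|lborel. indicator K z * \<bar>u (z + h) - u z\<bar> ^ 3) \<le> C * norm h"
      by (rule besov_estimate[OF mu M(2,1) a'_cont alpha_pos incr op conjunct1[OF K] conjunct2[OF K]]) (assumption, rule entropy)
    then obtain C d where C: "C > 0" "d > 0" "\<And>h. 0 < norm h \<Longrightarrow> norm h \<le> d \<Longrightarrow>
        (LINT z|lborel. indicator K z * \<bar>u (z + h) - u z\<bar> ^ 3) \<le> C * norm h"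
      by blast
    have "(LINT z:K|lborel. \<bar>u (z + h) - u z\<bar> powr 3) \<le> C * norm h powr (1 / 3 * 3)" if "norm h \<le> d" for h
    \<comment> \<open>\<open>besov_estimate\<close> excludes h = 0, where its mesh would degenerate;
      there both sides vanish.\<close>
    proof (cases "h = 0")
      case False
      then show ?thesis using C(3)[of h] that by (simp add: set_lebesgue_integral_def p3)
    qed (simp add: set_lebesgue_integral_def)
    then show "\<exists>C h0. C > 0 \<and> h0 > 0 \<and> (\<forall>h. norm h \<le> h0 \<longrightarrow>
        (LINT z:K|lborel. \<bar>u (z + h) - u z\<bar> powr 3) \<le> C * norm h powr (1 / 3 * 3))"
      using C(1,2) by blast
  qed
qed

end
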